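(* (1) For every $n\ge2$, there exists no Haar trace on $U\langle n\rangle$ for the boolean convolution $\star_B$, none for the monotone convolution $\star_M$, and none for the anti-monotone convolution $\star_{AM}$. (2) For every $n\ge1$, there exists a Haar trace on $U\langle n\rangle$ for the free convolution $\star_F$, and there exists a Haar trace on $U\langle n\rangle$ for the tensor convolution $\star_T$.
   Context: Let $n\ge1$. $U_n^{nc}$ denotes the universal unital $*$-algebra generated by $n^2$ elements $u_{ij}$ ($1\le i,j\le n$) subject to $\sum_{k=1}^n u_{ki}^*u_{kj}=\delta_{ij}1=\sum_{k=1}^n u_{ik}u_{jk}^*$. $\mathcal A\sqcup\mathcal B$ denotes the free product of unital $*$-algebras; $a^{(1)},a^{(2)}$ denote the copies of $a\in U_n^{nc}$ in the first/second factor of $U_n^{nc}\sqcup U_n^{nc}$. The unital $*$-homomorphisms $\Delta(u_{ij})=\sum_k u_{ik}^{(1)}u_{kj}^{(2)}$, $\delta(u_{ij})=\delta_{ij}$, $\Sigma(u_{ij})=u_{ji}^*$ make $U\langle n\rangle=(U_n^{nc},\Delta,\delta,\Sigma)$ a dual group. Products of states: for $(\mathcal A_i,\phi_i)$ with $\mathcal A_i=\mathbb C1\oplus\mathcal A_i^0$, the unital functionals $\phi_1*\phi_2,\phi_1\otimes\phi_2,\phi_1\diamond\phi_2,\phi_1\rhd\phi_2,\phi_1\lhd\phi_2$ on $\mathcal A_1\sqcup\mathcal A_2$ are determined, for $A_i\in\mathcal A_{\epsilon_i}^0$ with $\epsilon_1\ne\epsilon_2\ne\cdots\ne\epsilon_m$,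 by: free: $\phi_1*\phi_2(A_1\cdots A_m)=0$ whenever all $\phi_{\epsilon_i}(A_i)=0$; tensor: $\phi_1(\prod_{\epsilon_i=1}A_i)\phi_2(\prod_{\epsilon_i=2}A_i)$; boolean: $\prod_i\phi_{\epsilon_i}(A_i)$; monotone: $\phi_1(\prod_{\epsilon_i=1}A_i)\prod_{\epsilon_i=2}\phi_2(A_i)$; anti-monotone: $\prod_{\epsilon_i=1}\phi_1(A_i)\,\phi_2(\prod_{\epsilon_i=2}A_i)$ (ordered products). Using $U_n^{nc}=\mathbb C1\oplus\ker\delta$, the free, tensor, boolean, monotone, anti-monotone convolutions of states $\phi,\psi$ on $U_n^{nc}$ are $(\phi*\psi)\circ\Delta$, $(\phi\otimes\psi)\circ\Delta$, $(\phi\diamond\psi)\circ\Delta$, $(\phi\rhd\psi)\circ\Delta$, $(\phi\lhd\psi)\circ\Delta$, denoted $\star_F,\star_T,\star_B,\star_M,\star_{AM}$. A state $\phi$ is tracial if $\phi(ab)=\phi(ba)$ for all $a,b$. A Haar trace for a convolution $\star$ is a tracial state $h$ on $U_n^{nc}$ such that $\phi\star h=h=h\star\phi$ for every tracial state $\phi$ on $U_n^{nc}$. *)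

theory Defs
  imports Complex_Main
begin

text \<open>Letters of the free unital *-algebra on generators u_ij (i,j in 'n):
  (i, j, False) stands for u_ij and (i, j, True) for u_ij^*.  A linear functional on
  the free *-algebra is given by its values on words (lists of letters); functionals on
  the quotient U_n^nc are those vanishing on the two-sided ideal of the relations.
  Polynomials (finite linear combinations of words) are lists of (coefficient, word).\<close>

type_synonym 'n ulet = "'n \<times> 'n \<times> bool"

type_synonym 'a pol = "(complex \<times> 'a list) list"

definition lin :: "('a list \<Rightarrow> complex) \<Rightarrow> 'a pol \<Rightarrow> complex" where
  "lin f p = (\<Sum>(c, w)\<leftarrow>p. c * f w)"

definition pmul :: "'a pol \<Rightarrow> 'a pol \<Rightarrow> 'a pol" where
  "pmul p q = [(c * d, v @ w). (c, v) \<leftarrow> p, (d, w) \<leftarrow> q]"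

definition pprod :: "'a pol list \<Rightarrow> 'a pol" where
  "pprod ps = foldr pmul ps [(1, [])]"

definition pmap :: "('a \<Rightarrow> 'b) \<Rightarrow> 'a pol \<Rightarrow> 'b pol" where
  "pmap g p = [(c, map g w). (c, w) \<leftarrow> p]"

definition wstar :: "'n ulet list \<Rightarrow> 'n ulet list" where
  "wstar w = rev (map (\<lambda>(i, j, b). (i, j, \<not> b)) w)"

definition pstar :: "'n ulet pol \<Rightarrow> 'n ulet pol" where
  "pstar p = [(cnj c, wstar w). (c, w) \<leftarrow> p]"

definition cou :: "'n ulet list \<Rightarrow> complex" where
  "cou w = prod_list (map (\<lambda>(i, j, b). if i = j then 1 else 0) w)"

definition vanishes_on_relations :: "('n::finite ulet list \<Rightarrow> complex) \<Rightarrow> bool" where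
  "vanishes_on_relations f \<longleftrightarrow>
     (\<forall>p q i j. (\<Sum>k\<in>UNIV. f (p @ [(k, i, True), (k, j, False)] @ q))
                  = (if i = j then f (p @ q) else 0)) \<and>
     (\<forall>p q i j. (\<Sum>k\<in>UNIV. f (p @ [(i, k, False), (j, k, True)] @ q))
                  = (if i = j then f (p @ q) else 0))"

definition is_state :: "('n::finite ulet list \<Rightarrow> complex) \<Rightarrow> bool" where
  "is_state f \<longleftrightarrow> vanishes_on_relations f \<and> f [] = 1 \<and>
     (\<forall>p. Im (lin f (pmul (pstar p) p)) = 0 \<and> 0 \<le> Re (lin f (pmul (pstar p) p)))"

definition is_tracial :: "('n ulet list \<Rightarrow> complex) \<Rightarrow> bool" where
  "is_tracial f \<longleftrightarrow> (\<forall>v w. f (v @ w) = f (w @ v))"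

datatype side = Fst | Snd

text \<open>Letters of the doubled alphabet: (l, Fst) is the copy l^(1), (l, Snd) is l^(2).
  An alternating list of elements: entries (s, A) with A a polynomial in copy s.\<close>

definition alternating :: "(side \<times> 'a) list \<Rightarrow> bool" where
  "alternating es \<longleftrightarrow> (\<forall>i. Suc i < length es \<longrightarrow> fst (es ! i) \<noteq> fst (es ! Suc i))"

definition prodE :: "(side \<times> 'l pol) list \<Rightarrow> ('l \<times> side) pol" where
  "prodE es = pprod (map (\<lambda>(s, p). pmap (\<lambda>l. (l, s)) p) es)"

definition ph :: "('l list \<Rightarrow> complex) \<Rightarrow> ('l list \<Rightarrow> complex) \<Rightarrow> side \<Rightarrow> ('l list \<Rightarrow> complex)" where
  "ph f g s = (case s of Fst \<Rightarrow> f | Snd \<Rightarrow> g)"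

definition parts :: "side \<Rightarrow> (side \<times> 'l pol) list \<Rightarrow> 'l pol list" where
  "parts s es = [p. (t, p) \<leftarrow> es, t = s]"

text \<open>A^0 = ker delta (the decomposition U_n^nc = C1 + ker delta).\<close>
definition centered :: "(side \<times> 'n ulet pol) list \<Rightarrow> bool" where
  "centered es \<longleftrightarrow> (\<forall>(s, p) \<in> set es. lin cou p = 0)"

type_synonym 'n dfun = "('n ulet \<times> side) list \<Rightarrow> complex"
type_synonym 'n ufun = "'n ulet list \<Rightarrow> complex"

definition free_prod :: "'n ufun \<Rightarrow> 'n ufun \<Rightarrow> 'n dfun \<Rightarrow> bool" where
  "free_prod f g F \<longleftrightarrow> F [] = 1 \<and>
     (\<forall>es. es \<noteq> [] \<and> alternating es \<and> (\<forall>(s, p) \<in> set es. lin (ph f g s) p = 0)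
            \<longrightarrow> lin F (prodE es) = 0)"

definition tensor_prod :: "'n ufun \<Rightarrow> 'n ufun \<Rightarrow> 'n dfun \<Rightarrow> bool" where
  "tensor_prod f g F \<longleftrightarrow> F [] = 1 \<and>
     (\<forall>es. alternating es \<and> centered es \<longrightarrow>
        lin F (prodE es) = lin f (pprod (parts Fst es)) * lin g (pprod (parts Snd es)))"

definition boolean_prod :: "'n ufun \<Rightarrow> 'n ufun \<Rightarrow> 'n dfun \<Rightarrow> bool" where
  "boolean_prod f g F \<longleftrightarrow> F [] = 1 \<and>
     (\<forall>es. alternating es \<and> centered es \<longrightarrow>
        lin F (prodE es) = prod_list (map (\<lambda>(s, p). lin (ph f g s) p) es))"

definition monotone_prod :: "'n ufun \<Rightarrow> 'n ufun \<Rightarrow> 'n dfun \<Rightarrow> bool" where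
  "monotone_prod f g F \<longleftrightarrow> F [] = 1 \<and>
     (\<forall>es. alternating es \<and> centered es \<longrightarrow>
        lin F (prodE es) = lin f (pprod (parts Fst es)) * prod_list (map (lin g) (parts Snd es)))"

definition antimonotone_prod :: "'n ufun \<Rightarrow> 'n ufun \<Rightarrow> 'n dfun \<Rightarrow> bool" where
  "antimonotone_prod f g F \<longleftrightarrow> F [] = 1 \<and>
     (\<forall>es. alternating es \<and> centered es \<longrightarrow>
        lin F (prodE es) = prod_list (map (lin f) (parts Fst es)) * lin g (pprod (parts Snd es)))"

text \<open>Delta(u_ij) = sum_k u_ik^(1) u_kj^(2), Delta(u_ij^*) = sum_k (u_kj^(2))^* (u_ik^(1))^*.\<close>
definition dl :: "'n ulet \<Rightarrow> 'n \<Rightarrow> ('n ulet \<times> side) list" where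
  "dl l k = (case l of (i, j, b) \<Rightarrow>
     if \<not> b then [((i, k, False), Fst), ((k, j, False), Snd)]
     else [((k, j, True), Snd), ((i, k, True), Fst)])"

text \<open>dsum F w = F(Delta(w)), with F extended linearly.\<close>
primrec dsum :: "'n::finite dfun \<Rightarrow> 'n ulet list \<Rightarrow> complex" where
  "dsum F [] = F []"
| "dsum F (l # w) = (\<Sum>k\<in>UNIV. dsum (\<lambda>v. F (dl l k @ v)) w)"

text \<open>The convolution (phi (product) psi) o Delta, the product being the unique functional
  characterised by the given product rule.\<close>
definition conv :: "('n ufun \<Rightarrow> 'n ufun \<Rightarrow> 'n dfun \<Rightarrow> bool) \<Rightarrow> 'n::finite ufun \<Rightarrow> 'n ufun \<Rightarrow> 'n ufun" where
  "conv P f g = dsum (THE F. P f g F)"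

definition haar_trace :: "('n ufun \<Rightarrow> 'n ufun \<Rightarrow> 'n dfun \<Rightarrow> bool) \<Rightarrow> 'n::finite ufun \<Rightarrow> bool" where
  "haar_trace P h \<longleftrightarrow> is_state h \<and> is_tracial h \<and>
     (\<forall>f. is_state f \<and> is_tracial f \<longrightarrow> conv P f h = h \<and> conv P h f = h)"

end

theory Submission
  imports Defs "HOL-Library.Poly_Mapping"
begin

text \<open>
  All five products prescribe a functional on the alternating products of centred elements, and these
  span the free product, so each product exists and is unique.

  If the trace \<open>f\<close> kills the generators, then a boolean, monotone or anti-monotone product with \<open>f\<close> on
  the outside sees only the scalar part of the inner factor of \<open>\<Delta>(u\<^sub>i\<^sub>j u\<^sub>k\<^sub>l\<^sup>*)\<close> or
  \<open>\<Delta>(u\<^sub>i\<^sub>j\<^sup>* u\<^sub>k\<^sub>l)\<close>. A Haar trace would therefore agree with \<open>f\<close> on these elements, while they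
  separate two such \<open>f\<close> as soon as \<open>n \<ge> 2\<close>.

  For the free convolution, the Haar trace is given by the entries of a Haar unitary \<open>U\<close> that is free from
  the scalar matrices. It is realised in the group algebra of a free group as \<open>S H W H\<^sup>* T\<close>, with \<open>S\<close>, \<open>W\<close>,
  \<open>T\<close> diagonal matrices of free generators and \<open>H\<close> a complex Hadamard matrix, and it is characterised by
  vanishing on the products \<open>U\<^sup>e B U\<^sup>e' B' \<dots>\<close> in which the scalar matrices between powers of opposite sign
  are traceless.

  For the tensor convolution, the Haar trace is \<open>u\<^sub>i\<^sub>j = w e\<^sub>j\<^sub>i\<close> in the crossed product of the infinite tensor
  power of the \<open>n \<times> n\<close> matrices, indexed by the integers, by the shift \<open>w\<close>. It is the limit of the normalised
  traces of the operators by which words act on a queue of \<open>m\<close> indices: \<open>u\<^sub>i\<^sub>j\<close> removes \<open>i\<close> at the front and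
  appends \<open>j\<close> at the back. Up to a cyclic rotation of the word the two ends of the queue do not interact, and
  the pairing of first indices at the front is exactly the one that the relations of any trace reproduce.
\<close>

section \<open>The free algebra on an alphabet\<close>

text \<open>\<open>conv\<close> selects its product functional by \<open>THE\<close>, so a product
  rule says nothing about a convolution until existence and uniqueness are known. Functionals live
  on words and not on the quotient, so every comparison has to carry the unitarity relations along.

  In the free case no moment is computed. Multiplying the Haar unitary on the left by U with law f
  turns a scalar matrix B between powers of opposite sign into B or \<open>U\<^sup>* B U\<close>,
  and traciality of f keeps the expected trace of the latter at tr B = 0. The Hadamard matrix is
  chosen because its entries all have modulus 1/sqrt n, so that for diagonal B every diagonal entry
  of \<open>H\<^sup>* B H\<close> is tr B / n; off-diagonal entries of B are separated by the free
  letters in S and T.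

  In the tensor case the left factor f only alters first indices in the words that h sees. It is
  therefore enough that h factors into a function of the first indices and one of the second. The
  queue does so once the word is rotated until every suffix has at least as many starred as
  unstarred letters.\<close>

instantiation list :: (type) monoid_add
begin
definition "zero_list = ([] :: 'a list)"
definition "plus_list = ((@) :: 'a list \<Rightarrow> 'a list \<Rightarrow> 'a list)"
instance by standard (simp_all add: zero_list_def plus_list_def)
end

text \<open>\<open>Poly_Mapping\<close> multiplies by convolution over an additively written index
  monoid; with concatenation as the sum this is the free algebra.\<close>

type_synonym 'a alg = "'a list \<Rightarrow>\<^sub>0 complex"

definition wd :: "'a list \<Rightarrow> 'a alg" where "wd w = Poly_Mapping.single w 1"
text \<open>Scalars are multiples of the empty word, so scaling is ring multiplication, and
  linearity means additivity together with a rule for \<open>sc c * a\<close>.\<close>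

definition sc :: "complex \<Rightarrow> 'a alg" where "sc c = Poly_Mapping.single [] c"

definition lf :: "('a list \<Rightarrow> complex) \<Rightarrow> 'a alg \<Rightarrow> complex" where
  "lf f a = (\<Sum>w\<in>Poly_Mapping.keys a. Poly_Mapping.lookup a w * f w)"

lemma one_alg: "(1 :: 'a alg) = wd []"
  by (simp add: wd_def flip: zero_list_def)

lemma wd_append: "wd (v @ w) = wd v * wd w"
  by (simp add: wd_def mult_single plus_list_def)

lemma sc_wd: "sc c * wd w = Poly_Mapping.single w c"
  by (simp add: wd_def sc_def mult_single plus_list_def)

lemma wd_sc: "wd w * sc c = Poly_Mapping.single w c"
  by (simp add: wd_def sc_def mult_single plus_list_def)

lemma sc_0 [simp]: "sc 0 = 0" and sc_1 [simp]: "sc 1 = 1"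
  by (simp_all add: sc_def one_alg wd_def)

lemma sc_add: "sc (c + d) = sc c + sc d" by (simp add: sc_def single_add)
lemma sc_diff: "sc (c - d) = sc c - sc d" by (simp add: sc_def single_diff)
lemma sc_uminus: "sc (- c) = - sc c" by (simp add: sc_def single_uminus)
lemma sc_mult: "sc (c * d) = sc c * sc d" by (simp add: sc_def mult_single plus_list_def)

lemma alg_expand: "a = (\<Sum>w\<in>Poly_Mapping.keys a. sc (Poly_Mapping.lookup a w) * wd w)"
proof (rule poly_mapping_eqI)
  fix v
  have "Poly_Mapping.lookup (\<Sum>w\<in>Poly_Mapping.keys a. sc (Poly_Mapping.lookup a w) * wd w) v
     = (\<Sum>w\<in>Poly_Mapping.keys a. if w = v then Poly_Mapping.lookup a w else 0)"
    by (simp add: sc_wd lookup_sum lookup_single when_def)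
  also have "\<dots> = Poly_Mapping.lookup a v"
    by (simp add: sum.delta' in_keys_iff)
  finally show "Poly_Mapping.lookup a v =
    Poly_Mapping.lookup (\<Sum>w\<in>Poly_Mapping.keys a. sc (Poly_Mapping.lookup a w) * wd w) v" by simp
qed

lemma alg_induct [case_names zero add word]:
  assumes "P 0" "\<And>a b. P a \<Longrightarrow> P b \<Longrightarrow> P (a + b)" "\<And>c w. P (sc c * wd w)"
  shows "P a"
proof -
  have "P (\<Sum>w\<in>S. sc (g w) * wd w)" if "finite S" for S g
    using that by (induction S) (simp_all add: assms)
  then show ?thesis by (subst alg_expand) simp
qed

lemma sc_comm: "a * sc c = sc c * a"
proof (induction a rule: alg_induct)
  case (word d w)
  have "sc d * wd w * sc c = sc d * (sc c * wd w)" by (simp only: mult.assoc) (simp add: wd_sc sc_wd)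
  also have "\<dots> = sc c * (sc d * wd w)" 
    by (simp only: mult.assoc[symmetric] sc_mult[symmetric] mult.commute[of d c])
  finally show ?case .
qed (simp_all add: algebra_simps)

lemma sc_comm_left: "a * (sc c * b) = sc c * (a * b)"
  by (metis mult.assoc sc_comm)

lemma lf_superset:
  assumes "finite S" "Poly_Mapping.keys a \<subseteq> S"
  shows "lf f a = (\<Sum>w\<in>S. Poly_Mapping.lookup a w * f w)"
  unfolding lf_def using assms
  by (intro sum.mono_neutral_left) (auto simp: in_keys_iff)

lemma lf_0 [simp]: "lf f 0 = 0" by (simp add: lf_def)

lemma lf_add: "lf f (a + b) = lf f a + lf f b"
proof -
  let ?S = "Poly_Mapping.keys a \<union> Poly_Mapping.keys b"
  have "lf f (a + b) = (\<Sum>w\<in>?S. Poly_Mapping.lookup (a + b) w * f w)"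
    by (rule lf_superset) (auto simp: keys_add)
  also have "\<dots> = (\<Sum>w\<in>?S. Poly_Mapping.lookup a w * f w) + (\<Sum>w\<in>?S. Poly_Mapping.lookup b w * f w)"
    by (simp add: lookup_add algebra_simps sum.distrib)
  finally show ?thesis using lf_superset[of ?S] by simp
qed

lemma lf_single: "lf f (Poly_Mapping.single w c) = c * f w"
  by (simp add: lf_def)

lemma lf_wd [simp]: "lf f (wd w) = f w" by (simp add: wd_def lf_single)
lemma lf_sc: "lf f (sc c) = c * f []" by (simp add: sc_def lf_single)
lemma lf_1: "lf f 1 = f []" by (simp add: one_alg)

lemma lf_scale: "lf f (sc c * a) = c * lf f a"
proof (induction a rule: alg_induct)
  case (word d w)
  then show ?case by (metis lf_single mult.assoc sc_mult sc_wd)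
qed (simp_all add: lf_add algebra_simps)

lemma lf_uminus: "lf f (- a) = - lf f a"
  using lf_scale[of f "-1" a] by (simp add: sc_uminus)

lemma lf_diff: "lf f (a - b) = lf f a - lf f b"
  using lf_add[of f a "- b"] by (simp add: lf_uminus)

lemma lf_sum: "lf f (sum g S) = (\<Sum>x\<in>S. lf f (g x))"
  by (induction S rule: infinite_finite_induct) (simp_all add: lf_add)

text \<open>Recursions that feed a prefix to a functional, such as \<open>dsum\<close>, become left
  multiplications in the algebra.\<close>

lemma lf_wd_left: "lf (\<lambda>v. f (u @ v)) a = lf f (wd u * a)"
  by (induction a rule: alg_induct)
    (simp_all add: lf_add lf_scale sc_comm_left algebra_simps flip: wd_append)

section \<open>Unital homomorphisms out of the free algebra\<close>

definition alg_hom :: "('a \<Rightarrow> 'b alg) \<Rightarrow> 'a alg \<Rightarrow> 'b alg" where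
  "alg_hom g a = (\<Sum>w\<in>Poly_Mapping.keys a. sc (Poly_Mapping.lookup a w) * prod_list (map g w))"

lemma alg_hom_superset:
  assumes "finite S" "Poly_Mapping.keys a \<subseteq> S"
  shows "alg_hom g a = (\<Sum>w\<in>S. sc (Poly_Mapping.lookup a w) * prod_list (map g w))"
  unfolding alg_hom_def using assms
  by (intro sum.mono_neutral_left) (auto simp: in_keys_iff)

lemma alg_hom_0 [simp]: "alg_hom g 0 = 0" by (simp add: alg_hom_def)

lemma alg_hom_add: "alg_hom g (a + b) = alg_hom g a + alg_hom g b"
proof -
  let ?S = "Poly_Mapping.keys a \<union> Poly_Mapping.keys b"
  let ?h = "\<lambda>a. \<Sum>w\<in>?S. sc (Poly_Mapping.lookup a w) * prod_list (map g w)"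
  have "alg_hom g (a + b) = ?h (a + b)"
    by (rule alg_hom_superset) (auto simp: keys_add)
  also have "\<dots> = ?h a + ?h b"
    by (simp add: lookup_add sc_add algebra_simps sum.distrib)
  finally show ?thesis using alg_hom_superset[of ?S a g] alg_hom_superset[of ?S b g] by simp
qed

lemma alg_hom_single: "alg_hom g (Poly_Mapping.single w c) = sc c * prod_list (map g w)"
  by (simp add: alg_hom_def)

lemma alg_hom_wd: "alg_hom g (wd w) = prod_list (map g w)" by (simp add: wd_def alg_hom_single)
lemma alg_hom_sc [simp]: "alg_hom g (sc c) = sc c" by (simp add: sc_def alg_hom_single)
lemma alg_hom_1 [simp]: "alg_hom g 1 = 1" using alg_hom_sc[of g 1] by simp

lemma alg_hom_scale: "alg_hom g (sc c * a) = sc c * alg_hom g a"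
proof (induction a rule: alg_induct)
  case (word d w)
  have "alg_hom g (sc c * (sc d * wd w)) = alg_hom g (Poly_Mapping.single w (c * d))"
    by (metis mult.assoc sc_mult sc_wd)
  then show ?case by (simp add: alg_hom_single sc_wd sc_mult mult.assoc)
qed (simp_all add: alg_hom_add algebra_simps)

lemma alg_hom_mult: "alg_hom g (a * b) = alg_hom g a * alg_hom g b"
proof (induction a rule: alg_induct)
  case (word c v)
  have "alg_hom g (wd v * b) = alg_hom g (wd v) * alg_hom g b"
  proof (induction b rule: alg_induct)
    case (word d w)
    then show ?case by (simp add: sc_comm_left alg_hom_scale alg_hom_wd flip: wd_append)
  qed (simp_all add: alg_hom_add algebra_simps)
  then show ?case by (simp add: mult.assoc alg_hom_scale)
qed (simp_all add: alg_hom_add algebra_simps)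

lemma alg_hom_uminus: "alg_hom g (- a) = - alg_hom g a"
  using alg_hom_scale[of g "-1" a] by (simp add: sc_uminus)
lemma alg_hom_diff: "alg_hom g (a - b) = alg_hom g a - alg_hom g b"
  using alg_hom_add[of g a "- b"] by (simp add: alg_hom_uminus)
lemma alg_hom_sum: "alg_hom g (sum h S) = (\<Sum>x\<in>S. alg_hom g (h x))"
  by (induction S rule: infinite_finite_induct) (simp_all add: alg_hom_add)

lemma alg_hom_cong_comp:
  assumes "\<And>x. alg_hom g (h x) = k x"
  shows "alg_hom g (alg_hom h a) = alg_hom k a"
proof (induction a rule: alg_induct)
  case (word c w)
  have "alg_hom g (prod_list (map h w)) = prod_list (map k w)"
    by (induction w) (simp_all add: alg_hom_mult assms)
  then show ?case by (simp add: alg_hom_scale alg_hom_wd)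
qed (simp_all add: alg_hom_add)

lemma prod_list_wd: "prod_list (map (\<lambda>x. wd [\<tau> x]) w) = wd (map \<tau> w)"
  by (induction w) (simp_all add: one_alg flip: wd_append)

lemma lf_alg_hom_letters: "lf F (alg_hom (\<lambda>x. wd [\<tau> x]) a) = lf (\<lambda>w. F (map \<tau> w)) a"
  by (induction a rule: alg_induct)
    (simp_all add: alg_hom_add lf_add alg_hom_scale lf_scale alg_hom_wd prod_list_wd)

subsection \<open>Lists of coefficients and words as elements of the free algebra\<close>

definition alg_of_pol :: "'a pol \<Rightarrow> 'a alg" where
  "alg_of_pol p = sum_list (map (\<lambda>(c, w). sc c * wd w) p)"

lemma alg_of_pol_Nil [simp]: "alg_of_pol [] = 0" by (simp add: alg_of_pol_def)
lemma alg_of_pol_Cons: "alg_of_pol ((c, w) # p) = sc c * wd w + alg_of_pol p" by (simp add: alg_of_pol_def)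
lemma alg_of_pol_append: "alg_of_pol (p @ q) = alg_of_pol p + alg_of_pol q" by (simp add: alg_of_pol_def)

lemma lin_alg_of_pol: "lin f p = lf f (alg_of_pol p)"
  by (induction p) (auto simp: lin_def alg_of_pol_Cons lf_add lf_scale)

lemma alg_of_pol_pmul: "alg_of_pol (pmul p q) = alg_of_pol p * alg_of_pol q"
proof (induction p)
  case Nil
  then show ?case by (simp add: pmul_def)
next
  case (Cons x p)
  obtain c v where x: "x = (c, v)" by force
  have "alg_of_pol (map (\<lambda>(d, w). (c * d, v @ w)) q) = sc c * wd v * alg_of_pol q"
  proof (induction q)
    case (Cons y q)
    obtain d w where y: "y = (d, w)" by force
    have "sc (c * d) * wd (v @ w) = sc c * wd v * (sc d * wd w)"
      by (metis mult.assoc sc_comm_left sc_mult wd_append)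
    then show ?case using Cons by (simp add: y alg_of_pol_Cons distrib_left)
  qed simp
  moreover have "pmul (x # p) q = map (\<lambda>(d, w). (c * d, v @ w)) q @ pmul p q"
    by (simp add: pmul_def x)
  ultimately show ?case using Cons by (simp add: x alg_of_pol_append alg_of_pol_Cons algebra_simps)
qed

lemma alg_of_pol_pprod: "alg_of_pol (pprod ps) = prod_list (map alg_of_pol ps)"
proof (induction ps)
  case Nil
  show ?case by (simp add: pprod_def alg_of_pol_Cons) (simp add: one_alg)
next
  case (Cons p ps)
  have "pprod (p # ps) = pmul p (pprod ps)" by (simp add: pprod_def)
  then show ?case using Cons by (simp add: alg_of_pol_pmul)
qed

lemma alg_of_pol_pmap: "alg_of_pol (pmap g p) = alg_hom (\<lambda>x. wd [g x]) (alg_of_pol p)"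
proof (induction p)
  case Nil
  show ?case by (simp add: pmap_def)
next
  case (Cons x p)
  obtain c v where x: "x = (c, v)" by force
  have "pmap g (x # p) = (c, map g v) # pmap g p" by (simp add: pmap_def x)
  then show ?case using Cons
    by (simp add: x alg_of_pol_Cons alg_hom_add alg_hom_scale alg_hom_wd prod_list_wd)
qed

lemma surj_alg_of_pol: "\<exists>p. alg_of_pol p = a"
proof (induction a rule: alg_induct)
  case zero
  show ?case using alg_of_pol_Nil by blast
next
  case (add a b)
  then show ?case using alg_of_pol_append by metis
next
  case (word c w)
  show ?case by (rule exI[of _ "[(c, w)]"]) (simp add: alg_of_pol_Cons)
qed

section \<open>The two copies inside the doubled alphabet\<close>

definition copy_hom :: "side \<Rightarrow> 'a alg \<Rightarrow> ('a \<times> side) alg" where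
  "copy_hom s = alg_hom (\<lambda>l. wd [(l, s)])"

lemma copy_hom_mult: "copy_hom s (a * b) = copy_hom s a * copy_hom s b" by (simp add: copy_hom_def alg_hom_mult)
lemma copy_hom_add: "copy_hom s (a + b) = copy_hom s a + copy_hom s b" by (simp add: copy_hom_def alg_hom_add)
lemma copy_hom_diff: "copy_hom s (a - b) = copy_hom s a - copy_hom s b" by (simp add: copy_hom_def alg_hom_diff)
lemma copy_hom_sum: "copy_hom s (sum g S) = (\<Sum>x\<in>S. copy_hom s (g x))" by (simp add: copy_hom_def alg_hom_sum)
lemma copy_hom_scale: "copy_hom s (sc c * a) = sc c * copy_hom s a" by (simp add: copy_hom_def alg_hom_scale)
lemma copy_hom_sc [simp]: "copy_hom s (sc c) = sc c" by (simp add: copy_hom_def)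
lemma copy_hom_0 [simp]: "copy_hom s 0 = 0" by (simp add: copy_hom_def)
lemma copy_hom_1 [simp]: "copy_hom s 1 = 1" by (simp add: copy_hom_def)
lemma copy_hom_wd: "copy_hom s (wd w) = wd (map (\<lambda>l. (l, s)) w)" by (simp add: copy_hom_def alg_hom_wd prod_list_wd)

definition copy_prod :: "(side \<times> 'a alg) list \<Rightarrow> ('a \<times> side) alg" where
  "copy_prod es = prod_list (map (\<lambda>(s, a). copy_hom s a) es)"

lemma copy_prod_Nil [simp]: "copy_prod [] = 1" by (simp add: copy_prod_def)
lemma copy_prod_Cons [simp]: "copy_prod ((s, a) # es) = copy_hom s a * copy_prod es" by (simp add: copy_prod_def)
lemma copy_prod_append: "copy_prod (es @ fs) = copy_prod es * copy_prod fs" by (simp add: copy_prod_def)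

lemma alg_of_pol_prodE: "alg_of_pol (prodE es) = copy_prod (map (\<lambda>(s, p). (s, alg_of_pol p)) es)"
  by (simp add: prodE_def alg_of_pol_pprod copy_prod_def copy_hom_def alg_of_pol_pmap case_prod_unfold comp_def)

lemma surj_alg_of_pol_list: "\<exists>qs. map (\<lambda>(s, p). (s, alg_of_pol p)) qs = es"
proof (induction es)
  case (Cons e es)
  then obtain qs p where "map (\<lambda>(s, p). (s, alg_of_pol p)) qs = es" "alg_of_pol p = snd e"
    using surj_alg_of_pol by metis
  then have "map (\<lambda>(s, p). (s, alg_of_pol p)) ((fst e, p) # qs) = e # es" by simp
  then show ?case by (rule exI)
qed simp

section \<open>Functionals on a free product prescribed on alternating centred products\<close>

lemma alternating_successively: "alternating es \<longleftrightarrow> successively (\<noteq>) (map fst es)"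
  by (simp add: alternating_def successively_conv_nth)

lemma alternating_Nil [simp]: "alternating []"
  by (simp add: alternating_successively)

lemma alternating_append:
  "alternating (es @ fs) \<longleftrightarrow> alternating es \<and> alternating fs \<and>
     (es = [] \<or> fs = [] \<or> fst (last es) \<noteq> fst (hd fs))"
  by (auto simp: alternating_successively successively_append_iff last_map hd_map)

lemma alternating_Cons:
  "alternating (e # es) \<longleftrightarrow> alternating es \<and> (es = [] \<or> fst e \<noteq> fst (hd es))"
  by (auto simp: alternating_successively successively_Cons hd_map)

text \<open>The centring functional depends on the side because the free product centres with the
  two states themselves; the other four products use \<open>cou\<close> on both sides.\<close>

definition ccentered :: "(side \<Rightarrow> 'l list \<Rightarrow> complex) \<Rightarrow> (side \<times> 'l alg) list \<Rightarrow> bool" where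
  "ccentered c es \<longleftrightarrow> (\<forall>(s, a) \<in> set es. lf (c s) a = 0)"

lemma ccentered_simps [simp]:
  "ccentered c []"
  "ccentered c ((s, a) # es) \<longleftrightarrow> lf (c s) a = 0 \<and> ccentered c es"
  "ccentered c (es @ fs) \<longleftrightarrow> ccentered c es \<and> ccentered c fs"
  by (auto simp: ccentered_def)

definition multilinear :: "((side \<times> 'l alg) list \<Rightarrow> complex) \<Rightarrow> bool" where
  "multilinear R \<longleftrightarrow>
     (\<forall>p q s a b. R (p @ (s, a + b) # q) = R (p @ (s, a) # q) + R (p @ (s, b) # q)) \<and>
     (\<forall>p q s k a. R (p @ (s, sc k * a) # q) = k * R (p @ (s, a) # q))"

subsection \<open>Existence\<close>

lemma lf_fun_add: "lf (\<lambda>w. f w + g w) a = lf f a + lf g a"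
  by (simp add: lf_def algebra_simps sum.distrib)

lemma lf_fun_scale: "lf (\<lambda>w. k * f w) a = k * lf f a"
  by (simp add: lf_def sum_distrib_left algebra_simps)

lemma lf_fun_diff: "lf (\<lambda>w. f w - g w) a = lf f a - lf g a"
  by (simp add: lf_def algebra_simps sum_subtractf)

lemma lf_fun_0 [simp]: "lf (\<lambda>w. 0) a = 0"
  by (simp add: lf_def)

lemma lf_swap: "lf (\<lambda>w. lf (\<lambda>v. G w v) b) a = lf (\<lambda>v. lf (\<lambda>w. G w v) a) b"
  unfolding lf_def sum_distrib_left
  by (subst sum.swap) (simp add: algebra_simps)

text \<open>The free product acts on the span of the alternating lists of nonempty words, where the entry
  \<open>(s, w)\<close> stands for the centred element \<open>w - c s w\<close> of the copy \<open>s\<close>; \<open>letter_act\<close> is the transpose of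
  left multiplication by a letter.\<close>

definition letter_act :: "(side \<Rightarrow> 'l list \<Rightarrow> complex) \<Rightarrow> ((side \<times> 'l list) list \<Rightarrow> complex) \<Rightarrow> 'l \<times> side
    \<Rightarrow> (side \<times> 'l list) list \<Rightarrow> complex" where
  "letter_act c T x es = (case x of (l, s) \<Rightarrow>
     (if es \<noteq> [] \<and> fst (hd es) = s then
        (let w = snd (hd es); r = tl es in
         T ((s, l # w) # r) + c s (l # w) * T r - c s w * T ((s, [l]) # r) - c s w * c s [l] * T r)
      else T ((s, [l]) # es) + c s [l] * T es))"

lemma letter_act_add: "letter_act c (\<lambda>es. T es + T' es) x = (\<lambda>es. letter_act c T x es + letter_act c T' x es)"
  by (auto simp: letter_act_def Let_def algebra_simps split: prod.split)

lemma letter_act_scale: "letter_act c (\<lambda>es. k * T es) x = (\<lambda>es. k * letter_act c T x es)"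
  by (auto simp: letter_act_def Let_def algebra_simps split: prod.split)

lemma foldl_letter_act_add:
  "foldl (letter_act c) (\<lambda>es. T es + T' es) v = (\<lambda>es. foldl (letter_act c) T v es + foldl (letter_act c) T' v es)"
  by (induction v arbitrary: T T') (simp_all add: letter_act_add)

lemma foldl_letter_act_scale:
  "foldl (letter_act c) (\<lambda>es. k * T es) v = (\<lambda>es. k * foldl (letter_act c) T v es)"
  by (induction v arbitrary: T) (simp_all add: letter_act_scale)

definition alg_act :: "(side \<Rightarrow> 'l list \<Rightarrow> complex) \<Rightarrow> ((side \<times> 'l list) list \<Rightarrow> complex)
    \<Rightarrow> ('l \<times> side) alg \<Rightarrow> (side \<times> 'l list) list \<Rightarrow> complex" where
  "alg_act c T a es = lf (\<lambda>v. foldl (letter_act c) T v es) a"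

lemma alg_act_fun_add: "alg_act c (\<lambda>es. T es + T' es) a es = alg_act c T a es + alg_act c T' a es"
  by (simp add: alg_act_def foldl_letter_act_add lf_fun_add)

lemma alg_act_fun_scale: "alg_act c (\<lambda>es. k * T es) a es = k * alg_act c T a es"
  by (simp add: alg_act_def foldl_letter_act_scale lf_fun_scale)

text \<open>Transposition turns left multiplication into a right action, so the leftmost factor acts
  on \<open>T\<close> first.\<close>

lemma alg_act_mult: "alg_act c T (a * b) es = alg_act c (alg_act c T a) b es"
proof (induction a rule: alg_induct)
  case zero
  show ?case using alg_act_fun_scale[of c 0 "\<lambda>_. 0" b es] by (simp add: alg_act_def[of _ _ 0])
next
  case (add a a')
  have "alg_act c T (a + a') = (\<lambda>es. alg_act c T a es + alg_act c T a' es)"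
    by (rule ext) (simp add: alg_act_def lf_add)
  moreover have "alg_act c T ((a + a') * b) es = alg_act c T (a * b) es + alg_act c T (a' * b) es"
    by (simp add: alg_act_def lf_add distrib_right)
  ultimately show ?case using add by (simp add: alg_act_fun_add)
next
  case (word k u)
  have "alg_act c T (wd u * b) es = alg_act c (foldl (letter_act c) T u) b es"
    by (simp add: alg_act_def flip: lf_wd_left)
  moreover have "alg_act c T (sc k * wd u) = (\<lambda>es. k * foldl (letter_act c) T u es)"
    by (rule ext) (simp add: alg_act_def lf_scale)
  moreover have "alg_act c T (sc k * wd u * b) es = k * alg_act c T (wd u * b) es"
    by (simp add: alg_act_def lf_scale mult.assoc)
  ultimately show ?case by (simp add: alg_act_fun_scale)
qed

text \<open>A word w of copy s is \<open>(w - c s w) + c s w\<close>: the centred part opens a new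
  block, the scalar leaves the list alone.\<close>

lemma foldl_letter_act_block:
  assumes "es = [] \<or> fst (hd es) \<noteq> s" and "c s [] = 1"
  shows "foldl (letter_act c) T (map (\<lambda>l. (l, s)) w) es
     = (if w = [] then 0 else T ((s, w) # es)) + c s w * T es"
proof (induction w arbitrary: T)
  case (Cons l w)
  have "letter_act c T (l, s) es = T ((s, [l]) # es) + c s [l] * T es"
    using assms by (auto simp: letter_act_def)
  \<comment> \<open>This is \<open>l (w - c w)\<close> re-expanded in centred elements:
    \<open>(lw - c (lw)) + c (lw) - c w (l - c l) - c w c l\<close>. The last two terms cancel
    against \<open>c s w\<close> times the preceding equation.\<close>
  moreover have "letter_act c T (l, s) ((s, w) # es)
     = T ((s, l # w) # es) + c s (l # w) * T es - c s w * T ((s, [l]) # es) - c s w * c s [l] * T es"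
    by (simp add: letter_act_def)
  ultimately show ?case using Cons[of "letter_act c T (l, s)"] assms
    by (cases "w = []") (simp_all add: algebra_simps)
qed (simp add: assms)

lemma alg_act_copy_hom:
  assumes "es = [] \<or> fst (hd es) \<noteq> s" and "c s [] = 1"
  shows "alg_act c T (copy_hom s a) es
     = lf (\<lambda>w. if w = [] then 0 else T ((s, w) # es)) a + lf (c s) a * T es"
  using assms by (simp add: alg_act_def copy_hom_def lf_alg_hom_letters foldl_letter_act_block lf_fun_add
      mult.commute[of _ "T es"] lf_fun_scale)

text \<open>Multilinear evaluation of \<open>T\<close> on the expansion of the entries into words.
  The empty word is dropped because its centred part is zero.\<close>

primrec block_eval :: "(side \<times> 'l alg) list \<Rightarrow> ((side \<times> 'l list) list \<Rightarrow> complex) \<Rightarrow> complex" where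
  "block_eval [] T = T []"
| "block_eval (e # es) T = lf (\<lambda>w. if w = [] then 0 else block_eval es (\<lambda>x. T ((fst e, w) # x))) (snd e)"

text \<open>\<open>alg_act_copy_hom\<close> is only valid on lists that begin with another side, so
  \<open>T\<close> has to be rewritten under knowledge of the first side.\<close>

lemma block_eval_cong:
  assumes "\<And>x. (es = [] \<Longrightarrow> x = []) \<Longrightarrow> (es \<noteq> [] \<Longrightarrow> x \<noteq> [] \<and> fst (hd x) = fst (hd es)) \<Longrightarrow> T x = T' x"
  shows "block_eval es T = block_eval es T'"
proof (cases es)
  case (Cons e fs)
  have "(\<lambda>x. T ((fst e, w) # x)) = (\<lambda>x. T' ((fst e, w) # x))" for w
    using assms Cons by auto
  then show ?thesis using Cons by (simp cong: if_cong)
qed (use assms in simp)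

lemma block_eval_0 [simp]: "block_eval es (\<lambda>x. 0) = 0"
  by (induction es) (simp_all cong: if_cong)

lemma block_eval_lf: "block_eval es (\<lambda>x. lf (\<lambda>w. G w x) a) = lf (\<lambda>w. block_eval es (G w)) a"
proof (induction es arbitrary: G)
  case (Cons e es)
  have "block_eval (e # es) (\<lambda>x. lf (\<lambda>w. G w x) a)
    = lf (\<lambda>v. lf (\<lambda>w. if v = [] then 0 else block_eval es (\<lambda>x. G w ((fst e, v) # x))) a) (snd e)"
    using Cons by (auto intro!: arg_cong[of _ _ "\<lambda>f. lf f (snd e)"])
  also have "\<dots> = lf (\<lambda>w. block_eval (e # es) (G w)) a"
    by (subst lf_swap) simp
  finally show ?case .
qed simp

text \<open>A centred entry has no scalar part, so each factor merely prepends its block, and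
  alternation keeps adjacent blocks from merging.\<close>

lemma alg_act_copy_prod:
  fixes c :: "side \<Rightarrow> 'l list \<Rightarrow> complex"
  assumes "\<And>s. c s [] = 1"
  shows "alternating es \<Longrightarrow> ccentered c es \<Longrightarrow> alg_act c T (copy_prod es) [] = block_eval es T"
proof (induction es arbitrary: T)
  case Nil
  show ?case by (simp add: alg_act_def lf_1)
next
  case (Cons e es)
  obtain s a where e: "e = (s, a)" by force
  have "alg_act c T (copy_prod (e # es)) [] = alg_act c (alg_act c T (copy_hom s a)) (copy_prod es) []"
    by (simp add: e alg_act_mult)
  also have "\<dots> = block_eval es (alg_act c T (copy_hom s a))"
    using Cons by (simp add: e alternating_Cons)
  also have "\<dots> = block_eval es (\<lambda>x. lf (\<lambda>w. if w = [] then 0 else T ((s, w) # x)) a)"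
  proof (rule block_eval_cong)
    fix x :: "(side \<times> 'l list) list"
    assume x: "es = [] \<Longrightarrow> x = []" "es \<noteq> [] \<Longrightarrow> x \<noteq> [] \<and> fst (hd x) = fst (hd es)"
    have "x = [] \<or> fst (hd x) \<noteq> s" using x Cons.prems by (auto simp: e alternating_Cons)
    then show "alg_act c T (copy_hom s a) x = lf (\<lambda>w. if w = [] then 0 else T ((s, w) # x)) a"
      using Cons.prems assms by (simp add: e alg_act_copy_hom)
  qed
  also have "\<dots> = lf (\<lambda>w. block_eval es (\<lambda>x. if w = [] then 0 else T ((s, w) # x))) a"
    by (rule block_eval_lf)
  also have "\<dots> = block_eval (e # es) T"
    by (auto simp: e intro!: arg_cong[of _ _ "\<lambda>f. lf f a"])
  finally show ?case .
qed

lemma multilinear_0: "multilinear R \<Longrightarrow> R (p @ (s, 0) # q) = 0"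
  unfolding multilinear_def by (metis mult_zero_left sc_0)

lemma multilinear_lf:
  assumes "multilinear R"
  shows "lf (\<lambda>w. R (p @ (s, wd w - sc (c w)) # q)) a = R (p @ (s, a - sc (lf c a)) # q)"
proof (induction a rule: alg_induct)
  case zero
  show ?case using multilinear_0[OF assms] by simp
next
  case (add a b)
  have "a + b - sc (lf c (a + b)) = (a - sc (lf c a)) + (b - sc (lf c b))"
    by (simp add: lf_add sc_add algebra_simps)
  then have "R (p @ (s, a + b - sc (lf c (a + b))) # q)
      = R (p @ (s, a - sc (lf c a)) # q) + R (p @ (s, b - sc (lf c b)) # q)"
    using assms unfolding multilinear_def by metis
  then show ?case using add by (simp add: lf_add)
next
  case (word k w)
  have "sc k * wd w - sc (lf c (sc k * wd w)) = sc k * (wd w - sc (c w))"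
    by (simp add: lf_scale sc_mult algebra_simps)
  then show ?case using assms by (simp add: lf_scale multilinear_def)
qed

lemma block_eval_multilinear:
  assumes "multilinear R" "\<And>s. c s [] = 1"
  shows "ccentered c es \<Longrightarrow>
    block_eval es (\<lambda>bs. R (pre @ map (\<lambda>(s, w). (s, wd w - sc (c s w))) bs)) = R (pre @ es)"
proof (induction es arbitrary: pre)
  case (Cons e es)
  obtain s a where e: "e = (s, a)" by force
  let ?ct = "map (\<lambda>(s, w). (s, wd w - sc (c s w)))"
  have "block_eval (e # es) (\<lambda>bs. R (pre @ ?ct bs))
     = lf (\<lambda>w. if w = [] then 0 else block_eval es (\<lambda>bs. R ((pre @ [(s, wd w - sc (c s w))]) @ ?ct bs))) a"
    by (simp add: e cong: if_cong)
  also have "\<dots> = lf (\<lambda>w. if w = [] then 0 else R (pre @ (s, wd w - sc (c s w)) # es)) a"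
  proof -
    have "block_eval es (\<lambda>bs. R ((pre @ [x]) @ ?ct bs)) = R (pre @ x # es)" for x
      using Cons.IH[of "pre @ [x]"] Cons.prems by (simp add: e)
    then show ?thesis by (simp only:)
  qed
  also have "\<dots> = lf (\<lambda>w. R (pre @ (s, wd w - sc (c s w)) # es)) a"
    using multilinear_0[OF assms(1)] assms(2)
    by (intro arg_cong[of _ _ "\<lambda>f. lf f a"] ext) (auto simp flip: one_alg)
  also have "\<dots> = R (pre @ e # es)"
    using Cons.prems by (simp add: multilinear_lf[OF assms(1)] e)
  finally show ?case .
qed simp

text \<open>\<open>T\<close> is \<open>R\<close> on lists of centred words, and F is the coefficient
  of the action at the empty list, the vacuum vector of the free product.\<close>

lemma product_functional_exists:
  assumes "multilinear R" "\<And>s. c s [] = 1"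
  shows "\<exists>F. \<forall>es. alternating es \<and> ccentered c es \<longrightarrow> lf F (copy_prod es) = R es"
proof -
  let ?T = "\<lambda>bs. R (map (\<lambda>(s, w). (s, wd w - sc (c s w))) bs)"
  have "lf (\<lambda>v. foldl (letter_act c) ?T v []) (copy_prod es) = R es" if "alternating es" "ccentered c es" for es
    using alg_act_copy_prod[OF assms(2) that, of ?T] block_eval_multilinear[OF assms that(2), of "[]"]
    by (simp add: alg_act_def)
  then show ?thesis by blast
qed

subsection \<open>Uniqueness\<close>

inductive_set lin_span :: "'a alg set \<Rightarrow> 'a alg set" for X where
  lin_span_0: "0 \<in> lin_span X"
| lin_span_base: "x \<in> X \<Longrightarrow> sc k * x \<in> lin_span X"
| lin_span_add: "x \<in> lin_span X \<Longrightarrow> y \<in> lin_span X \<Longrightarrow> x + y \<in> lin_span X"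

lemma lin_span_superset: "x \<in> X \<Longrightarrow> x \<in> lin_span X"
  using lin_span_base[of x X 1] by simp

lemma lin_span_map:
  assumes "x \<in> lin_span X" and "\<And>y. y \<in> X \<Longrightarrow> T y \<in> lin_span Z"
    and "\<And>a b. T (a + b) = T a + T b" and "\<And>k a. T (sc k * a) = sc k * T a"
  shows "T x \<in> lin_span Z"
proof -
  have sc: "sc k * z \<in> lin_span Z" if "z \<in> lin_span Z" for k z
    using that
  proof induction
    case (lin_span_base x k')
    then show ?case using lin_span.lin_span_base[of x Z "k * k'"] by (simp add: sc_mult mult.assoc)
  qed (simp_all add: lin_span.intros distrib_left)
  show ?thesis using assms(1)
  proof induction
    case lin_span_0
    then show ?case using assms(4)[of 0 0] by (simp add: lin_span.lin_span_0)
  qed (simp_all add: assms lin_span.intros sc)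
qed

lemma lin_span_scale: "x \<in> lin_span X \<Longrightarrow> sc k * x \<in> lin_span X"
  by (rule lin_span_map[of x X "\<lambda>x. sc k * x"])
    (auto simp: lin_span_base distrib_left intro: sc_comm_left)

lemma lin_span_sum: "(\<And>x. x \<in> S \<Longrightarrow> g x \<in> lin_span X) \<Longrightarrow> sum g S \<in> lin_span X"
  by (induction S rule: infinite_finite_induct) (auto intro: lin_span.intros)

lemma lin_span_all:
  assumes "\<And>w. wd w \<in> lin_span X"
  shows "a \<in> lin_span X"
  by (induction a rule: alg_induct) (auto intro: lin_span.intros lin_span_scale assms)

lemma lf_lin_span_0:
  assumes "x \<in> lin_span X" "\<And>y. y \<in> X \<Longrightarrow> lf F y = 0"
  shows "lf F x = 0"
  using assms(1) by induction (simp_all add: lf_add lf_scale assms(2))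

text \<open>Only the last factor, in the fixed copy s, may be uncentred; this makes the set stable
  under right multiplication by that copy. \<open>rspan\<close> is its mirror image, used together
  with it when an element is inserted in the middle of a product.\<close>

definition lspan :: "(side \<Rightarrow> 'l list \<Rightarrow> complex) \<Rightarrow> side \<Rightarrow> ('l \<times> side) alg set" where
  "lspan c s = {copy_prod es * copy_hom s a | es a.
     alternating es \<and> ccentered c es \<and> (es = [] \<or> fst (last es) \<noteq> s)}"

definition rspan :: "(side \<Rightarrow> 'l list \<Rightarrow> complex) \<Rightarrow> side \<Rightarrow> ('l \<times> side) alg set" where
  "rspan c s = {copy_hom s a * copy_prod es | es a.
     alternating es \<and> ccentered c es \<and> (es = [] \<or> fst (hd es) \<noteq> s)}"

lemma side_eqI: "s \<noteq> t \<Longrightarrow> s' \<noteq> t \<Longrightarrow> s = (s' :: side)"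
  by (cases s; cases s'; cases t) auto

text \<open>Splitting the free factor of copy t into centred part and scalar gives a longer centred
  product, followed by 1 in copy s, and a shorter one, whose last entry lies in copy s because there
  are only two sides.\<close>

lemma lspan_step:
  assumes c1: "\<And>s. c s [] = 1" and x: "x \<in> lspan c t" and st: "s \<noteq> t"
  shows "x \<in> lin_span (lspan c s)"
proof -
  from x obtain es a where es: "x = copy_prod es * copy_hom t a" "alternating es" "ccentered c es"
    "es = [] \<or> fst (last es) \<noteq> t"
    by (auto simp: lspan_def)
  let ?a = "a - sc (lf (c t) a)"
  have ca: "lf (c t) ?a = 0" by (simp add: lf_diff lf_sc c1)
  have "x = copy_prod (es @ [(t, ?a)]) * copy_hom s 1 + sc (lf (c t) a) * copy_prod es"
    by (simp add: es copy_prod_append copy_hom_diff algebra_simps sc_comm)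
  moreover have "copy_prod (es @ [(t, ?a)]) * copy_hom s 1 \<in> lspan c s"
    unfolding lspan_def using es ca st
    by (intro CollectI exI[of _ "es @ [(t, ?a)]"] exI[of _ 1])
       (auto simp: alternating_append alternating_Cons)
  moreover have "copy_prod es \<in> lspan c s"
  proof (cases es rule: rev_cases)
    case Nil
    then show ?thesis unfolding lspan_def by (intro CollectI exI[of _ "[]"] exI[of _ 1]) simp
  next
    case (snoc fs e)
    obtain s' b where e: "e = (s', b)" by force
    have "s' \<noteq> t" using es snoc e by auto
    then have "s' = s" using st by (rule side_eqI)
    then show ?thesis unfolding lspan_def using es snoc e
      by (intro CollectI exI[of _ fs] exI[of _ b]) (auto simp: copy_prod_append alternating_append)
  qed
  ultimately show ?thesis by (auto intro: lin_span.intros lin_span_superset)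
qed

lemma rspan_step:
  assumes c1: "\<And>s. c s [] = 1" and x: "x \<in> rspan c t" and st: "s \<noteq> t"
  shows "x \<in> lin_span (rspan c s)"
proof -
  from x obtain es a where es: "x = copy_hom t a * copy_prod es" "alternating es" "ccentered c es"
    "es = [] \<or> fst (hd es) \<noteq> t"
    by (auto simp: rspan_def)
  let ?a = "a - sc (lf (c t) a)"
  have ca: "lf (c t) ?a = 0" by (simp add: lf_diff lf_sc c1)
  have "x = copy_hom s 1 * copy_prod ((t, ?a) # es) + sc (lf (c t) a) * copy_prod es"
    by (simp add: es copy_hom_diff algebra_simps)
  moreover have "copy_hom s 1 * copy_prod ((t, ?a) # es) \<in> rspan c s"
    unfolding rspan_def using es ca st
    by (intro CollectI exI[of _ "(t, ?a) # es"] exI[of _ 1])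
       (auto simp: alternating_Cons)
  moreover have "copy_prod es \<in> rspan c s"
  proof (cases es)
    case Nil
    then show ?thesis unfolding rspan_def by (intro CollectI exI[of _ "[]"] exI[of _ 1]) simp
  next
    case (Cons e fs)
    obtain s' b where e: "e = (s', b)" by force
    have "s' \<noteq> t" using es Cons e by auto
    then have "s' = s" using st by (rule side_eqI)
    then show ?thesis unfolding rspan_def using es Cons e
      by (intro CollectI exI[of _ fs] exI[of _ b]) (auto simp: alternating_Cons)
  qed
  ultimately show ?thesis by (auto intro: lin_span.intros lin_span_superset)
qed

lemma lin_span_lspan:
  assumes c1: "\<And>s. c s [] = 1"
  shows "x \<in> lin_span (lspan c s)"
proof (rule lin_span_all)
  fix v
  show "wd v \<in> lin_span (lspan c s)"
  proof (induction v arbitrary: s rule: rev_induct)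
    case Nil
    have "wd [] \<in> lspan c s"
      unfolding lspan_def by (intro CollectI exI[of _ "[]"] exI[of _ 1]) (simp flip: one_alg)
    then show ?case by (rule lin_span_superset)
  next
    case (snoc x v)
    obtain l t where x: "x = (l, t)" by force
    have "wd v * copy_hom t (wd [l]) \<in> lin_span (lspan c s)"
    proof (rule lin_span_map[OF snoc, of t])
      fix y assume "y \<in> lspan c t"
      then have "y * copy_hom t (wd [l]) \<in> lspan c t"
        unfolding lspan_def by clarify (metis copy_hom_mult mult.assoc)
      then show "y * copy_hom t (wd [l]) \<in> lin_span (lspan c s)"
        using lspan_step[where c = c, OF c1] lin_span_superset by (cases "s = t") blast+
    qed (simp_all add: distrib_right mult.assoc)
    then show ?case by (simp add: x copy_hom_wd wd_append)
  qed
qed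

lemma lin_span_rspan:
  assumes c1: "\<And>s. c s [] = 1"
  shows "x \<in> lin_span (rspan c s)"
proof (rule lin_span_all)
  fix v
  show "wd v \<in> lin_span (rspan c s)"
  proof (induction v arbitrary: s)
    case Nil
    have "wd [] \<in> rspan c s"
      unfolding rspan_def by (intro CollectI exI[of _ "[]"] exI[of _ 1]) (simp flip: one_alg)
    then show ?case by (rule lin_span_superset)
  next
    case (Cons x v)
    obtain l t where x: "x = (l, t)" by force
    have "copy_hom t (wd [l]) * wd v \<in> lin_span (rspan c s)"
    proof (rule lin_span_map[OF Cons, of t])
      fix y assume "y \<in> rspan c t"
      then have "copy_hom t (wd [l]) * y \<in> rspan c t"
        unfolding rspan_def by clarify (metis copy_hom_mult mult.assoc)
      then show "copy_hom t (wd [l]) * y \<in> lin_span (rspan c s)"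
        using rspan_step[where c = c, OF c1] lin_span_superset by (cases "s = t") blast+
    qed (simp_all add: distrib_left sc_comm_left)
    then show ?case using wd_append[of "[x]" v] by (simp add: x copy_hom_wd)
  qed
qed

text \<open>Centring the last factor of an element of \<open>lspan c Fst\<close> leaves only
  alternating centred products, so these span the whole algebra.\<close>

lemma product_functional_unique:
  assumes c1: "\<And>s. c s [] = 1"
    and eq: "\<And>es. alternating es \<Longrightarrow> ccentered c es \<Longrightarrow> lf F (copy_prod es) = lf G (copy_prod es)"
  shows "F = G"
proof -
  have "lf (\<lambda>w. F w - G w) x = 0" for x
  proof (rule lf_lin_span_0[OF lin_span_lspan[where c = c, OF c1, of x Fst]])
    fix y assume "y \<in> lspan c Fst"
    then obtain es a where y: "y = copy_prod es * copy_hom Fst a" "alternating es" "ccentered c es"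
      "es = [] \<or> fst (last es) \<noteq> Fst" by (auto simp: lspan_def)
    let ?a = "a - sc (lf (c Fst) a)"
    have "y = copy_prod (es @ [(Fst, ?a)]) + sc (lf (c Fst) a) * copy_prod es"
      by (simp add: y copy_prod_append copy_hom_diff algebra_simps sc_comm)
    moreover have "alternating (es @ [(Fst, ?a)])" "ccentered c (es @ [(Fst, ?a)])"
      using y by (auto simp: alternating_append alternating_Cons lf_diff lf_sc c1)
    ultimately show "lf (\<lambda>w. F w - G w) y = 0"
      using eq y by (simp add: lf_fun_diff lf_add lf_scale)
  qed
  then show ?thesis by (intro ext) (metis eq_iff_diff_eq_0 lf_wd)
qed

lemma product_functional_ex1:
  assumes "multilinear R" "\<And>s. c s [] = 1"
  shows "\<exists>!F. \<forall>es. alternating es \<and> ccentered c es \<longrightarrow> lf F (copy_prod es) = R es"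
proof (rule ex_ex1I)
  show "\<exists>F. \<forall>es. alternating es \<and> ccentered c es \<longrightarrow> lf F (copy_prod es) = R es"
    by (rule product_functional_exists) (rule assms)+
next
  fix F G
  assume "\<forall>es. alternating es \<and> ccentered c es \<longrightarrow> lf F (copy_prod es) = R es"
    and "\<forall>es. alternating es \<and> ccentered c es \<longrightarrow> lf G (copy_prod es) = R es"
  then show "F = G"
    by (intro product_functional_unique[of c F G]) (auto simp: assms)
qed

section \<open>The five products and their convolutions\<close>

text \<open>Common shape of the five products: \<open>c\<close> says how entries are centred,
  \<open>R\<close> is the prescribed value. Unitality is the case of the empty list.\<close>

definition product_rule :: "(side \<Rightarrow> 'l list \<Rightarrow> complex) \<Rightarrow> ((side \<times> 'l alg) list \<Rightarrow> complex)
    \<Rightarrow> (('l \<times> side) list \<Rightarrow> complex) \<Rightarrow> bool" where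
  "product_rule c R F \<longleftrightarrow> (\<forall>es. alternating es \<and> ccentered c es \<longrightarrow> lf F (copy_prod es) = R es)"

lemma pruleD: "product_rule c R F \<Longrightarrow> alternating es \<Longrightarrow> ccentered c es \<Longrightarrow> lf F (copy_prod es) = R es"
  by (simp add: product_rule_def)

abbreviation algs_of_pols :: "(side \<times> 'l pol) list \<Rightarrow> (side \<times> 'l alg) list" where
  "algs_of_pols es \<equiv> map (\<lambda>(s, p). (s, alg_of_pol p)) es"

lemma alternating_algs_of_pols [simp]: "alternating (algs_of_pols es) \<longleftrightarrow> alternating es"
  by (simp add: alternating_successively case_prod_unfold comp_def)

lemma ccentered_algs_of_pols [simp]: "ccentered c (algs_of_pols es) \<longleftrightarrow> (\<forall>(s, p) \<in> set es. lin (c s) p = 0)"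
  by (auto simp: ccentered_def lin_alg_of_pol)

lemma product_rule_pol:
  "product_rule c R F \<longleftrightarrow> (\<forall>es. alternating es \<and> (\<forall>(s, p) \<in> set es. lin (c s) p = 0)
      \<longrightarrow> lin F (prodE es) = R (algs_of_pols es))" (is "_ \<longleftrightarrow> ?r")
proof
  assume "product_rule c R F"
  then show ?r unfolding product_rule_def by (auto simp: lin_alg_of_pol[of F] alg_of_pol_prodE)
next
  assume r: ?r
  show "product_rule c R F"
    unfolding product_rule_def
  proof (intro allI impI)
    fix es assume es: "alternating es \<and> ccentered c es"
    obtain qs where "algs_of_pols qs = es" using surj_alg_of_pol_list by blast
    then show "lf F (copy_prod es) = R es" using r es by (auto simp: lin_alg_of_pol[of F] alg_of_pol_prodE)
  qed
qed

lemma product_rule_ex1: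
  assumes "multilinear R" "\<And>s. c s [] = 1"
  shows "\<exists>!F. product_rule c R F"
  unfolding product_rule_def by (rule product_functional_ex1) (rule assms)+

text \<open>Resolves the \<open>THE\<close> inside \<open>conv\<close>, so that later arguments work
  with some F obeying the rule.\<close>

lemma conv_product_rule:
  assumes P: "\<And>F. P f g F \<longleftrightarrow> product_rule c R F" and "multilinear R" "\<And>s. c s [] = 1"
  obtains F where "product_rule c R F" "P f g F" "conv P f g = dsum F"
proof -
  have "\<exists>!F. P f g F" unfolding P using product_rule_ex1[of R c] assms(2,3) by simp
  then have "P f g (THE F. P f g F)" by (rule theI')
  then show ?thesis using P that by (auto simp: conv_def)
qed

definition part :: "side \<Rightarrow> (side \<times> 'l alg) list \<Rightarrow> 'l alg list" where
  "part s es = map snd (filter (\<lambda>e. fst e = s) es)"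

lemma part_simps [simp]:
  "part s [] = []" "part s ((t, a) # es) = (if t = s then a # part s es else part s es)"
  "part s (es @ fs) = part s es @ part s fs"
  by (simp_all add: part_def)

lemma map_alg_of_pol_parts: "map alg_of_pol (parts s es) = part s (algs_of_pols es)"
  by (induction es) (auto simp: parts_def)

section \<open>The prescribed values of the five products\<close>

definition rfree :: "(side \<times> 'l alg) list \<Rightarrow> complex" where
  "rfree es = (if es = [] then 1 else 0)"
definition rtens :: "('l list \<Rightarrow> complex) \<Rightarrow> ('l list \<Rightarrow> complex) \<Rightarrow> (side \<times> 'l alg) list \<Rightarrow> complex" where
  "rtens f g es = lf f (prod_list (part Fst es)) * lf g (prod_list (part Snd es))"
definition rbool :: "('l list \<Rightarrow> complex) \<Rightarrow> ('l list \<Rightarrow> complex) \<Rightarrow> (side \<times> 'l alg) list \<Rightarrow> complex" where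
  "rbool f g es = prod_list (map (\<lambda>(s, a). lf (ph f g s) a) es)"
definition rmono :: "('l list \<Rightarrow> complex) \<Rightarrow> ('l list \<Rightarrow> complex) \<Rightarrow> (side \<times> 'l alg) list \<Rightarrow> complex" where
  "rmono f g es = lf f (prod_list (part Fst es)) * prod_list (map (lf g) (part Snd es))"
definition ranti :: "('l list \<Rightarrow> complex) \<Rightarrow> ('l list \<Rightarrow> complex) \<Rightarrow> (side \<times> 'l alg) list \<Rightarrow> complex" where
  "ranti f g es = prod_list (map (lf f) (part Fst es)) * lf g (prod_list (part Snd es))"

lemma lf_mid_add: "lf f (x * ((a + b) * y)) = lf f (x * (a * y)) + lf f (x * (b * y))"
  by (simp add: algebra_simps lf_add)

lemma lf_mid_scale: "lf f (x * (sc k * a * y)) = k * lf f (x * (a * y))"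
  by (simp add: mult.assoc sc_comm_left lf_scale)

lemma multilinear_sides:
  "multilinear R \<longleftrightarrow>
     (\<forall>p q a b. R (p @ (Fst, a + b) # q) = R (p @ (Fst, a) # q) + R (p @ (Fst, b) # q)) \<and>
     (\<forall>p q k a. R (p @ (Fst, sc k * a) # q) = k * R (p @ (Fst, a) # q)) \<and>
     (\<forall>p q a b. R (p @ (Snd, a + b) # q) = R (p @ (Snd, a) # q) + R (p @ (Snd, b) # q)) \<and>
     (\<forall>p q k a. R (p @ (Snd, sc k * a) # q) = k * R (p @ (Snd, a) # q))"
  unfolding multilinear_def by (auto; case_tac s; simp)

lemma multilinear_rules:
  "multilinear rfree" "multilinear (rtens f g)" "multilinear (rbool f g)"
  "multilinear (rmono f g)" "multilinear (ranti f g)"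
  by (simp_all add: multilinear_sides rfree_def rtens_def rbool_def rmono_def ranti_def
      lf_mid_add lf_mid_scale lf_add lf_scale
      distrib_left[where 'a = complex] distrib_right[where 'a = complex] mult_ac(3)[where 'a = complex])

lemma cou_Nil [simp]: "cou [] = 1" by (simp add: cou_def)

lemma free_prod_iff: "free_prod f g F \<longleftrightarrow> product_rule (ph f g) rfree F"
proof -
  have "lin F (prodE []) = F []" by (simp add: lin_alg_of_pol alg_of_pol_prodE lf_1)
  then show ?thesis unfolding free_prod_def product_rule_pol rfree_def by force
qed

lemma rule_Nil:
  assumes "R [] = 1"
  shows "F [] = 1 \<and> (\<forall>es. alternating es \<and> centered es \<longrightarrow> lin F (prodE es) = R (algs_of_pols es))
    \<longleftrightarrow> product_rule (\<lambda>_. cou) R F"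
proof -
  have "lin F (prodE []) = F []" by (simp add: lin_alg_of_pol alg_of_pol_prodE lf_1)
  then show ?thesis unfolding product_rule_pol centered_def using assms by force
qed

lemma tensor_prod_iff: "f [] = 1 \<Longrightarrow> g [] = 1 \<Longrightarrow> tensor_prod f g F \<longleftrightarrow> product_rule (\<lambda>_. cou) (rtens f g) F"
  unfolding tensor_prod_def
  by (subst rule_Nil[symmetric]) (simp_all add: rtens_def lf_1 lin_alg_of_pol alg_of_pol_pprod map_alg_of_pol_parts)

lemma boolean_prod_iff: "boolean_prod f g F \<longleftrightarrow> product_rule (\<lambda>_. cou) (rbool f g) F"
  unfolding boolean_prod_def
  by (subst rule_Nil[symmetric]) (simp_all add: rbool_def lin_alg_of_pol case_prod_unfold comp_def)

lemma monotone_prod_iff: "f [] = 1 \<Longrightarrow> monotone_prod f g F \<longleftrightarrow> product_rule (\<lambda>_. cou) (rmono f g) F"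
  unfolding monotone_prod_def
  by (subst rule_Nil[symmetric])
    (simp_all add: rmono_def lf_1 lin_alg_of_pol[abs_def] alg_of_pol_pprod comp_def flip: map_alg_of_pol_parts)

lemma antimonotone_prod_iff: "g [] = 1 \<Longrightarrow> antimonotone_prod f g F \<longleftrightarrow> product_rule (\<lambda>_. cou) (ranti f g) F"
  unfolding antimonotone_prod_def
  by (subst rule_Nil[symmetric])
    (simp_all add: ranti_def lf_1 lin_alg_of_pol[abs_def] alg_of_pol_pprod comp_def flip: map_alg_of_pol_parts)

section \<open>The comultiplication on the free algebra\<close>

definition Delta_alg :: "'n::finite ulet alg \<Rightarrow> ('n ulet \<times> side) alg" where
  "Delta_alg = alg_hom (\<lambda>l. \<Sum>k\<in>UNIV. wd (dl l k))"

lemma dsum_Delta_alg: "dsum F w = lf F (Delta_alg (wd w))"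
proof (induction w arbitrary: F)
  case Nil
  show ?case by (simp add: Delta_alg_def alg_hom_wd lf_1)
next
  case (Cons l w)
  have "dsum F (l # w) = (\<Sum>k\<in>UNIV. lf F (wd (dl l k) * Delta_alg (wd w)))"
    by (simp add: Cons lf_wd_left)
  then show ?case by (simp add: Delta_alg_def alg_hom_wd sum_distrib_right lf_sum)
qed

lemma lf_dsum: "lf (dsum F) a = lf F (Delta_alg a)"
  by (induction a rule: alg_induct) (simp_all add: lf_add lf_scale Delta_alg_def alg_hom_add alg_hom_scale dsum_Delta_alg)

subsection \<open>Positivity\<close>

lemma lin_pmul_pstar:
  "lin f (pmul (pstar p) q)
     = (\<Sum>(c, v)\<leftarrow>p. \<Sum>(d, w)\<leftarrow>q. cnj c * d * f (wstar v @ w))"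
proof (induction p)
  case Nil
  show ?case by (simp add: pmul_def pstar_def lin_def)
next
  case (Cons x p)
  obtain c v where x: "x = (c, v)" by force
  have "pmul (pstar (x # p)) q = map (\<lambda>(d, w). (cnj c * d, wstar v @ w)) q @ pmul (pstar p) q"
    by (simp add: pmul_def x pstar_def)
  then show ?case using Cons
    by (simp add: x lin_def comp_def case_prod_unfold mult.assoc)
qed

text \<open>A polynomial involves finitely many words, so a Gram representation of each finite
  family suffices, and its index set may depend on the family.\<close>

lemma positive_if_gram:
  fixes f :: "'n ulet list \<Rightarrow> complex"
  assumes "\<And>W. finite W \<Longrightarrow> \<exists>(S :: 'b set) \<xi>. finite S \<and>
      (\<forall>v\<in>W. \<forall>w\<in>W. f (wstar v @ w) = (\<Sum>a\<in>S. cnj (\<xi> v a) * \<xi> w a))"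
  shows "Im (lin f (pmul (pstar p) p)) = 0 \<and> 0 \<le> Re (lin f (pmul (pstar p) p))"
proof -
  obtain S :: "'b set" and \<xi> where S: "finite S"
    "\<And>v w. v \<in> snd ` set p \<Longrightarrow> w \<in> snd ` set p \<Longrightarrow> f (wstar v @ w) = (\<Sum>a\<in>S. cnj (\<xi> v a) * \<xi> w a)"
    using assms[of "snd ` set p"] by auto
  define g where "g a = (\<Sum>(d, w)\<leftarrow>p. d * \<xi> w a)" for a
  have sum_swap: "(\<Sum>x\<leftarrow>q. \<Sum>a\<in>S. h x a) = (\<Sum>a\<in>S. \<Sum>x\<leftarrow>q. h x a)"
    for q :: "(complex \<times> 'n ulet list) list" and h :: "_ \<Rightarrow> 'b \<Rightarrow> complex"
    by (induction q) (simp_all add: sum.distrib)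
  have cnj_sum: "cnj (\<Sum>x\<leftarrow>q. h x) = (\<Sum>x\<leftarrow>q. cnj (h x))"
    for q :: "(complex \<times> 'n ulet list) list" and h
    by (induction q) simp_all
  have "lin f (pmul (pstar p) p) = (\<Sum>x\<leftarrow>p. \<Sum>y\<leftarrow>p. cnj (fst x) * fst y * f (wstar (snd x) @ snd y))"
    by (simp add: lin_pmul_pstar case_prod_unfold)
  also have "\<dots> = (\<Sum>x\<leftarrow>p. \<Sum>y\<leftarrow>p. \<Sum>a\<in>S. cnj (fst x * \<xi> (snd x) a) * (fst y * \<xi> (snd y) a))"
    by (intro arg_cong[of _ _ sum_list] map_cong refl)
      (simp add: S sum_distrib_left algebra_simps)
  also have "\<dots> = (\<Sum>a\<in>S. cnj (g a) * g a)"
    by (simp add: sum_swap g_def case_prod_unfold cnj_sum sum_list_const_mult sum_list_mult_const)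
  also have "\<dots> = of_real (\<Sum>a\<in>S. (cmod (g a))\<^sup>2)"
    by (simp add: mult.commute[of "cnj _"] complex_norm_square[symmetric])
  finally have "lin f (pmul (pstar p) p) = of_real (\<Sum>a\<in>S. (cmod (g a))\<^sup>2)" .
  then show ?thesis by (simp add: sum_nonneg)
qed

section \<open>No Haar trace for the boolean and monotone convolutions\<close>

text \<open>The average of the two characters sending the generator \<open>u\<^sub>i\<^sub>j\<close>
  to \<open>v i\<close> or to \<open>- v i\<close> if i = j, and to 0 otherwise, for a vector v of
  signs. Averaging kills words of odd length, in particular the generators.\<close>

definition diag_state :: "('n \<Rightarrow> complex) \<Rightarrow> 'n ulet list \<Rightarrow> complex" where
  "diag_state v w = (if even (length w) then prod_list (map (\<lambda>(i, j, b). if i = j then v i else 0) w) else 0)"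

lemma diag_state_state:
  fixes v :: "'n::finite \<Rightarrow> complex"
  assumes v: "\<And>i. v i = 1 \<or> v i = -1"
  shows "is_state (diag_state v)" "is_tracial (diag_state v)"
proof -
  let ?c = "\<lambda>w. prod_list (map (\<lambda>(i, j, b). if i = j then v i else 0) w)"
  have vv: "v i * v i = 1" for i using v[of i] by auto
  have delta: "(\<Sum>k\<in>UNIV. (if k = i then a k else 0) * (if k = j then b k else 0))
      = (if i = j then a i * b i else (0::complex))" for i j :: 'n and a b
  proof -
    have "(\<Sum>k\<in>UNIV. (if k = i then a k else 0) * (if k = j then b k else 0))
      = (\<Sum>k\<in>UNIV. if k = i then a i * (if i = j then b i else 0) else 0)"
      by (intro sum.cong) auto
    then show ?thesis by simp
  qed
  have 1: "(\<Sum>k\<in>UNIV. ?c (p @ [(k, i, True), (k, j, False)] @ q)) = (if i = j then ?c (p @ q) else 0)"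
    for p q i j
  proof -
    have "(\<Sum>k\<in>UNIV. ?c (p @ [(k, i, True), (k, j, False)] @ q))
      = ?c (p @ q) * (\<Sum>k\<in>UNIV. (if k = i then v k else 0) * (if k = j then v k else 0))"
      by (simp add: sum_distrib_left algebra_simps)
    then show ?thesis by (simp only: delta) (simp add: vv)
  qed
  have 2: "(\<Sum>k\<in>UNIV. ?c (p @ [(i, k, False), (j, k, True)] @ q)) = (if i = j then ?c (p @ q) else 0)"
    for p q i j
  proof -
    have "(\<Sum>k\<in>UNIV. ?c (p @ [(i, k, False), (j, k, True)] @ q))
      = ?c (p @ q) * (\<Sum>k\<in>UNIV. (if k = i then v k else 0) * (if k = j then v k else 0))"
      unfolding sum_distrib_left by (intro sum.cong refl) (auto simp: algebra_simps)
    then show ?thesis by (simp only: delta) (simp add: vv)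
  qed
  have rel: "vanishes_on_relations (diag_state v)"
    unfolding vanishes_on_relations_def
  proof (intro conjI allI)
    fix p q :: "'n ulet list" and i j
    show "(\<Sum>k\<in>UNIV. diag_state v (p @ [(k, i, True), (k, j, False)] @ q))
       = (if i = j then diag_state v (p @ q) else 0)"
      using 1[of p i j q] by (auto simp: diag_state_def)
    show "(\<Sum>k\<in>UNIV. diag_state v (p @ [(i, k, False), (j, k, True)] @ q))
       = (if i = j then diag_state v (p @ q) else 0)"
      using 2[of p i j q] by (auto simp: diag_state_def)
  qed
  have cv: "cnj (v i) = v i" for i using v[of i] by auto
  have star: "?c (wstar w) = cnj (?c w)" for w
  proof (induction w)
    case (Cons x w)
    obtain i j b where x: "x = (i, j, b)" by (cases x)
    have "wstar (x # w) = wstar w @ [(i, j, \<not> b)]" by (simp add: wstar_def x)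
    then show ?case using Cons by (simp add: x cv)
  qed (simp add: wstar_def)
  have "Im (lin (diag_state v) (pmul (pstar p) p)) = 0 \<and> 0 \<le> Re (lin (diag_state v) (pmul (pstar p) p))" for p
  proof (rule positive_if_gram)
    fix W :: "'n ulet list set"
    \<comment> \<open>One coordinate for each parity of the length: \<open>wstar u @ w\<close> has
      even length exactly if the parities of u and w agree.\<close>
    let ?\<xi> = "\<lambda>w a. if even (length w) = a then ?c w else 0"
    have "diag_state v (wstar u @ w) = (\<Sum>a\<in>UNIV. cnj (?\<xi> u a) * ?\<xi> w a)" for u w
      using star[of u] by (auto simp: diag_state_def UNIV_bool wstar_def)
    then show "\<exists>(S :: bool set) \<xi>. finite S \<and>
      (\<forall>u\<in>W. \<forall>w\<in>W. diag_state v (wstar u @ w) = (\<Sum>a\<in>S. cnj (\<xi> u a) * \<xi> w a))"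
      by (intro exI[of _ UNIV] exI[of _ ?\<xi>]) simp
  qed
  then show "is_state (diag_state v)"
    using rel by (simp add: is_state_def diag_state_def)
  show "is_tracial (diag_state v)"
    by (simp add: is_tracial_def diag_state_def add.commute mult.commute)
qed

text \<open>The outer factors are only seen through their expectations, up to the scalar part of the middle
  factor, which lets them multiply.\<close>

lemma sandwich:
  fixes R :: "(side \<times> 'n ulet alg) list \<Rightarrow> complex"
  assumes F: "product_rule (\<lambda>_. cou) R F" and st: "s \<noteq> t"
    and R: "R [] = 1" "\<And>a. R [(s, a)] = lf \<phi> a" "\<And>x. R [(t, x)] = lf \<psi> x"
      "\<And>a x. R [(s, a), (t, x)] = lf \<phi> a * lf \<psi> x" "\<And>x b. R [(t, x), (s, b)] = lf \<psi> x * lf \<phi> b"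
      "\<And>a x b. R [(s, a), (t, x), (s, b)] = lf \<phi> a * lf \<psi> x * lf \<phi> b"
    and one: "\<phi> [] = 1"
  shows "lf F (copy_hom s a * copy_hom t x * copy_hom s b)
     = lf \<phi> a * lf \<phi> b * (lf \<psi> x - lf cou x * \<psi> []) + lf cou x * lf \<phi> (a * b)"
proof -
  note [simp] = alternating_Cons lf_diff lf_sc
  have one_block: "lf F (copy_hom s y) = lf \<phi> y" for y
  proof -
    let ?y = "y - sc (lf cou y)"
    have "copy_hom s y = copy_prod [(s, ?y)] + sc (lf cou y) * copy_prod []"
      by (simp add: copy_hom_diff)
    then show ?thesis
      using pruleD[OF F, of "[(s, ?y)]"] pruleD[OF F, of "[]"]
      by (simp add: lf_add lf_scale R one del: copy_prod_Cons copy_prod_Nil)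
  qed
  have expand: "(A + sc \<alpha>) * (X + sc \<xi>) * (B + sc \<beta>) = A * (X * B) + sc \<alpha> * (X * B) + sc \<beta> * (A * X)
      + sc \<alpha> * (sc \<beta> * X) + sc \<xi> * ((A + sc \<alpha>) * (B + sc \<beta>))"
    for A X B :: "('n ulet \<times> side) alg" and \<alpha> \<beta> \<xi>
  proof -
    have scsc: "sc c * (sc d * y) = sc d * (sc c * y)" "sc c * sc d = sc d * sc c"
      for c d and y :: "('n ulet \<times> side) alg"
      by (rule sc_comm_left) (rule sc_comm)
    show ?thesis
      by (simp add: distrib_left distrib_right mult.assoc sc_comm[of A] sc_comm[of X] sc_comm[of B]
          sc_comm_left[of A] sc_comm_left[of X] sc_comm_left[of B] scsc)
  qed
  let ?a = "a - sc (lf cou a)" and ?b = "b - sc (lf cou b)" and ?x = "x - sc (lf cou x)"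
  have "copy_hom s a * copy_hom t x * copy_hom s b = copy_prod [(s, ?a), (t, ?x), (s, ?b)]
      + sc (lf cou a) * copy_prod [(t, ?x), (s, ?b)] + sc (lf cou b) * copy_prod [(s, ?a), (t, ?x)]
      + sc (lf cou a) * (sc (lf cou b) * copy_prod [(t, ?x)]) + sc (lf cou x) * copy_hom s (a * b)"
    using expand[of "copy_hom s ?a" "lf cou a" "copy_hom t ?x" "lf cou x" "copy_hom s ?b" "lf cou b"]
    by (simp add: copy_hom_diff copy_hom_mult)
  then have "lf F (copy_hom s a * copy_hom t x * copy_hom s b) = R [(s, ?a), (t, ?x), (s, ?b)]
      + lf cou a * R [(t, ?x), (s, ?b)] + lf cou b * R [(s, ?a), (t, ?x)]
      + lf cou a * (lf cou b * R [(t, ?x)]) + lf cou x * lf \<phi> (a * b)"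
    using st
    by (simp add: lf_add lf_scale one_block pruleD[OF F] del: copy_prod_Cons copy_prod_Nil)
  then show ?thesis by (simp add: R one algebra_simps)
qed

lemma sum_delta2:
  "(\<Sum>p\<in>(UNIV :: 'n::finite set). \<Sum>q\<in>(UNIV :: 'n set).
     (if p = j then 1 else 0) * (if q = l then 1 else 0) * g p q) = (g j l :: complex)"
proof -
  have "(\<Sum>p\<in>UNIV. \<Sum>q\<in>UNIV. (if p = j then 1 else 0) * (if q = l then 1 else 0) * g p q)
     = (\<Sum>p\<in>UNIV. \<Sum>q\<in>UNIV. if q = l then if p = j then g p l else 0 else 0)"
    by (intro sum.cong) auto
  then show ?thesis by simp
qed

text \<open>Covers the boolean and the anti-monotone rule through their values on lists of at most
  three entries with the first copy outside. The comultiplication of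
  \<open>u\<^sub>i\<^sub>j u\<^sub>k\<^sub>l\<^sup>*\<close> has its first-copy letters at both
  ends.\<close>

lemma no_haar_outer_Fst:
  fixes h :: "'n::finite ufun"
  assumes n: "card (UNIV :: 'n set) \<ge> 2"
    and P: "\<And>f F. f [] = 1 \<Longrightarrow> P f h F \<longleftrightarrow> product_rule (\<lambda>_. cou) (R f) F"
    and R: "\<And>f. multilinear (R f)" "\<And>f. f [] = 1 \<Longrightarrow> R f [] = 1" "\<And>f a. R f [(Fst, a)] = lf f a * h []"
      "\<And>f x. f [] = 1 \<Longrightarrow> R f [(Snd, x)] = lf h x" "\<And>f a x. R f [(Fst, a), (Snd, x)] = lf f a * lf h x"
      "\<And>f x b. R f [(Snd, x), (Fst, b)] = lf h x * lf f b"
      "\<And>f a x b. R f [(Fst, a), (Snd, x), (Fst, b)] = lf f a * lf h x * lf f b"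
  shows "\<not> haar_trace P h"
proof
  assume haar: "haar_trace P h"
  then have h1: "h [] = 1" by (simp add: haar_trace_def is_state_def)
  have key: "h [(i, j, False), (k, l, True)] = diag_state v [(i, j, False), (k, l, True)]"
    if v: "\<And>i. v i = 1 \<or> v i = -1" for v i j k l
  proof -
    let ?f = "diag_state v"
    have f1: "?f [] = 1" by (simp add: diag_state_def)
    obtain F where F: "product_rule (\<lambda>_. cou) (R ?f) F" "conv P ?f h = dsum F"
      using conv_product_rule[of P ?f h "\<lambda>_. cou" "R ?f", OF P[of ?f, OF f1] R(1) cou_Nil] by blast
    have "h = dsum F"
      using haar diag_state_state[of v, OF v] F(2) by (simp add: haar_trace_def)
    moreover have "F [((i, p, False), Fst), ((p, j, False), Snd), ((q, l, True), Snd), ((k, q, True), Fst)]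
        = (if p = j then 1 else 0) * (if q = l then 1 else 0) * ?f [(i, p, False), (k, q, True)]" for p q
    proof -
      have "wd [((i, p, False), Fst), ((p, j, False), Snd), ((q, l, True), Snd), ((k, q, True), Fst)]
        = copy_hom Fst (wd [(i, p, False)]) * copy_hom Snd (wd [(p, j, False), (q, l, True)]) * copy_hom Fst (wd [(k, q, True)])"
        by (simp add: copy_hom_wd flip: wd_append)
      then have "F [((i, p, False), Fst), ((p, j, False), Snd), ((q, l, True), Snd), ((k, q, True), Fst)]
        = lf F (copy_hom Fst (wd [(i, p, False)]) * copy_hom Snd (wd [(p, j, False), (q, l, True)]) * copy_hom Fst (wd [(k, q, True)]))"
        by (metis lf_wd)
      \<comment> \<open>f vanishes on single letters, so only the scalar part of the middle factor
        contributes, and there the two outer letters multiply.\<close>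
      also have "\<dots> = cou [(p, j, False), (q, l, True)] * ?f [(i, p, False), (k, q, True)]"
        by (subst sandwich[OF F(1), of Fst Snd ?f h])
          (simp_all add: R h1 f1 diag_state_def flip: wd_append)
      finally show ?thesis by (simp add: cou_def)
    qed
    ultimately show ?thesis by (simp add: dl_def sum_delta2)
  qed
  obtain i j :: 'n where ij: "i \<noteq> j"
    using n by (metis card_le_Suc0_iff_eq finite not_less_eq_eq numeral_2_eq_2)
  \<comment> \<open>The two sign patterns give 1 and -1 on this word, although both would have to
    equal h.\<close>
  have "diag_state (\<lambda>_. 1) [(i, i, False), (j, j, True)]
      = diag_state (\<lambda>k. if k = i then -1 else 1) [(i, i, False), (j, j, True)]"
    using key[of "\<lambda>_. 1" i i j j] key[of "\<lambda>k. if k = i then -1 else 1" i i j j] by simp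
  then show False using ij by (simp add: diag_state_def)
qed

text \<open>The monotone rule evaluates second-copy factors one by one, so here f is the right
  factor; the word \<open>u\<^sub>i\<^sub>j\<^sup>* u\<^sub>k\<^sub>l\<close> puts the second copy
  outside.\<close>

lemma no_haar_outer_Snd:
  fixes h :: "'n::finite ufun"
  assumes n: "card (UNIV :: 'n set) \<ge> 2"
    and P: "\<And>f F. h [] = 1 \<Longrightarrow> P h f F \<longleftrightarrow> product_rule (\<lambda>_. cou) (R f) F"
    and R: "\<And>f. multilinear (R f)" "\<And>f. h [] = 1 \<Longrightarrow> R f [] = 1" "\<And>f a. R f [(Snd, a)] = lf f a * h []"
      "\<And>f x. R f [(Fst, x)] = lf h x" "\<And>f a x. R f [(Snd, a), (Fst, x)] = lf f a * lf h x"
      "\<And>f x b. R f [(Fst, x), (Snd, b)] = lf h x * lf f b"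
      "\<And>f a x b. R f [(Snd, a), (Fst, x), (Snd, b)] = lf f a * lf h x * lf f b"
  shows "\<not> haar_trace P h"
proof
  assume haar: "haar_trace P h"
  then have h1: "h [] = 1" by (simp add: haar_trace_def is_state_def)
  have key: "h [(i, j, True), (k, l, False)] = diag_state v [(i, j, True), (k, l, False)]"
    if v: "\<And>i. v i = 1 \<or> v i = -1" for v i j k l
  proof -
    let ?f = "diag_state v"
    have f1: "?f [] = 1" by (simp add: diag_state_def)
    obtain F where F: "product_rule (\<lambda>_. cou) (R ?f) F" "conv P h ?f = dsum F"
      using conv_product_rule[of P h ?f "\<lambda>_. cou" "R ?f", OF P[OF h1] R(1) cou_Nil] by blast
    have "h = dsum F"
      using haar diag_state_state[of v, OF v] F(2) by (simp add: haar_trace_def)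
    moreover have "F [((p, j, True), Snd), ((i, p, True), Fst), ((k, q, False), Fst), ((q, l, False), Snd)]
        = (if p = i then 1 else 0) * (if q = k then 1 else 0) * ?f [(p, j, True), (q, l, False)]" for p q
    proof -
      have "wd [((p, j, True), Snd), ((i, p, True), Fst), ((k, q, False), Fst), ((q, l, False), Snd)]
        = copy_hom Snd (wd [(p, j, True)]) * copy_hom Fst (wd [(i, p, True), (k, q, False)]) * copy_hom Snd (wd [(q, l, False)])"
        by (simp add: copy_hom_wd flip: wd_append)
      then have "F [((p, j, True), Snd), ((i, p, True), Fst), ((k, q, False), Fst), ((q, l, False), Snd)]
        = lf F (copy_hom Snd (wd [(p, j, True)]) * copy_hom Fst (wd [(i, p, True), (k, q, False)]) * copy_hom Snd (wd [(q, l, False)]))"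
        by (metis lf_wd)
      also have "\<dots> = cou [(i, p, True), (k, q, False)] * ?f [(p, j, True), (q, l, False)]"
        by (subst sandwich[OF F(1), of Snd Fst ?f h])
          (simp_all add: R h1 f1 diag_state_def flip: wd_append)
      finally show ?thesis by (auto simp: cou_def)
    qed
    ultimately show ?thesis by (simp add: dl_def sum_delta2)
  qed
  obtain i j :: 'n where ij: "i \<noteq> j"
    using n by (metis card_le_Suc0_iff_eq finite not_less_eq_eq numeral_2_eq_2)
  have "diag_state (\<lambda>_. 1) [(i, i, True), (j, j, False)]
      = diag_state (\<lambda>k. if k = i then -1 else 1) [(i, i, True), (j, j, False)]"
    using key[of "\<lambda>_. 1" i i j j] key[of "\<lambda>k. if k = i then -1 else 1" i i j j] by simp
  then show False using ij by (simp add: diag_state_def)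
qed

lemma no_haar_boolean: "card (UNIV :: 'n set) \<ge> 2 \<Longrightarrow> \<not> haar_trace boolean_prod (h :: 'n::finite ufun)"
proof
  assume n: "card (UNIV :: 'n set) \<ge> 2" and haar: "haar_trace boolean_prod h"
  then have "h [] = 1" by (simp add: haar_trace_def is_state_def)
  then have "\<not> haar_trace boolean_prod h"
    by (intro no_haar_outer_Fst[OF n, of boolean_prod h "\<lambda>f. rbool f h"])
      (simp_all add: boolean_prod_iff multilinear_rules rbool_def ph_def)
  then show False using haar by contradiction
qed

lemma no_haar_antimonotone: "card (UNIV :: 'n set) \<ge> 2 \<Longrightarrow> \<not> haar_trace antimonotone_prod (h :: 'n::finite ufun)"
proof
  assume n: "card (UNIV :: 'n set) \<ge> 2" and haar: "haar_trace antimonotone_prod h"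
  then have "h [] = 1" by (simp add: haar_trace_def is_state_def)
  then have "\<not> haar_trace antimonotone_prod h"
    by (intro no_haar_outer_Fst[OF n, of antimonotone_prod h "\<lambda>f. ranti f h"])
      (simp_all add: antimonotone_prod_iff multilinear_rules ranti_def lf_1)
  then show False using haar by contradiction
qed

lemma no_haar_monotone: "card (UNIV :: 'n set) \<ge> 2 \<Longrightarrow> \<not> haar_trace monotone_prod (h :: 'n::finite ufun)"
proof
  assume n: "card (UNIV :: 'n set) \<ge> 2" and haar: "haar_trace monotone_prod h"
  then have "h [] = 1" by (simp add: haar_trace_def is_state_def)
  then have "\<not> haar_trace monotone_prod h"
    by (intro no_haar_outer_Snd[OF n, of h monotone_prod "\<lambda>f. rmono h f"])
      (simp_all add: monotone_prod_iff multilinear_rules rmono_def lf_1)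
  then show False using haar by contradiction
qed

section \<open>The antipode and one-sided invariance\<close>

fun antipode_letter :: "'n ulet \<Rightarrow> 'n ulet" where "antipode_letter (i, j, b) = (j, i, \<not> b)"

fun flip :: "side \<Rightarrow> side" where "flip Fst = Snd" | "flip Snd = Fst"

text \<open>Composition with the antipode \<Sigma>. It is a homomorphism here, so the order of the
  letters is kept.\<close>

definition antipode_dual :: "('n ulet list \<Rightarrow> complex) \<Rightarrow> 'n ulet list \<Rightarrow> complex" where
  "antipode_dual f w = f (map antipode_letter w)"

lemma antipode_letter_antipode_letter [simp]: "antipode_letter (antipode_letter l) = l" by (cases l) auto

lemma antipode_dual_antipode_dual [simp]: "antipode_dual (antipode_dual f) = f"
  by (rule ext) (simp add: antipode_dual_def comp_def)

lemma antipode_dual_Nil [simp]: "antipode_dual f [] = f []" by (simp add: antipode_dual_def)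

lemma wstar_antipode_letter: "wstar (map antipode_letter w) = map antipode_letter (wstar w)"
  by (auto simp: wstar_def rev_map)

lemma is_state_antipode_dual:
  assumes "is_state f"
  shows "is_state (antipode_dual f)"
proof -
  have "vanishes_on_relations (antipode_dual f)"
    using assms unfolding is_state_def vanishes_on_relations_def antipode_dual_def by simp
  moreover have "lin (antipode_dual f) (pmul (pstar p) p)
      = lin f (pmul (pstar (map (apsnd (map antipode_letter)) p)) (map (apsnd (map antipode_letter)) p))" for p
    by (simp add: lin_pmul_pstar antipode_dual_def case_prod_unfold comp_def wstar_antipode_letter)
  ultimately show ?thesis using assms by (simp add: is_state_def)
qed

lemma is_tracial_antipode_dual: "is_tracial f \<Longrightarrow> is_tracial (antipode_dual f)"
  by (simp add: is_tracial_def antipode_dual_def)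

definition swap :: "'n ulet \<times> side \<Rightarrow> 'n ulet \<times> side" where
  "swap = (\<lambda>(l, s). (antipode_letter l, flip s))"

text \<open>\<Sigma> intertwines \<Delta> with the exchange of the two copies; this is why it
  reverses the order of the factors in a convolution.\<close>

lemma dsum_swap: "dsum F (map antipode_letter w) = dsum (\<lambda>v. F (map swap v)) w"
proof (induction w arbitrary: F)
  case (Cons l w)
  have "dl (antipode_letter l) k = map swap (dl l k)" for k
    by (cases l) (auto simp: dl_def swap_def)
  then show ?case using Cons by simp
qed simp

definition antipode_alg :: "'n ulet alg \<Rightarrow> 'n ulet alg" where "antipode_alg = alg_hom (\<lambda>l. wd [antipode_letter l])"

lemma lf_antipode_alg: "lf f (antipode_alg a) = lf (antipode_dual f) a"
  by (simp add: antipode_alg_def lf_alg_hom_letters antipode_dual_def[abs_def])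

lemma alg_hom_swap_copy_hom: "alg_hom (\<lambda>x. wd [swap x]) (copy_hom s a) = copy_hom (flip s) (antipode_alg a)"
  unfolding copy_hom_def antipode_alg_def
  by (subst (1 2) alg_hom_cong_comp[OF refl]) (simp add: alg_hom_wd swap_def)

abbreviation swap_blocks :: "(side \<times> 'n ulet alg) list \<Rightarrow> (side \<times> 'n ulet alg) list" where
  "swap_blocks es \<equiv> map (\<lambda>(s, a). (flip s, antipode_alg a)) es"

lemma alg_hom_swap_copy_prod: "alg_hom (\<lambda>x. wd [swap x]) (copy_prod es) = copy_prod (swap_blocks es)"
  by (induction es) (auto simp: alg_hom_mult alg_hom_swap_copy_hom)

lemma flip_eq [simp]: "flip s = flip t \<longleftrightarrow> s = t"
  by (cases s; cases t) auto

lemma alternating_swap_blocks [simp]: "alternating (swap_blocks es) \<longleftrightarrow> alternating es"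
  by (simp add: alternating_def case_prod_unfold)

lemma product_rule_swap:
  assumes "product_rule c R F" and "\<And>s. c' s = antipode_dual (c (flip s))" and "\<And>es. R' es = R (swap_blocks es)"
  shows "product_rule c' R' (\<lambda>v. F (map swap v))"
  unfolding product_rule_def
proof (intro allI impI)
  fix es assume es: "alternating es \<and> ccentered c' es"
  then have "ccentered c (swap_blocks es)"
    by (auto simp: ccentered_def assms(2) lf_antipode_alg)
  then have "lf F (copy_prod (swap_blocks es)) = R' es"
    using es by (simp add: pruleD[OF assms(1)] assms(3))
  then show "lf (\<lambda>v. F (map swap v)) (copy_prod es) = R' es"
    by (simp add: lf_alg_hom_letters[symmetric] alg_hom_swap_copy_prod)
qed

lemma conv_eq:
  assumes P: "\<And>F. P f g F \<longleftrightarrow> product_rule c R F" and "multilinear R" "\<And>s. c s [] = 1" and "product_rule c R F"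
  shows "conv P f g = dsum F"
proof -
  obtain F' where "product_rule c R F'" "conv P f g = dsum F'"
    using conv_product_rule[of P f g c R, OF assms(1-3)] by blast
  moreover have "F' = F"
    using product_rule_ex1[of R c, OF assms(2,3)] calculation(1) assms(4) by blast
  ultimately show ?thesis by simp
qed

lemma conv_free_antipode_dual:
  assumes "f [] = 1" "g [] = 1"
  shows "conv free_prod f g (map antipode_letter w) = conv free_prod (antipode_dual g) (antipode_dual f) w"
proof -
  have c1: "ph f g s [] = 1" "ph (antipode_dual g) (antipode_dual f) s [] = 1" for s
    using assms by (cases s; simp add: ph_def)+
  obtain F where F: "product_rule (ph f g) rfree F" "conv free_prod f g = dsum F"
    using conv_product_rule[of free_prod f g "ph f g" rfree, OF free_prod_iff multilinear_rules(1) c1(1)] by blast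
  have "product_rule (ph (antipode_dual g) (antipode_dual f)) rfree (\<lambda>v. F (map swap v))"
  proof (rule product_rule_swap[OF F(1)])
    show "ph (antipode_dual g) (antipode_dual f) s = antipode_dual (ph f g (flip s))" for s by (cases s) (simp_all add: ph_def)
  qed (simp add: rfree_def)
  then have "conv free_prod (antipode_dual g) (antipode_dual f) = dsum (\<lambda>v. F (map swap v))"
    using conv_eq[of free_prod "antipode_dual g" "antipode_dual f", OF free_prod_iff multilinear_rules(1) c1(2)] by blast
  then show ?thesis using F(2) by (simp add: dsum_swap)
qed

lemma conv_tensor_antipode_dual:
  fixes f g :: "'a::finite ufun"
  assumes "f [] = 1" "g [] = 1"
  shows "conv tensor_prod f g (map antipode_letter w) = conv tensor_prod (antipode_dual g) (antipode_dual f) w"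
proof -
  have a1: "antipode_dual f [] = 1" "antipode_dual g [] = 1" using assms by simp_all
  obtain F where F: "product_rule (\<lambda>_. cou) (rtens f g) F" "conv tensor_prod f g = dsum F"
    using conv_product_rule[of tensor_prod f g "\<lambda>_. cou" "rtens f g",
        OF tensor_prod_iff[of f g, OF assms] multilinear_rules(2) cou_Nil] by blast
  have "product_rule (\<lambda>_. cou) (rtens (antipode_dual g) (antipode_dual f)) (\<lambda>v. F (map swap v))"
  proof (rule product_rule_swap[OF F(1)])
    have "(case antipode_letter l of (i, j, b) \<Rightarrow> if i = j then 1 else 0) = (case l of (i, j, b) \<Rightarrow> if i = j then 1 else (0::complex))"
      for l :: "'a ulet" by (cases l) auto
    then have "cou (map antipode_letter w) = cou w" for w :: "'a ulet list"
      by (simp add: cou_def comp_def)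
    then show "(cou :: 'a ufun) = antipode_dual cou" by (simp add: antipode_dual_def[abs_def])
    fix es :: "(side \<times> 'a ulet alg) list"
    have part: "part (flip s) (swap_blocks es) = map antipode_alg (part s es)" for s
      by (induction es) auto
    have "prod_list (map antipode_alg as) = antipode_alg (prod_list as)" for as :: "'a ulet alg list"
      by (induction as) (simp_all add: antipode_alg_def alg_hom_mult)
    then show "rtens (antipode_dual g) (antipode_dual f) es = rtens f g (swap_blocks es)"
      using part[of Fst] part[of Snd] by (simp add: rtens_def lf_antipode_alg)
  qed
  then have "conv tensor_prod (antipode_dual g) (antipode_dual f) = dsum (\<lambda>v. F (map swap v))"
    using conv_eq[of tensor_prod "antipode_dual g" "antipode_dual f",
        OF tensor_prod_iff[of "antipode_dual g" "antipode_dual f", OF a1(2) a1(1)] multilinear_rules(2) cou_Nil] by blast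
  then show ?thesis using F(2) by (simp add: dsum_swap)
qed

text \<open>If \<open>h\<close> is left invariant then \<open>antipode_dual h\<close> is right invariant, and convolving one with the other shows
  that they coincide.\<close>

lemma haar_trace_if_left_invariant:
  assumes antipode_dual: "\<And>f g w. f [] = 1 \<Longrightarrow> g [] = 1 \<Longrightarrow> conv P f g (map antipode_letter w) = conv P (antipode_dual g) (antipode_dual f) w"
    and h: "is_state h" "is_tracial h"
    and left: "\<And>f. is_state f \<Longrightarrow> is_tracial f \<Longrightarrow> conv P f h = h"
  shows "haar_trace P h"
proof -
  have st1: "f [] = 1" if "is_state f" for f :: "'a ufun" using that by (simp add: is_state_def)
  have right: "conv P (antipode_dual h) f = antipode_dual h" if f: "is_state f" "is_tracial f" for f
  proof
    fix w
    have "conv P (antipode_dual h) f w = conv P (antipode_dual f) h (map antipode_letter w)"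
      using antipode_dual[of "antipode_dual f" h w] st1 f h by simp
    also have "\<dots> = antipode_dual h w"
      using left[of "antipode_dual f"] f by (simp add: is_state_antipode_dual is_tracial_antipode_dual antipode_dual_def)
    finally show "conv P (antipode_dual h) f w = antipode_dual h w" .
  qed
  have "antipode_dual h = h"
    using right[OF h] left[of "antipode_dual h"] h by (simp add: is_state_antipode_dual is_tracial_antipode_dual)
  then show ?thesis using h left right by (simp add: haar_trace_def)
qed

section \<open>Left invariance for the free convolution\<close>

text \<open>\<open>gen_entry False\<close> is the matrix \<open>U\<close> of generators and \<open>gen_entry True\<close> is its adjoint.\<close>

definition gen_entry :: "bool \<Rightarrow> 'n \<Rightarrow> 'n \<Rightarrow> 'n ulet alg" where
  "gen_entry e i j = wd [if e then (j, i, True) else (i, j, False)]"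

text \<open>\<open>e = False\<close> is the relation for U times its adjoint and
  \<open>e = True\<close> the opposite one, so both families become a single statement.\<close>

definition rel_null :: "('n::finite ulet list \<Rightarrow> complex) \<Rightarrow> bool" where
  "rel_null d \<longleftrightarrow> (\<forall>x y e i j. lf d (x * (\<Sum>k\<in>UNIV. gen_entry e i k * gen_entry (\<not> e) k j) * y)
     = (if i = j then lf d (x * y) else 0))"

lemma lf_mult_eqI:
  assumes "\<And>v w. lf d (wd v * a * wd w) = lf d (wd v * b * wd w)"
  shows "lf d (x * a * y) = lf d (x * b * y)"
proof (induction x rule: alg_induct)
  case (word c v)
  have "lf d (wd v * a * y) = lf d (wd v * b * y)"
  proof (induction y rule: alg_induct)
    case (word c' w)
    then show ?case using assms by (simp add: sc_comm_left lf_scale)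
  qed (simp_all add: distrib_left lf_add)
  then show ?case by (simp add: mult.assoc lf_scale)
qed (simp_all add: distrib_right lf_add)

lemma rel_null_if_vanishes:
  fixes d :: "'a::finite ufun"
  assumes "vanishes_on_relations d"
  shows "rel_null d"
  unfolding rel_null_def
proof (intro allI)
  fix x y :: "'a ulet alg" and e and i j :: 'a
  let ?a = "\<Sum>k\<in>UNIV. gen_entry e i k * gen_entry (\<not> e) k j" and ?b = "if i = j then 1 else 0 :: 'a ulet alg"
  have "lf d (x * ?a * y) = lf d (x * ?b * y)"
  proof (rule lf_mult_eqI)
    fix v w
    show "lf d (wd v * ?a * wd w) = lf d (wd v * ?b * wd w)"
      using assms by (cases e) (simp_all add: vanishes_on_relations_def gen_entry_def
        sum_distrib_left sum_distrib_right lf_sum flip: wd_append)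
  qed
  then show "lf d (x * ?a * y) = (if i = j then lf d (x * y) else 0)" by simp
qed

text \<open>Columns of matrix words \<open>U\<^sup>e B U\<^sup>e' B' \<dots>\<close> in which a matrix between two powers of opposite sign is
  traceless. A Haar unitary that is free from the scalar matrices annihilates all of them.\<close>

inductive chain :: "bool \<Rightarrow> ('n::finite \<Rightarrow> 'n ulet alg) \<Rightarrow> bool" where
  chain_base: "chain e (\<lambda>i. gen_entry e i j)"
| chain_step: "chain e' Y \<Longrightarrow> (e \<noteq> e' \<Longrightarrow> (\<Sum>j\<in>UNIV. B j j) = 0) \<Longrightarrow>
    chain e (\<lambda>i. \<Sum>j\<in>UNIV. \<Sum>l\<in>UNIV. gen_entry e i j * (sc (B j l) * Y l))"

definition chain_null :: "'n::finite ufun \<Rightarrow> bool" where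
  "chain_null d \<longleftrightarrow> (\<forall>e Y i. chain e Y \<longrightarrow> lf d (Y i) = 0)"

lemma chain_nullD: "chain_null d \<Longrightarrow> chain e Y \<Longrightarrow> lf d (Y i) = 0"
  by (auto simp: chain_null_def)

lemma sum_unit:
  fixes g :: "'n::finite \<Rightarrow> 'n \<Rightarrow> 'a alg"
  shows "(\<Sum>p\<in>UNIV. \<Sum>q\<in>UNIV. g p q * (sc (if p = j \<and> q = l then 1 else 0) * Y q)) = g j l * Y l"
proof -
  have "(\<Sum>p\<in>UNIV. \<Sum>q\<in>UNIV. g p q * (sc (if p = j \<and> q = l then 1 else 0) * Y q))
     = (\<Sum>p\<in>UNIV. \<Sum>q\<in>UNIV. if q = l then if p = j then g p l * Y l else 0 else 0)"
    by (intro sum.cong) auto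
  then show ?thesis by simp
qed

lemma sum_diag:
  fixes g :: "'n::finite \<Rightarrow> 'a alg"
  shows "(\<Sum>p\<in>UNIV. \<Sum>q\<in>UNIV. g p * (sc (if p = q then c else 0) * Y q)) = sc c * (\<Sum>p\<in>UNIV. g p * Y p)"
proof -
  have "(\<Sum>p\<in>UNIV. \<Sum>q\<in>UNIV. g p * (sc (if p = q then c else 0) * Y q))
     = (\<Sum>p\<in>UNIV. \<Sum>q\<in>UNIV. if p = q then sc c * (g p * Y p) else 0)"
    by (intro sum.cong) (auto simp: sc_comm_left)
  then show ?thesis by (simp add: sum_distrib_left)
qed

text \<open>Modulo the relations every word is a combination of 1 and entries of chains. The
  reduction works from the right end of the word, so equality is tested under an arbitrary left
  multiple x.\<close>

lemma chain_functional_zero: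
  fixes d :: "'n::finite ulet list \<Rightarrow> complex"
  assumes rel: "rel_null d" and one: "d [] = 0"
    and chain: "chain_null d"
  shows "d w = 0"
proof -
  define X where "X = insert (1 :: 'n ulet alg) {Y i | Y i e. chain e Y}"
  have Xchain: "Y i \<in> X" if "chain e Y" for e Y i using that by (auto simp: X_def)
  have relL: "lf d (x * (\<Sum>k\<in>UNIV. gen_entry e i k * (gen_entry (\<not> e) k j * y))) = (if i = j then lf d (x * y) else 0)"
    for x e i j y
    using rel unfolding rel_null_def by (metis (no_types, lifting) mult.assoc sum.cong sum_distrib_right)
  have step_haar_entry: "\<exists>r'\<in>lin_span X. \<forall>x. lf d (x * (gen_entry e i j * y)) = lf d (x * r')" if y: "y \<in> X" for e i j y
  proof -
    consider "y = 1" | e' Y l where "chain e' Y" "y = Y l" using y by (auto simp: X_def)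
    then show ?thesis
    proof cases
      case 1
      have "gen_entry e i j \<in> X" using Xchain[OF chain_base[of e j], of i] .
      then show ?thesis using 1 by (intro bexI[of _ "gen_entry e i j"]) (auto intro: lin_span_superset)
    next
      case 2
      show ?thesis
      \<comment> \<open>The product is a chain with a matrix unit in between. The matrix unit is
        admissible unless the signs differ and j = l, where its trace is 1.\<close>
      proof (cases "e = e' \<or> j \<noteq> l")
        case True
        have "chain e (\<lambda>i. \<Sum>p\<in>UNIV. \<Sum>q\<in>UNIV. gen_entry e i p * (sc (if p = j \<and> q = l then 1 else 0) * Y q))"
        proof (rule chain_step[OF 2(1)])
          assume "e \<noteq> e'"
          then have "(if p = j \<and> p = l then 1 else 0 :: complex) = 0" for p using True by auto
          then show "(\<Sum>p\<in>UNIV. if p = j \<and> p = l then 1 else 0 :: complex) = 0" by simp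
        qed
        then have "chain e (\<lambda>i. gen_entry e i j * Y l)" by (simp only: sum_unit)
        then have "gen_entry e i j * Y l \<in> X" by (rule Xchain)
        then show ?thesis using 2 by (intro bexI[of _ "gen_entry e i j * y"]) (auto intro: lin_span_superset)
      next
        case False
        then have e': "e' = (\<not> e)" and jl: "j = l" by auto
        define n where "n = (of_nat (card (UNIV :: 'n set)) :: complex)"
        have n0: "n \<noteq> 0" by (simp add: n_def)
        \<comment> \<open>The traceless part of the matrix unit; the multiple 1/n of the identity is
          treated separately.\<close>
        let ?B = "\<lambda>p q. (if p = l \<and> q = l then 1 else 0) - (if p = q then 1 / n else 0)"
        have "(\<Sum>p\<in>(UNIV :: 'n set). ?B p p) = 0"
          using n0 by (simp add: sum_subtractf n_def)
        then have "chain e (\<lambda>i. \<Sum>p\<in>UNIV. \<Sum>q\<in>UNIV. gen_entry e i p * (sc (?B p q) * Y q))"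
          by (intro chain_step[OF 2(1)]) simp
        moreover have "(\<Sum>p\<in>UNIV. \<Sum>q\<in>UNIV. gen_entry e i p * (sc (?B p q) * Y q))
            = gen_entry e i l * Y l - sc (1 / n) * (\<Sum>p\<in>UNIV. gen_entry e i p * Y p)" for i
          by (simp add: sc_diff left_diff_distrib right_diff_distrib sum_subtractf sum_unit sum_diag
              del: sc_0)
        ultimately have "chain e (\<lambda>i. gen_entry e i l * Y l - sc (1 / n) * (\<Sum>p\<in>UNIV. gen_entry e i p * Y p))"
          by simp
        then have Z: "gen_entry e i l * Y l - sc (1 / n) * (\<Sum>p\<in>UNIV. gen_entry e i p * Y p) \<in> X" (is "?Z \<in> X")
          by (rule Xchain)
        \<comment> \<open>The identity part makes two opposite powers of U adjacent. The relation
          contracts them, leaving a shorter column or a constant.\<close>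
        have "\<exists>s\<in>lin_span X. \<forall>x. lf d (x * (\<Sum>p\<in>UNIV. gen_entry e i p * Y p)) = lf d (x * s)"
          using 2(1)
        proof cases
          case (chain_base j')
          have "lf d (x * (\<Sum>p\<in>UNIV. gen_entry e i p * Y p)) = lf d (x * (if i = j' then 1 else 0))" for x
            using relL[of x e i j' 1] by (simp add: chain_base e')
          moreover have "(if i = j' then 1 else 0) \<in> lin_span X"
            by (auto intro: lin_span_0 lin_span_superset simp: X_def)
          ultimately show ?thesis by blast
        next
          case (chain_step e'' Y' B)
          have "(\<Sum>p\<in>UNIV. gen_entry e i p * Y p)
             = (\<Sum>j\<in>UNIV. \<Sum>q\<in>UNIV. \<Sum>p\<in>UNIV. gen_entry e i p * (gen_entry e' p j * (sc (B j q) * Y' q)))"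
            unfolding chain_step(1) sum_distrib_left
            by (subst sum.swap, rule sum.cong[OF refl], rule sum.swap)
          then have "lf d (x * (\<Sum>p\<in>UNIV. gen_entry e i p * Y p))
             = (\<Sum>j\<in>UNIV. \<Sum>q\<in>UNIV. lf d (x * (\<Sum>p\<in>UNIV. gen_entry e i p * (gen_entry e' p j * (sc (B j q) * Y' q)))))" for x
            by (simp add: sum_distrib_left lf_sum)
          moreover have "lf d (x * (\<Sum>p\<in>UNIV. gen_entry e i p * (gen_entry e' p j * (sc (B j q) * Y' q))))
             = (if j = i then lf d (x * (sc (B i q) * Y' q)) else 0)" for x j q
            using relL[of x e i j] by (auto simp: e')
          moreover have "(\<Sum>j\<in>UNIV. \<Sum>q\<in>UNIV. if j = i then g q else (0 :: complex)) = (\<Sum>q\<in>UNIV. g q)"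
            for g :: "'n \<Rightarrow> complex"
            by (subst sum.swap) simp
          ultimately have "lf d (x * (\<Sum>p\<in>UNIV. gen_entry e i p * Y p)) = lf d (x * (\<Sum>q\<in>UNIV. sc (B i q) * Y' q))" for x
            by (simp add: sum_distrib_left lf_sum)
          moreover have "(\<Sum>q\<in>UNIV. sc (B i q) * Y' q) \<in> lin_span X"
            by (intro lin_span_sum lin_span_base Xchain[OF chain_step(2)])
          ultimately show ?thesis by blast
        qed
        then obtain s where s: "s \<in> lin_span X" "\<And>x. lf d (x * (\<Sum>p\<in>UNIV. gen_entry e i p * Y p)) = lf d (x * s)"
          by blast
        have "lf d (x * (gen_entry e i j * y)) = lf d (x * (?Z + sc (1 / n) * s))" for x
        proof -
          have "lf d (x * (gen_entry e i j * y)) = lf d (x * ?Z + sc (1 / n) * (x * (\<Sum>p\<in>UNIV. gen_entry e i p * Y p)))"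
            by (simp add: 2 jl right_diff_distrib sc_comm_left)
          then show ?thesis using s(2)[of x] by (simp add: lf_add lf_scale distrib_left sc_comm_left)
        qed
        moreover have "?Z + sc (1 / n) * s \<in> lin_span X"
          using Z s(1) by (intro lin_span_add lin_span_scale) (auto intro: lin_span_superset)
        ultimately show ?thesis by blast
      qed
    qed
  qed
  have step: "\<exists>r'\<in>lin_span X. \<forall>x. lf d (x * (gen_entry e i j * r)) = lf d (x * r')" if "r \<in> lin_span X" for e i j r
    using that
  proof induction
    case lin_span_0
    show ?case by (rule bexI[of _ 0]) (simp_all add: lin_span.lin_span_0)
  next
    case (lin_span_base y k)
    then obtain r' where "r' \<in> lin_span X" "\<forall>x. lf d (x * (gen_entry e i j * y)) = lf d (x * r')"
      using step_haar_entry by blast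
    then show ?case
      by (intro bexI[of _ "sc k * r'"]) (simp_all add: sc_comm_left lf_scale lin_span_scale)
  next
    case (lin_span_add y z)
    then obtain r1 r2 where "r1 \<in> lin_span X" "\<forall>x. lf d (x * (gen_entry e i j * y)) = lf d (x * r1)"
      "r2 \<in> lin_span X" "\<forall>x. lf d (x * (gen_entry e i j * z)) = lf d (x * r2)" by blast
    then show ?case
      by (intro bexI[of _ "r1 + r2"]) (simp_all add: distrib_left lf_add lin_span.lin_span_add)
  qed
  have "\<exists>r\<in>lin_span X. \<forall>x. lf d (x * wd w) = lf d (x * r)"
  proof (induction w)
    case Nil
    have "wd [] \<in> lin_span X" by (rule lin_span_superset) (simp add: X_def flip: one_alg)
    then show ?case by blast
  next
    case (Cons l w)
    then obtain r where r: "r \<in> lin_span X" "\<And>x. lf d (x * wd w) = lf d (x * r)" by blast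
    obtain e i j where l: "wd [l] = gen_entry e i j"
    proof (cases l)
      case (fields i j b)
      then show ?thesis using that[of b "if b then j else i" "if b then i else j"] by (auto simp: gen_entry_def)
    qed
    obtain r' where r': "r' \<in> lin_span X" "\<And>x. lf d (x * (gen_entry e i j * r)) = lf d (x * r')"
      using step[OF r(1)] by blast
    have "lf d (x * wd (l # w)) = lf d (x * r')" for x
      using r(2)[of "x * gen_entry e i j"] r'(2)[of x] wd_append[of "[l]" w] by (simp add: l mult.assoc)
    then show ?case using r'(1) by blast
  qed
  then obtain r where r: "r \<in> lin_span X" "lf d (1 * wd w) = lf d (1 * r)" by blast
  have "lf d r = 0"
    by (rule lf_lin_span_0[OF r(1)]) (auto simp: X_def lf_1 one chain_nullD[OF chain])
  then show ?thesis using r(2) by simp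
qed

subsection \<open>The free product and the relations\<close>

text \<open>Between an element of \<open>lspan\<close> and one of \<open>rspan\<close>, r becomes
  part of an entry \<open>a * r * b\<close>, which is centred by assumption. The result is a
  nonempty alternating centred product, killed by the free rule.\<close>

lemma free_product_ideal:
  assumes F: "product_rule c rfree F" and c1: "\<And>s. c s [] = 1"
    and r: "\<And>a b. lf (c s) (a * r * b) = 0"
  shows "lf F (x * copy_hom s r * y) = 0"
proof -
  let ?N = "{copy_prod es | es. alternating es \<and> ccentered c es \<and> es \<noteq> []}"
  have haar_entry: "u * copy_hom s r * v \<in> ?N" if "u \<in> lspan c s" "v \<in> rspan c s" for u v
  proof -
    obtain es a where u: "u = copy_prod es * copy_hom s a" "alternating es" "ccentered c es"
      "es = [] \<or> fst (last es) \<noteq> s" using \<open>u \<in> lspan c s\<close> by (auto simp: lspan_def)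
    obtain fs b where v: "v = copy_hom s b * copy_prod fs" "alternating fs" "ccentered c fs"
      "fs = [] \<or> fst (hd fs) \<noteq> s" using \<open>v \<in> rspan c s\<close> by (auto simp: rspan_def)
    have "u * copy_hom s r * v = copy_prod (es @ (s, a * r * b) # fs)"
      by (simp add: u v copy_prod_append copy_hom_mult mult.assoc)
    moreover have "alternating (es @ (s, a * r * b) # fs)" "ccentered c (es @ (s, a * r * b) # fs)"
      using u v r by (auto simp: alternating_append alternating_Cons)
    ultimately show ?thesis by blast
  qed
  have "u * copy_hom s r * y \<in> lin_span ?N" if "u \<in> lspan c s" for u
    by (rule lin_span_map[OF lin_span_rspan[where c = c and s = s and x = y, OF c1], of "\<lambda>y. u * copy_hom s r * y"])
      (use haar_entry[OF that] in \<open>auto simp: distrib_left sc_comm_left intro!: lin_span_superset\<close>)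
  then have "x * copy_hom s r * y \<in> lin_span ?N"
    by (intro lin_span_map[OF lin_span_lspan[where c = c and s = s and x = x, OF c1], of "\<lambda>x. x * copy_hom s r * y"])
      (auto simp: distrib_right mult.assoc)
  then show ?thesis
    by (rule lf_lin_span_0) (auto simp: pruleD[OF F] rfree_def)
qed

lemma free_product_rel:
  fixes f g :: "'n::finite ufun"
  assumes F: "product_rule (ph f g) rfree F" and f: "is_state f" and g: "is_state g"
  shows "lf F (x * (\<Sum>k\<in>UNIV. copy_hom s (gen_entry e i k) * copy_hom s (gen_entry (\<not> e) k j)) * y)
     = (if i = j then lf F (x * y) else 0)"
proof -
  let ?r = "(\<Sum>k\<in>UNIV. gen_entry e i k * gen_entry (\<not> e) k j) - (if i = j then 1 else 0)"
  have "rel_null (ph f g s)" "ph f g s' [] = 1" for s'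
    using f g by (cases s; cases s'; auto simp: ph_def is_state_def intro: rel_null_if_vanishes)+
  then have "lf F (x * copy_hom s ?r * y) = 0"
    by (intro free_product_ideal[OF F]) (auto simp: rel_null_def right_diff_distrib left_diff_distrib lf_diff)
  then show ?thesis
    by (auto simp: copy_hom_diff copy_hom_sum copy_hom_mult right_diff_distrib left_diff_distrib lf_diff)
qed

text \<open>The copy standing on the left in \<Delta> of an entry; for the adjoint the order of the
  factors is reversed.\<close>

abbreviation outer :: "bool \<Rightarrow> side" where "outer e \<equiv> (if e then Snd else Fst)"

lemma Delta_alg_gen_entry:
  fixes i j :: "'n::finite"
  shows "Delta_alg (gen_entry e i j) = (\<Sum>k\<in>UNIV. copy_hom (outer e) (gen_entry e i k) * copy_hom (outer (\<not> e)) (gen_entry e k j))"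
  by (cases e) (simp_all add: Delta_alg_def gen_entry_def alg_hom_wd copy_hom_wd dl_def flip: wd_append)

lemma Delta_alg_mult: "Delta_alg (a * b) = Delta_alg a * Delta_alg b" by (simp add: Delta_alg_def alg_hom_mult)
lemma Delta_alg_sum: "Delta_alg (sum g S) = (\<Sum>x\<in>S. Delta_alg (g x))" by (simp add: Delta_alg_def alg_hom_sum)
lemma Delta_alg_sc: "Delta_alg (sc c) = sc c" by (simp add: Delta_alg_def)

text \<open>A product of two unitaries is unitary: the inner pair contracts in its copy, which
  brings the outer pair together.\<close>

lemma rel_null_dsum:
  fixes f g :: "'n::finite ufun"
  assumes F: "product_rule (ph f g) rfree F" and f: "is_state f" and g: "is_state g"
  shows "rel_null (dsum F)"
  unfolding rel_null_def
proof (intro allI)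
  fix x y :: "'n ulet alg" and e and i j :: 'n
  let ?A = "\<lambda>p. copy_hom (outer e) (gen_entry e i p)" and ?A' = "\<lambda>q. copy_hom (outer e) (gen_entry (\<not> e) q j)"
  let ?B = "\<lambda>p k. copy_hom (outer (\<not> e)) (gen_entry e p k)" and ?B' = "\<lambda>k q. copy_hom (outer (\<not> e)) (gen_entry (\<not> e) k q)"
  have "(\<Sum>k\<in>UNIV. Delta_alg (gen_entry e i k) * Delta_alg (gen_entry (\<not> e) k j))
      = (\<Sum>k\<in>UNIV. \<Sum>p\<in>UNIV. \<Sum>q\<in>UNIV. ?A p * (?B p k * ?B' k q) * ?A' q)"
    by (cases e) (simp_all add: Delta_alg_gen_entry sum_product mult.assoc)
  also have "\<dots> = (\<Sum>p\<in>UNIV. \<Sum>q\<in>UNIV. ?A p * (\<Sum>k\<in>UNIV. ?B p k * ?B' k q) * ?A' q)"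
    unfolding sum_distrib_left sum_distrib_right
    by (subst sum.swap, rule sum.cong[OF refl], rule sum.swap)
  finally have eq: "(\<Sum>k\<in>UNIV. Delta_alg (gen_entry e i k) * Delta_alg (gen_entry (\<not> e) k j))
      = (\<Sum>p\<in>UNIV. \<Sum>q\<in>UNIV. ?A p * (\<Sum>k\<in>UNIV. ?B p k * ?B' k q) * ?A' q)" .
  have "lf (dsum F) (x * (\<Sum>k\<in>UNIV. gen_entry e i k * gen_entry (\<not> e) k j) * y)
      = lf F (Delta_alg x * (\<Sum>k\<in>UNIV. Delta_alg (gen_entry e i k) * Delta_alg (gen_entry (\<not> e) k j)) * Delta_alg y)"
    by (simp add: lf_dsum Delta_alg_mult Delta_alg_sum)
  also have "\<dots> = (\<Sum>p\<in>UNIV. \<Sum>q\<in>UNIV. lf F ((Delta_alg x * ?A p) * (\<Sum>k\<in>UNIV. ?B p k * ?B' k q) * (?A' q * Delta_alg y)))"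
    unfolding eq by (simp only: sum_distrib_left sum_distrib_right mult.assoc lf_sum)
  also have "\<dots> = (\<Sum>p\<in>UNIV. \<Sum>q\<in>UNIV. if p = q then lf F ((Delta_alg x * ?A p) * (?A' q * Delta_alg y)) else 0)"
    by (simp only: free_product_rel[OF F f g])
  also have "\<dots> = lf F (Delta_alg x * (\<Sum>p\<in>UNIV. ?A p * ?A' p) * Delta_alg y)"
    by (simp add: sum_distrib_left sum_distrib_right mult.assoc lf_sum)
  also have "\<dots> = (if i = j then lf F (Delta_alg x * Delta_alg y) else 0)"
    by (rule free_product_rel[OF F f g])
  finally show "lf (dsum F) (x * (\<Sum>k\<in>UNIV. gen_entry e i k * gen_entry (\<not> e) k j) * y)
      = (if i = j then lf (dsum F) (x * y) else 0)"
    by (simp add: lf_dsum Delta_alg_mult)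
qed

subsection \<open>The convolution annihilates chains\<close>

text \<open>The tail \<open>es\<close> is the same for all rows, so a matrix acting on the column
  touches only the chain \<open>C\<close>. When h kills chains, the leading block is
  centred.\<close>

inductive free_col :: "'n::finite ufun \<Rightarrow> 'n ufun \<Rightarrow> bool \<Rightarrow> ('n \<Rightarrow> ('n ulet \<times> side) alg) \<Rightarrow> bool" for f h where
  free_col_0: "free_col f h e (\<lambda>_. 0)"
| free_col_add: "free_col f h e Z \<Longrightarrow> free_col f h e Z' \<Longrightarrow> free_col f h e (\<lambda>k. Z k + Z' k)"
| free_col_base: "chain e C \<Longrightarrow> alternating es \<Longrightarrow> ccentered (ph f h) es \<Longrightarrow> (es = [] \<or> fst (hd es) = Fst)
    \<Longrightarrow> free_col f h e (\<lambda>k. sc a * (copy_hom Snd (C k) * copy_prod es))"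

lemma free_col_sum: "(\<And>x. x \<in> S \<Longrightarrow> free_col f h e (Z x)) \<Longrightarrow> free_col f h e (\<lambda>k. \<Sum>x\<in>S. Z x k)"
  by (induction S rule: infinite_finite_induct) (auto intro: free_col.intros)

lemma free_col_eq: "free_col f h e Z \<Longrightarrow> (\<And>k. Z k = Z' k) \<Longrightarrow> free_col f h e Z'"
  by (subgoal_tac "Z = Z'") auto

lemma free_col_letter:
  assumes "f [] = 1"
  shows "free_col f h e (\<lambda>i. copy_hom Snd (gen_entry e i p) * copy_hom Fst y)"
proof (rule free_col_eq)
  let ?y = "y - sc (lf f y)"
  show "free_col f h e (\<lambda>i. sc 1 * (copy_hom Snd (gen_entry e i p) * copy_prod [(Fst, ?y)])
      + sc (lf f y) * (copy_hom Snd (gen_entry e i p) * copy_prod []))"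
    by (intro free_col_add free_col_base chain_base)
      (auto simp: alternating_Cons ph_def lf_diff lf_sc assms)
qed (simp add: copy_hom_diff algebra_simps sc_comm)

text \<open>Split \<open>X\<close> into its expectation and a centred rest. The rest makes a new
  first-copy block, with a single generator in front; the expectation is a scalar matrix that
  lengthens the chain, where the trace condition is needed.\<close>

lemma free_col_step:
  assumes f1: "f [] = 1" and h: "chain_null h"
  shows "free_col f h e' Z \<Longrightarrow> (e \<noteq> e' \<Longrightarrow> (\<Sum>p\<in>UNIV. lf f (X p p)) = 0) \<Longrightarrow> free_col f h e (\<lambda>i. \<Sum>p\<in>UNIV. \<Sum>m\<in>UNIV. copy_hom Snd (gen_entry e i p) * (copy_hom Fst (X p m) * Z m))"
proof (induction rule: free_col.induct)
  case (free_col_0 e)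
  then show ?case by (simp add: free_col.free_col_0)
next
  case (free_col_add e' Z Z')
  then show ?case
    by (simp add: distrib_left sum.distrib free_col.free_col_add)
next
  case base: (free_col_base e' C es a)
  show ?case
  proof (rule free_col_eq)
    note tr = base.prems
    let ?X = "\<lambda>p m. X p m - sc (lf f (X p m))"
    have "chain e (\<lambda>i. \<Sum>p\<in>UNIV. \<Sum>m\<in>UNIV. gen_entry e i p * (sc (lf f (X p m)) * C m))"
      using base(1) tr by (rule chain_step)
    then have 1: "free_col f h e (\<lambda>i. sc a * (copy_hom Snd (\<Sum>p\<in>UNIV. \<Sum>m\<in>UNIV. gen_entry e i p * (sc (lf f (X p m)) * C m)) * copy_prod es))"
      using base by (intro free_col.free_col_base) auto
    have 2: "free_col f h e (\<lambda>i. \<Sum>p\<in>UNIV. \<Sum>m\<in>UNIV.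
        sc a * (copy_hom Snd (gen_entry e i p) * copy_prod ((Fst, ?X p m) # (Snd, C m) # es)))"
      using base f1 chain_nullD[OF h base(1)]
      by (intro free_col_sum free_col.free_col_base chain_base)
        (auto simp: alternating_Cons ph_def lf_diff lf_sc)
    show "free_col f h e (\<lambda>i. (\<Sum>p\<in>UNIV. \<Sum>m\<in>UNIV.
        sc a * (copy_hom Snd (gen_entry e i p) * copy_prod ((Fst, ?X p m) # (Snd, C m) # es)))
       + sc a * (copy_hom Snd (\<Sum>p\<in>UNIV. \<Sum>m\<in>UNIV. gen_entry e i p * (sc (lf f (X p m)) * C m)) * copy_prod es))"
      by (rule free_col.free_col_add[OF 2 1])
    fix i
    have "sc a * (copy_hom Snd (gen_entry e i p) * copy_prod ((Fst, ?X p m) # (Snd, C m) # es))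
        + sc a * (copy_hom Snd (gen_entry e i p * (sc (lf f (X p m)) * C m)) * copy_prod es)
        = copy_hom Snd (gen_entry e i p) * (copy_hom Fst (X p m) * (sc a * (copy_hom Snd (C m) * copy_prod es)))" for p m
    proof -
      let ?U = "copy_hom Snd (gen_entry e i p)" and ?R = "copy_hom Snd (C m) * copy_prod es"
      have "?U * (copy_hom Fst (X p m) * (sc a * ?R)) = sc a * (?U * (copy_hom Fst (X p m) * ?R))"
        by (simp add: sc_comm_left[of "copy_hom Fst (X p m)"] sc_comm_left[of ?U])
      also have "\<dots> = sc a * (?U * (copy_hom Fst (?X p m) * ?R)) + sc a * (?U * (sc (lf f (X p m)) * ?R))"
        by (simp add: copy_hom_diff left_diff_distrib right_diff_distrib)
      finally show ?thesis by (simp add: copy_hom_mult copy_hom_scale mult.assoc)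
    qed
    then show "(\<Sum>p\<in>UNIV. \<Sum>m\<in>UNIV. sc a * (copy_hom Snd (gen_entry e i p) * copy_prod ((Fst, ?X p m) # (Snd, C m) # es)))
       + sc a * (copy_hom Snd (\<Sum>p\<in>UNIV. \<Sum>m\<in>UNIV. gen_entry e i p * (sc (lf f (X p m)) * C m)) * copy_prod es)
       = (\<Sum>p\<in>UNIV. \<Sum>m\<in>UNIV. copy_hom Snd (gen_entry e i p) * (copy_hom Fst (X p m) * (sc a * (copy_hom Snd (C m) * copy_prod es))))"
      by (simp add: copy_hom_sum sum_distrib_left sum_distrib_right flip: sum.distrib)
  qed
qed

lemma free_col_lf:
  assumes F: "product_rule (ph f h) rfree F" and f1: "f [] = 1" and h: "chain_null h"
  shows "free_col f h e Z \<Longrightarrow> lf F (copy_hom Fst a * Z k) = 0"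
proof (induction rule: free_col.induct)
  case (free_col_base e C es b)
  let ?a = "a - sc (lf f a)"
  have "copy_hom Fst a * (sc b * (copy_hom Snd (C k) * copy_prod es))
     = sc b * (copy_prod ((Fst, ?a) # (Snd, C k) # es) + sc (lf f a) * copy_prod ((Snd, C k) # es))"
    by (simp add: copy_hom_diff left_diff_distrib sc_comm_left[of "copy_hom Fst a"])
  moreover have "alternating ((Fst, ?a) # (Snd, C k) # es)" "alternating ((Snd, C k) # es)"
    "ccentered (ph f h) ((Fst, ?a) # (Snd, C k) # es)" "ccentered (ph f h) ((Snd, C k) # es)"
    using free_col_base chain_nullD[OF h free_col_base(1)] f1 by (auto simp: alternating_Cons ph_def lf_diff lf_sc)
  ultimately show ?case
    by (simp add: lf_scale lf_add pruleD[OF F] rfree_def del: copy_prod_Cons)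
qed (simp_all add: distrib_left lf_add)

text \<open>For \<open>e = False\<close> the leading first-copy letter is split off, so that the
  remaining column always begins in the second copy.\<close>

lemma Delta_alg_chain:
  fixes f h :: "'n::finite ufun"
  assumes f: "is_state f" "is_tracial f" and h: "chain_null h"
  shows "chain e Y \<Longrightarrow> \<exists>Z. free_col f h e Z \<and>
    (\<forall>i. Delta_alg (Y i) = (if e then Z i else \<Sum>k\<in>UNIV. copy_hom Fst (gen_entry e i k) * Z k))"
proof (induction rule: chain.induct)
  case (chain_base e j)
  have f1: "f [] = 1" using f by (simp add: is_state_def)
  show ?case
  proof (cases e)
    case True
    have "free_col f h e (\<lambda>i. \<Sum>k\<in>UNIV. copy_hom Snd (gen_entry e i k) * copy_hom Fst (gen_entry e k j))"
      by (intro free_col_sum free_col_letter f1)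
    then show ?thesis using True
      by (intro exI[of _ "\<lambda>i. \<Sum>k\<in>UNIV. copy_hom Snd (gen_entry e i k) * copy_hom Fst (gen_entry e k j)"]) (simp add: Delta_alg_gen_entry)
  next
    case False
    have "free_col f h e (\<lambda>i. copy_hom Snd (gen_entry e i j) * copy_hom Fst 1)"
      by (intro free_col_letter f1)
    then show ?thesis using False
      by (intro exI[of _ "\<lambda>i. copy_hom Snd (gen_entry e i j)"]) (simp add: Delta_alg_gen_entry)
  qed
next
  case (chain_step e' Y e B)
  have f1: "f [] = 1" using f by (simp add: is_state_def)
  from chain_step obtain Z where Z: "free_col f h e' Z"
    "\<And>l. Delta_alg (Y l) = (if e' then Z l else \<Sum>k\<in>UNIV. copy_hom Fst (gen_entry e' l k) * Z k)" by blast
  \<comment> \<open>\<Delta> turns U into the product \<open>U1 U2\<close> of its copies, so between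
    successive powers of \<open>U2\<close> there stands \<open>B\<close>, \<open>B U1\<close>,
    \<open>U1\<^sup>* B\<close> or \<open>U1\<^sup>* B U1\<close>, depending on the signs; this
    matrix is \<open>X\<close>.\<close>
  define X1 where "X1 j m = (if e' then sc (B j m) else \<Sum>l\<in>UNIV. sc (B j l) * gen_entry e' l m)" for j m
  define X where "X p m = (if e then \<Sum>j\<in>UNIV. gen_entry e p j * X1 j m else X1 p m)" for p m
  have X1: "(\<Sum>l\<in>UNIV. sc (B j l) * Delta_alg (Y l)) = (\<Sum>m\<in>UNIV. copy_hom Fst (X1 j m) * Z m)" for j
  proof (cases e')
    case False
    then show ?thesis
      by (simp add: Z(2) X1_def copy_hom_sum copy_hom_scale sum_distrib_left sum_distrib_right mult.assoc)
        (rule sum.swap)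
  qed (simp add: Z(2) X1_def)
  \<comment> \<open>Opposite signs leave \<open>B\<close> and \<open>U1\<^sup>* B U1\<close>. For
    the latter, traciality of f reverses the two letters, and the relation then reduces the sum to
    tr B.\<close>
  have tr: "(\<Sum>p\<in>UNIV. lf f (X p p)) = 0" if ee: "e \<noteq> e'"
  proof (cases e)
    case False
    then show ?thesis using ee chain_step(2) f1 by (simp add: X_def X1_def lf_sc)
  next
    case True
    have "(\<Sum>p\<in>UNIV. f [(j, p, True), (l, p, False)]) = (if j = l then 1 else 0)" for j l
    proof -
      have "(\<Sum>p\<in>UNIV. f ([] @ [(l, p, False), (j, p, True)] @ [])) = (if l = j then f ([] @ []) else 0)"
        using f(1) unfolding is_state_def vanishes_on_relations_def by blast
      moreover have "f ([(j, p, True)] @ [(l, p, False)]) = f ([(l, p, False)] @ [(j, p, True)])" for p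
        using f(2) unfolding is_tracial_def by blast
      ultimately show ?thesis using f1 by auto
    qed
    then have *: "(\<Sum>p\<in>UNIV. lf f (gen_entry True p j * gen_entry False l p)) = (if j = l then 1 else 0)" for j l
      by (simp add: gen_entry_def flip: wd_append)
    have "(\<Sum>p\<in>UNIV. lf f (X p p)) = (\<Sum>p\<in>UNIV. \<Sum>j\<in>UNIV. \<Sum>l\<in>UNIV. B j l * lf f (gen_entry True p j * gen_entry False l p))"
      using True ee by (simp add: X_def X1_def sum_distrib_left lf_sum sc_comm_left lf_scale)
    also have "\<dots> = (\<Sum>j\<in>UNIV. \<Sum>l\<in>UNIV. B j l * (\<Sum>p\<in>UNIV. lf f (gen_entry True p j * gen_entry False l p)))"
      unfolding sum_distrib_left by (subst sum.swap, rule sum.cong[OF refl], rule sum.swap)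
    also have "\<dots> = (\<Sum>j\<in>UNIV. B j j)"
      by (simp add: * if_distrib[of "\<lambda>x. _ * x"] cong: if_cong)
    finally show ?thesis using chain_step(2) ee by simp
  qed
  let ?Z = "\<lambda>i. \<Sum>p\<in>UNIV. \<Sum>m\<in>UNIV. copy_hom Snd (gen_entry e i p) * (copy_hom Fst (X p m) * Z m)"
  have "free_col f h e ?Z"
    by (rule free_col_step[where X = X and e = e, OF f1 h Z(1) tr])
  moreover have "Delta_alg (\<Sum>j\<in>UNIV. \<Sum>l\<in>UNIV. gen_entry e i j * (sc (B j l) * Y l))
      = (if e then ?Z i else \<Sum>k\<in>UNIV. copy_hom Fst (gen_entry e i k) * ?Z k)" for i
  proof -
    have "Delta_alg (\<Sum>j\<in>UNIV. \<Sum>l\<in>UNIV. gen_entry e i j * (sc (B j l) * Y l))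
       = (\<Sum>j\<in>UNIV. Delta_alg (gen_entry e i j) * (\<Sum>m\<in>UNIV. copy_hom Fst (X1 j m) * Z m))"
      by (simp add: Delta_alg_sum Delta_alg_mult Delta_alg_sc X1[symmetric] sum_distrib_left)
    also have "\<dots> = (if e then ?Z i else \<Sum>k\<in>UNIV. copy_hom Fst (gen_entry e i k) * ?Z k)"
    proof (cases e)
      case True
      have "(\<Sum>j\<in>UNIV. Delta_alg (gen_entry e i j) * (\<Sum>m\<in>UNIV. copy_hom Fst (X1 j m) * Z m))
        = (\<Sum>j\<in>UNIV. \<Sum>p\<in>UNIV. \<Sum>m\<in>UNIV. copy_hom Snd (gen_entry e i p) * (copy_hom Fst (gen_entry e p j) * (copy_hom Fst (X1 j m) * Z m)))"
        using True by (simp add: Delta_alg_gen_entry sum_product mult.assoc)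
      also have "\<dots> = (\<Sum>p\<in>UNIV. \<Sum>m\<in>UNIV. \<Sum>j\<in>UNIV. copy_hom Snd (gen_entry e i p) * (copy_hom Fst (gen_entry e p j) * (copy_hom Fst (X1 j m) * Z m)))"
        by (subst sum.swap, rule sum.cong[OF refl], rule sum.swap)
      also have "\<dots> = ?Z i"
        using True by (simp add: X_def copy_hom_sum copy_hom_mult sum_distrib_left sum_distrib_right mult.assoc)
      finally show ?thesis using True by simp
    next
      case False
      have "(\<Sum>j\<in>UNIV. Delta_alg (gen_entry e i j) * (\<Sum>m\<in>UNIV. copy_hom Fst (X1 j m) * Z m))
        = (\<Sum>k\<in>UNIV. \<Sum>j\<in>UNIV. copy_hom Fst (gen_entry e i k) * (copy_hom Snd (gen_entry e k j) * (\<Sum>m\<in>UNIV. copy_hom Fst (X1 j m) * Z m)))"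
        using False by (simp add: Delta_alg_gen_entry sum_distrib_right mult.assoc) (rule sum.swap)
      then show ?thesis using False by (simp add: X_def sum_distrib_left)
    qed
    finally show ?thesis .
  qed
  ultimately show ?case by (intro exI[of _ ?Z]) blast
qed

text \<open>The difference of the two functionals vanishes at the unit, respects the relations and
  kills chains, so it is zero.\<close>

lemma free_left_invariant:
  fixes f h :: "'n::finite ufun"
  assumes f: "is_state f" "is_tracial f" and antipode_alg: "is_state h"
    and h: "chain_null h"
  shows "conv free_prod f h = h"
proof -
  have f1: "f [] = 1" and h1: "h [] = 1" using f antipode_alg by (simp_all add: is_state_def)
  have c1: "ph f h s [] = 1" for s using f1 h1 by (cases s) (simp_all add: ph_def)
  obtain F where F: "product_rule (ph f h) rfree F" "conv free_prod f h = dsum F"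
    using conv_product_rule[of free_prod f h "ph f h" rfree, OF free_prod_iff multilinear_rules(1) c1] by blast
  have rel: "rel_null (dsum F)" "rel_null h"
    using rel_null_dsum[OF F(1) f(1) antipode_alg] antipode_alg by (auto simp: is_state_def intro: rel_null_if_vanishes)
  have F1: "F [] = 1" using pruleD[OF F(1), of "[]"] by (simp add: rfree_def lf_1)
  have chain: "lf (dsum F) (Y i) = 0" if Y: "chain e Y" for e Y i
  proof -
    obtain Z where Z: "free_col f h e Z" "Delta_alg (Y i) = (if e then Z i else \<Sum>k\<in>UNIV. copy_hom Fst (gen_entry e i k) * Z k)"
      using Delta_alg_chain[OF f h Y] by blast
    have "lf F (copy_hom Fst a * Z k) = 0" for a k by (rule free_col_lf[OF F(1) f1 h Z(1)])
    from this[of 1] this show ?thesis by (simp add: lf_dsum Z(2) lf_sum)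
  qed
  have "chain_null (\<lambda>w. dsum F w - h w)"
    unfolding chain_null_def lf_fun_diff by (metis chain chain_nullD[OF h] diff_self)
  moreover have "rel_null (\<lambda>w. dsum F w - h w)"
    using rel by (simp add: rel_null_def lf_fun_diff)
  ultimately have "dsum F w - h w = 0" for w
    using F1 h1 by - (rule chain_functional_zero[of "\<lambda>w. dsum F w - h w"], simp_all)
  then show ?thesis using F(2) by (intro ext) simp
qed

section \<open>A Haar unitary free from the scalar matrices\<close>

subsection \<open>Reduction in the free group\<close>

datatype kind = KS | KW | KT

type_synonym 'n gl = "kind \<times> 'n \<times> bool"

fun ginv :: "'n gl \<Rightarrow> 'n gl" where "ginv (a, i, b) = (a, i, \<not> b)"

lemma ginv_ginv [simp]: "ginv (ginv x) = x" by (cases x) auto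

lemma ginv_neq [simp]: "ginv x \<noteq> x" "x \<noteq> ginv x" by (cases x; auto)+

text \<open>Each letter acts as a permutation of the reduced words (van der Waerden's construction),
  so confluence of cancellation never has to be discussed.\<close>

definition push :: "'n gl \<Rightarrow> 'n gl list \<Rightarrow> 'n gl list" where
  "push x r = (if r \<noteq> [] \<and> hd r = ginv x then tl r else x # r)"

definition reduced :: "'n gl list \<Rightarrow> bool" where
  "reduced r = successively (\<lambda>x y. y \<noteq> ginv x) r"

lemma reduced_Nil [simp]: "reduced []" by (simp add: reduced_def)

lemma reduced_push: "reduced r \<Longrightarrow> reduced (push x r)"
  by (cases r) (auto simp: reduced_def push_def successively_Cons)

lemma push_ginv: "reduced r \<Longrightarrow> push (ginv x) (push x r) = r"
  by (cases r) (auto simp: reduced_def push_def successively_Cons)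

lemma push_ginv': "reduced r \<Longrightarrow> push x (push (ginv x) r) = r"
  using push_ginv[of r "ginv x"] by simp

lemma push_eq_iff: "reduced r \<Longrightarrow> reduced r' \<Longrightarrow> push x r = r' \<longleftrightarrow> r = push (ginv x) r'"
  using push_ginv push_ginv' by metis

definition red :: "'n gl list \<Rightarrow> 'n gl list" where "red g = foldr push g []"

lemma reduced_foldr: "reduced r \<Longrightarrow> reduced (foldr push g r)"
  by (induction g) (simp_all add: reduced_push)

lemma reduced_red [simp]: "reduced (red g)" by (simp add: red_def reduced_foldr)

lemma red_Cons: "red (x # g) = push x (red g)" by (simp add: red_def)

lemma foldr_push_red: "reduced r \<Longrightarrow> foldr push (red g) r = foldr push g r"
proof (induction g)
  case (Cons x g)
  show ?case
  proof (cases "red g \<noteq> [] \<and> hd (red g) = ginv x")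
    case True
    then obtain r' where r': "red g = ginv x # r'" by (cases "red g") auto
    have "foldr push g r = push (ginv x) (foldr push r' r)" using Cons r' by simp
    moreover have "reduced (foldr push r' r)" using Cons.prems by (rule reduced_foldr)
    moreover have "push x (ginv x # r') = r'" by (simp add: push_def)
    ultimately show ?thesis using r' by (simp add: red_Cons push_ginv')
  next
    case False
    then have "push x (red g) = x # red g" by (auto simp: push_def)
    then show ?thesis using Cons by (simp add: red_Cons)
  qed
qed (simp add: red_def)

lemma red_cancel: "red (p @ [x, ginv x] @ q) = red (p @ q)"
  by (simp add: red_def) (simp add: push_ginv' flip: red_def)

definition gstar :: "'n gl list \<Rightarrow> 'n gl list" where "gstar g = rev (map ginv g)"

lemma red_gstar: "red (gstar g @ g') = [] \<longleftrightarrow> red g' = red g"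
proof (induction g arbitrary: g')
  case (Cons x g)
  have "red (gstar (x # g) @ g') = red (gstar g @ (ginv x # g'))" by (simp add: gstar_def)
  also have "\<dots> = [] \<longleftrightarrow> push (ginv x) (red g') = red g" using Cons by (simp add: red_Cons)
  also have "\<dots> \<longleftrightarrow> red g' = push x (red g)" by (simp add: push_eq_iff)
  finally show ?case by (simp add: red_Cons)
qed (simp add: gstar_def red_def)

lemma red_append_Nil:
  assumes "red (g @ g') = []"
  shows "red (g' @ g) = []"
proof -
  have id: "foldr push (g @ g') r = r" if "reduced r" for r
    using foldr_push_red[OF that, of "g @ g'"] assms by simp
  have inj: "foldr push (gstar g) (foldr push g r) = r" if "reduced r" for r
    using that
  proof (induction g arbitrary: r)
    case (Cons x g)
    then show ?case by (simp add: gstar_def push_ginv reduced_foldr)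
  qed (simp add: gstar_def)
  have "foldr push g (foldr push (g' @ g) []) = foldr push (g @ g') (foldr push g [])" by simp
  also have "\<dots> = foldr push g []" by (rule id) (simp add: reduced_foldr)
  finally have "foldr push g (foldr push (g' @ g) []) = foldr push g []" .
  then show ?thesis
    using inj[of "foldr push (g' @ g) []"] inj[of "[]"] reduced_foldr[of "[]" "g' @ g"]
    by (simp add: red_def)
qed

subsection \<open>Coefficients in the group algebra\<close>

text \<open>The group algebra is not formed as a quotient: elements stay in the free algebra on the
  letters, and this is the coefficient of the group element with normal form r.\<close>

definition red_coeff :: "'n gl alg \<Rightarrow> 'n gl list \<Rightarrow> complex" where
  "red_coeff a r = lf (\<lambda>g. if red g = r then 1 else 0) a"

definition group_trace :: "'n gl alg \<Rightarrow> complex" where "group_trace a = red_coeff a []"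

lemma red_coeff_0 [simp]: "red_coeff 0 r = 0" by (simp add: red_coeff_def)
lemma red_coeff_add: "red_coeff (a + b) r = red_coeff a r + red_coeff b r" by (simp add: red_coeff_def lf_add)
lemma red_coeff_scale: "red_coeff (sc c * a) r = c * red_coeff a r" by (simp add: red_coeff_def lf_scale)
lemma red_coeff_sum: "red_coeff (sum g S) r = (\<Sum>x\<in>S. red_coeff (g x) r)" by (simp add: red_coeff_def lf_sum)
lemma red_coeff_wd: "red_coeff (wd g) r = (if red g = r then 1 else 0)" by (simp add: red_coeff_def)

lemma red_coeff_letter: "reduced r \<Longrightarrow> red_coeff (wd [x] * a) r = red_coeff a (push (ginv x) r)"
proof -
  assume r: "reduced r"
  have "red_coeff (wd [x] * a) r = lf (\<lambda>g. if red ([x] @ g) = r then 1 else 0) a"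
    unfolding red_coeff_def by (rule lf_wd_left[symmetric])
  also have "\<dots> = red_coeff a (push (ginv x) r)"
    using r by (simp add: red_coeff_def red_Cons push_eq_iff)
  finally show ?thesis .
qed

lemma group_trace_sum: "group_trace (sum g S) = (\<Sum>x\<in>S. group_trace (g x))" by (simp add: group_trace_def red_coeff_sum)

lemma group_trace_mult_comm: "group_trace (a * b) = group_trace (b * a)"
proof (induction a rule: alg_induct)
  case (word c v)
  have "group_trace (wd v * b) = group_trace (b * wd v)"
  proof (induction b rule: alg_induct)
    case (word d w)
    have "red (v @ w) = [] \<longleftrightarrow> red (w @ v) = []" using red_append_Nil by blast
    then show ?case by (simp add: group_trace_def sc_comm_left mult.assoc red_coeff_scale red_coeff_wd flip: wd_append)
  qed (simp_all add: distrib_left distrib_right group_trace_def red_coeff_add)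
  then show ?case by (simp add: group_trace_def sc_comm_left mult.assoc red_coeff_scale)
qed (simp_all add: distrib_left distrib_right group_trace_def red_coeff_add)

lemma group_trace_cancel: "group_trace (x * (wd [z, ginv z] * y)) = group_trace (x * y)"
proof -
  have "lf (\<lambda>g. if red g = [] then 1 else 0) (x * wd [z, ginv z] * y)
      = lf (\<lambda>g. if red g = [] then 1 else 0) (x * 1 * y)"
    by (rule lf_mult_eqI) (simp add: red_cancel flip: wd_append, use red_cancel[of _ z] in simp)
  then show ?thesis by (simp add: group_trace_def red_coeff_def mult.assoc)
qed

definition astar :: "'n gl alg \<Rightarrow> 'n gl alg" where
  "astar a = (\<Sum>g\<in>Poly_Mapping.keys a. sc (cnj (Poly_Mapping.lookup a g)) * wd (gstar g))"

lemma astar_superset: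
  assumes "finite S" "Poly_Mapping.keys a \<subseteq> S"
  shows "astar a = (\<Sum>g\<in>S. sc (cnj (Poly_Mapping.lookup a g)) * wd (gstar g))"
  unfolding astar_def using assms
  by (intro sum.mono_neutral_left) (auto simp: in_keys_iff)

lemma astar_0 [simp]: "astar 0 = 0" by (simp add: astar_def)

lemma astar_add: "astar (a + b) = astar a + astar b"
proof -
  let ?S = "Poly_Mapping.keys a \<union> Poly_Mapping.keys b"
  let ?h = "\<lambda>a. \<Sum>g\<in>?S. sc (cnj (Poly_Mapping.lookup a g)) * wd (gstar g)"
  have "astar (a + b) = ?h (a + b)"
    by (rule astar_superset) (auto simp: keys_add)
  also have "\<dots> = ?h a + ?h b"
    by (simp add: lookup_add sc_add distrib_right sum.distrib)
  finally show ?thesis using astar_superset[of ?S a] astar_superset[of ?S b] by simp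
qed

lemma astar_word: "astar (sc c * wd g) = sc (cnj c) * wd (gstar g)"
  by (simp add: sc_wd astar_def)

lemma astar_sum: "astar (sum g S) = (\<Sum>x\<in>S. astar (g x))"
  by (induction S rule: infinite_finite_induct) (simp_all add: astar_add)

lemma astar_1 [simp]: "astar 1 = 1"
  using astar_word[of 1 "[]"] by (simp add: gstar_def flip: one_alg)

lemma astar_mult: "astar (a * b) = astar b * astar a"
proof (induction a rule: alg_induct)
  case (word c v)
  show ?case
  proof (induction b rule: alg_induct)
    case (word d w)
    have "sc c * wd v * (sc d * wd w) = sc (c * d) * wd (v @ w)"
      by (simp add: sc_mult wd_append mult.assoc sc_comm_left[of "wd v"])
    then have "astar (sc c * wd v * (sc d * wd w)) = sc (cnj c * cnj d) * (wd (gstar w) * wd (gstar v))"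
      by (simp add: astar_word gstar_def flip: wd_append)
    moreover have "sc (cnj d) * wd (gstar w) * (sc (cnj c) * wd (gstar v))
       = sc (cnj c * cnj d) * (wd (gstar w) * wd (gstar v))"
      by (simp add: mult.assoc sc_comm_left[of "wd (gstar w)"] mult.commute[of "cnj c"] sc_mult)
    ultimately show ?case by (simp add: astar_word)
  qed (simp_all add: distrib_left distrib_right astar_add)
qed (simp_all add: distrib_left distrib_right astar_add)

text \<open>Distinct group elements are orthonormal for the canonical trace. It suffices that S
  contains those occurring in a.\<close>

lemma group_trace_astar_mult:
  assumes "finite S" "red ` Poly_Mapping.keys a \<subseteq> S"
  shows "group_trace (astar a * b) = (\<Sum>r\<in>S. cnj (red_coeff a r) * red_coeff b r)"
proof -
  have 1: "group_trace (wd (gstar g) * b) = red_coeff b (red g)" for g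
    unfolding group_trace_def red_coeff_def
    by (simp add: red_gstar flip: lf_wd_left)
  have "group_trace (astar a * b) = (\<Sum>g\<in>Poly_Mapping.keys a. cnj (Poly_Mapping.lookup a g) * red_coeff b (red g))"
    by (simp add: astar_def sum_distrib_right mult.assoc 1[symmetric]) (simp add: group_trace_def red_coeff_sum red_coeff_scale)
  also have "\<dots> = (\<Sum>g\<in>Poly_Mapping.keys a. \<Sum>r\<in>S. if r = red g then cnj (Poly_Mapping.lookup a g) * red_coeff b r else 0)"
    using assms by (intro sum.cong) auto
  also have "\<dots> = (\<Sum>r\<in>S. \<Sum>g\<in>Poly_Mapping.keys a. if r = red g then cnj (Poly_Mapping.lookup a g) * red_coeff b r else 0)"
    by (rule sum.swap)
  also have "\<dots> = (\<Sum>r\<in>S. cnj (red_coeff a r) * red_coeff b r)"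
    by (intro sum.cong refl) (auto simp: red_coeff_def lf_def sum_distrib_right intro!: sum.cong)
  finally show ?thesis .
qed

subsection \<open>A complex Hadamard matrix\<close>

definition hadamard :: "('n::finite \<Rightarrow> 'n \<Rightarrow> complex) \<Rightarrow> bool" where
  "hadamard H \<longleftrightarrow> (\<forall>i j. (\<Sum>k\<in>UNIV. H i k * cnj (H j k)) = (if i = j then 1 else 0)) \<and>
     (\<forall>i j. (\<Sum>k\<in>UNIV. cnj (H k i) * H k j) = (if i = j then 1 else 0)) \<and>
     (\<forall>i k. cnj (H i k) * H i k = 1 / of_nat (card (UNIV :: 'n set)))"

text \<open>The normalised Fourier matrix of the cyclic group of order n, carried to the index type
  by an enumeration.\<close>

lemma hadamard_exists: "\<exists>H :: 'n::finite \<Rightarrow> 'n \<Rightarrow> complex. hadamard H"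
proof -
  define n where "n = card (UNIV :: 'n set)"
  have n: "n > 0" by (simp add: n_def card_gt_0_iff)
  obtain e :: "'n \<Rightarrow> nat" where e: "bij_betw e UNIV {..<n}"
    using ex_bij_betw_finite_nat[of "UNIV :: 'n set"] by (auto simp: n_def atLeast0LessThan)
  define z where "z k = cis (2 * pi * real k / real n)" for k
  have zn: "z k ^ n = 1" for k
    using n cis_multiple_2pi[of "real k"] by (simp add: z_def DeMoivre mult_ac)
  have zz: "z k * cnj (z k) = 1" for k by (simp add: z_def cis_cnj cis_mult)
  have inj: "z j = z k \<Longrightarrow> j < n \<Longrightarrow> k < n \<Longrightarrow> j = k" for j k
    using bij_betw_roots_unity[OF n] by (auto simp: bij_betw_def inj_on_def z_def)
  define H where "H i k = z (e i) ^ e k / complex_of_real (sqrt (real n))" for i k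
  \<comment> \<open>Symmetry turns orthogonality of the rows into orthogonality of the
    columns.\<close>
  have sym: "H i k = H k i" for i k
    by (simp add: H_def z_def DeMoivre mult_ac)
  have sq: "complex_of_real (sqrt (real n)) * complex_of_real (sqrt (real n)) = of_nat n"
    by (simp flip: of_real_mult)
  have Hprod: "H i k * cnj (H j k) = (z (e i) * cnj (z (e j))) ^ e k / of_nat n" for i j k
    by (simp add: H_def power_mult_distrib sq)
  have rows: "(\<Sum>k\<in>UNIV. H i k * cnj (H j k)) = (if i = j then 1 else 0)" for i j
  proof (cases "i = j")
    case True
    then show ?thesis using n by (simp add: Hprod zz n_def)
  next
    case False
    let ?w = "z (e i) * cnj (z (e j))"
    have "e i \<noteq> e j" "e i < n" "e j < n"
      using e False by (auto simp: bij_betw_def inj_on_def)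
    then have "z (e i) \<noteq> z (e j)" using inj by blast
    then have "?w \<noteq> 1" using zz[of "e j"] by (metis mult.assoc mult.commute mult_1)
    moreover have "?w ^ n = 1"
      by (simp add: power_mult_distrib zn flip: complex_cnj_power)
    ultimately have "(\<Sum>k<n. ?w ^ k) = 0" by (simp add: geometric_sum)
    moreover have "(\<Sum>k\<in>UNIV. ?w ^ e k) = (\<Sum>k<n. ?w ^ k)"
      by (rule sum.reindex_bij_betw[OF e])
    ultimately show ?thesis using False by (simp add: Hprod flip: sum_divide_distrib)
  qed
  moreover have "(\<Sum>k\<in>UNIV. cnj (H k i) * H k j) = (if i = j then 1 else 0)" for i j
    using rows[of j i] by (auto simp: sym[of _ i] sym[of _ j] mult.commute)
  moreover have "cnj (H i k) * H i k = 1 / of_nat n" for i k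
    using Hprod[of i k i] by (simp add: zz mult.commute)
  ultimately have "hadamard H" unfolding hadamard_def n_def by blast
  then show "\<exists>H :: 'n \<Rightarrow> 'n \<Rightarrow> complex. hadamard H" by blast
qed

subsection \<open>The Haar trace\<close>

text \<open>An entry of U uses the letters \<open>S\<^sub>i W\<^sub>k T\<^sub>j\<close>, an entry of
  its adjoint the inverses of \<open>T\<^sub>i\<close>, \<open>W\<^sub>k\<close>,
  \<open>S\<^sub>j\<close> in this order. The coefficient \<open>H i k * cnj (H j k)\<close> is the
  same for both signs.\<close>

definition gL :: "bool \<Rightarrow> 'n \<Rightarrow> 'n gl" where "gL e i = (if e then (KT, i, True) else (KS, i, False))"
definition gR :: "bool \<Rightarrow> 'n \<Rightarrow> 'n gl" where "gR e i = (if e then (KS, i, True) else (KT, i, False))"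
definition gW :: "bool \<Rightarrow> 'n \<Rightarrow> 'n gl" where "gW e k = (KW, k, e)"

lemma ginv_gR: "ginv (gR e i) = gL (\<not> e) i" by (simp add: gL_def gR_def)
lemma ginv_gL: "ginv (gL e i) = gR (\<not> e) i" by (simp add: gL_def gR_def)
lemma ginv_gW: "ginv (gW e i) = gW (\<not> e) i" by (simp add: gW_def)

text \<open>The matrix \<open>S H W H\<^sup>* T\<close> with \<open>S\<close>, \<open>W\<close>, \<open>T\<close> diagonal matrices of free group generators.\<close>

definition haar_entry :: "('n::finite \<Rightarrow> 'n \<Rightarrow> complex) \<Rightarrow> bool \<Rightarrow> 'n \<Rightarrow> 'n \<Rightarrow> 'n gl alg" where
  "haar_entry H e i j = (\<Sum>k\<in>UNIV. sc (H i k * cnj (H j k)) * wd [gL e i, gW e k, gR e j])"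

definition group_hom :: "('n::finite \<Rightarrow> 'n \<Rightarrow> complex) \<Rightarrow> 'n ulet alg \<Rightarrow> 'n gl alg" where
  "group_hom H = alg_hom (\<lambda>(i, j, b). if b then haar_entry H True j i else haar_entry H False i j)"

lemma group_hom_gen_entry: "group_hom H (gen_entry e i j) = haar_entry H e i j"
  by (simp add: group_hom_def gen_entry_def alg_hom_wd)

lemma group_hom_mult: "group_hom H (a * b) = group_hom H a * group_hom H b" by (simp add: group_hom_def alg_hom_mult)
lemma group_hom_sum: "group_hom H (sum g S) = (\<Sum>x\<in>S. group_hom H (g x))" by (simp add: group_hom_def alg_hom_sum)
lemma group_hom_sc: "group_hom H (sc c) = sc c" by (simp add: group_hom_def)

definition free_haar :: "('n::finite \<Rightarrow> 'n \<Rightarrow> complex) \<Rightarrow> 'n ufun" where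
  "free_haar H w = group_trace (group_hom H (wd w))"

lemma lf_free_haar: "lf (free_haar H) a = group_trace (group_hom H a)"
  by (induction a rule: alg_induct)
    (simp_all add: lf_add lf_scale group_trace_def red_coeff_add red_coeff_scale group_hom_def alg_hom_add alg_hom_scale free_haar_def)

lemma free_haar_tracial: "is_tracial (free_haar H)"
  unfolding is_tracial_def free_haar_def wd_append group_hom_def alg_hom_mult
  by (simp add: group_trace_mult_comm)

lemma astar_haar_entry: "astar (haar_entry H e i j) = haar_entry H (\<not> e) j i"
  by (auto simp: haar_entry_def astar_sum astar_word gstar_def ginv_gL ginv_gR ginv_gW mult.commute)

lemma group_hom_wstar: "group_hom H (wd (wstar w)) = astar (group_hom H (wd w))"
proof (induction w)
  case Nil
  show ?case by (simp add: wstar_def group_hom_def flip: one_alg)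
next
  case (Cons l w)
  obtain i j b where l: "l = (i, j, b)" by (cases l)
  have "wstar (l # w) = wstar w @ [(i, j, \<not> b)]" by (simp add: wstar_def l)
  moreover have "group_hom H (wd (l # w)) = group_hom H (wd [l]) * group_hom H (wd w)"
    using wd_append[of "[l]" w] by (simp add: group_hom_def alg_hom_mult)
  moreover have "group_hom H (wd [(i, j, \<not> b)]) = astar (group_hom H (wd [l]))"
    by (simp add: group_hom_def alg_hom_wd l astar_haar_entry)
  ultimately show ?case using Cons by (simp add: wd_append group_hom_def alg_hom_mult astar_mult)
qed

text \<open>The letters meeting at the summation index k cancel. Column orthogonality then forces
  equal W letters, which cancel too, and row orthogonality forces i = j.\<close>

lemma haar_entry_rel:
  assumes H: "hadamard H"
  shows "group_trace (x * ((\<Sum>k\<in>UNIV. haar_entry H e i k * haar_entry H (\<not> e) k j) * y)) = (if i = j then group_trace (x * y) else 0)"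
proof -
  let ?T = "\<lambda>a b. group_trace (x * (wd [gL e i, gW e a, gW (\<not> e) b, gR (\<not> e) j] * y))"
  have word: "group_trace (x * (wd [gL e i, gW e a, gR e k] * (wd [gL (\<not> e) k, gW (\<not> e) b, gR (\<not> e) j] * y))) = ?T a b"
    for a b k
    using group_trace_cancel[of "x * wd [gL e i, gW e a]" "gR e k" "wd [gW (\<not> e) b, gR (\<not> e) j] * y"]
    by (simp add: ginv_gR mult.assoc flip: wd_append, simp flip: mult.assoc wd_append)
  have Taa: "?T a a = group_trace (x * (wd [gL e i, gR (\<not> e) j] * y))" for a
    using group_trace_cancel[of "x * wd [gL e i]" "gW e a" "wd [gR (\<not> e) j] * y"]
    by (simp add: ginv_gW mult.assoc flip: wd_append, simp flip: mult.assoc wd_append)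
  have lin: "group_trace (x * ((sc c * u) * (sc d * v) * y)) = c * d * group_trace (x * (u * (v * y)))" for c d u v
    by (simp add: group_trace_def mult.assoc sc_comm_left[of x] sc_comm_left[of u] red_coeff_scale)
  have "group_trace (x * ((\<Sum>k\<in>UNIV. haar_entry H e i k * haar_entry H (\<not> e) k j) * y))
      = (\<Sum>k\<in>UNIV. \<Sum>a\<in>UNIV. \<Sum>b\<in>UNIV. (H i a * cnj (H k a)) * (H k b * cnj (H j b)) * ?T a b)"
    by (simp only: haar_entry_def sum_product sum_distrib_left[of x] sum_distrib_right[of _ _ y] group_trace_sum lin word)
  also have "\<dots> = (\<Sum>a\<in>UNIV. \<Sum>b\<in>UNIV. \<Sum>k\<in>UNIV. (H i a * cnj (H k a)) * (H k b * cnj (H j b)) * ?T a b)"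
    by (subst sum.swap, rule sum.cong[OF refl], rule sum.swap)
  also have "\<dots> = (\<Sum>a\<in>UNIV. \<Sum>b\<in>UNIV. H i a * cnj (H j b) * ?T a b * (\<Sum>k\<in>UNIV. cnj (H k a) * H k b))"
    unfolding sum_distrib_left by (intro sum.cong refl) (simp add: mult_ac)
  also have "\<dots> = (\<Sum>a\<in>UNIV. H i a * cnj (H j a) * ?T a a)"
    using H by (simp add: hadamard_def if_distrib[of "\<lambda>x. _ * x"] cong: if_cong)
  also have "\<dots> = (if i = j then 1 else 0) * group_trace (x * (wd [gL e i, gR (\<not> e) j] * y))"
    using H by (simp only: Taa flip: sum_distrib_right) (simp add: hadamard_def)
  also have "\<dots> = (if i = j then group_trace (x * y) else 0)"
    using group_trace_cancel[of x "gL e i" y] by (auto simp: ginv_gL)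
  finally show ?thesis .
qed

lemma free_haar_state:
  fixes H :: "'n::finite \<Rightarrow> 'n \<Rightarrow> complex"
  assumes H: "hadamard H"
  shows "is_state (free_haar H)"
proof -
  have rel: "(\<Sum>k\<in>UNIV. lf (free_haar H) (wd p * (gen_entry e i k * gen_entry (\<not> e) k j) * wd q))
      = (if i = j then lf (free_haar H) (wd p * wd q) else 0)" for p q e i j
  proof -
    have "(\<Sum>k\<in>UNIV. lf (free_haar H) (wd p * (gen_entry e i k * gen_entry (\<not> e) k j) * wd q))
       = lf (free_haar H) (wd p * (\<Sum>k\<in>UNIV. gen_entry e i k * gen_entry (\<not> e) k j) * wd q)"
      by (simp only: sum_distrib_left sum_distrib_right lf_sum)
    then show ?thesis
      using haar_entry_rel[OF H, of "group_hom H (wd p)" e i j "group_hom H (wd q)"]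
      by (simp add: lf_free_haar group_hom_mult group_hom_sum group_hom_gen_entry mult.assoc)
  qed
  have "vanishes_on_relations (free_haar H)"
    unfolding vanishes_on_relations_def
  proof (intro conjI allI)
    fix p q i j
    show "(\<Sum>k\<in>UNIV. free_haar H (p @ [(k, i, True), (k, j, False)] @ q)) = (if i = j then free_haar H (p @ q) else 0)"
      using rel[of p True i j q] by (simp add: gen_entry_def flip: wd_append)
    show "(\<Sum>k\<in>UNIV. free_haar H (p @ [(i, k, False), (j, k, True)] @ q)) = (if i = j then free_haar H (p @ q) else 0)"
      using rel[of p False i j q] by (simp add: gen_entry_def flip: wd_append)
  qed
  moreover have "free_haar H [] = 1"
    by (simp add: free_haar_def group_hom_def alg_hom_wd group_trace_def one_alg red_coeff_wd red_def)
  moreover have "Im (lin (free_haar H) (pmul (pstar p) p)) = 0 \<and> 0 \<le> Re (lin (free_haar H) (pmul (pstar p) p))" for p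
  proof (rule positive_if_gram)
    fix W :: "'n ulet list set" assume W: "finite W"
    let ?S = "\<Union>w\<in>W. red ` Poly_Mapping.keys (group_hom H (wd w))"
    have "free_haar H (wstar v @ w) = (\<Sum>r\<in>?S. cnj (red_coeff (group_hom H (wd v)) r) * red_coeff (group_hom H (wd w)) r)"
      if "v \<in> W" for v w
    proof -
      have "free_haar H (wstar v @ w) = group_trace (astar (group_hom H (wd v)) * group_hom H (wd w))"
        by (simp add: free_haar_def wd_append group_hom_wstar[symmetric]) (simp add: group_hom_def alg_hom_mult)
      then show ?thesis using W that by (subst (asm) group_trace_astar_mult[of ?S]) auto
    qed
    then show "\<exists>(S :: 'n gl list set) \<xi>. finite S \<and>
      (\<forall>v\<in>W. \<forall>w\<in>W. free_haar H (wstar v @ w) = (\<Sum>a\<in>S. cnj (\<xi> v a) * \<xi> w a))"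
      using W by (intro exI[of _ ?S] exI[of _ "\<lambda>w. red_coeff (group_hom H (wd w))"]) simp
  qed
  ultimately show ?thesis by (simp add: is_state_def)
qed

definition starts :: "'n gl \<Rightarrow> 'n gl alg \<Rightarrow> bool" where
  "starts x a \<longleftrightarrow> (\<forall>r. reduced r \<and> red_coeff a r \<noteq> 0 \<longrightarrow> r \<noteq> [] \<and> hd r = x)"

lemma starts_letter:
  assumes "\<And>r. reduced r \<Longrightarrow> r \<noteq> [] \<Longrightarrow> hd r = ginv x \<Longrightarrow> red_coeff a r = 0"
  shows "starts x (wd [x] * a)"
  unfolding starts_def
proof (intro allI impI)
  fix r assume r: "reduced r \<and> red_coeff (wd [x] * a) r \<noteq> 0"
  then have "red_coeff a (push (ginv x) r) \<noteq> 0" by (auto simp: red_coeff_letter)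
  moreover have "reduced (push (ginv x) r)" using r by (simp add: reduced_push)
  ultimately have "\<not> (push (ginv x) r \<noteq> [] \<and> hd (push (ginv x) r) = ginv x)" using assms by blast
  then show "r \<noteq> [] \<and> hd r = x" by (auto simp: push_def split: if_splits)
qed

lemma starts_letter_starts: "starts y a \<Longrightarrow> y \<noteq> ginv x \<Longrightarrow> starts x (wd [x] * a)"
  by (rule starts_letter) (auto simp: starts_def)

text \<open>The invariant is that the k-th part of a column is supported on reduced words beginning
  with its W letter, so that further multiplication rarely cancels and the identity is never
  reached.\<close>

lemma free_haar_chain:
  fixes H :: "'n::finite \<Rightarrow> 'n \<Rightarrow> complex"
  assumes H: "hadamard H"
  shows "chain e Y \<Longrightarrow> \<exists>y. (\<forall>k. starts (gW e k) (y k)) \<and>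
    (\<forall>i. group_hom H (Y i) = wd [gL e i] * (\<Sum>k\<in>UNIV. sc (H i k) * y k))"
proof (induction rule: chain.induct)
  case (chain_base e j)
  let ?y = "\<lambda>k. wd [gW e k] * (sc (cnj (H j k)) * wd [gR e j])"
  have "starts (gW e k) (?y k)" for k
    by (rule starts_letter) (auto simp: red_coeff_scale red_coeff_wd red_def push_def gW_def gR_def split: if_splits)
  moreover have "group_hom H (gen_entry e i j) = wd [gL e i] * (\<Sum>k\<in>UNIV. sc (H i k) * ?y k)" for i
    unfolding group_hom_gen_entry haar_entry_def sum_distrib_left
    by (intro sum.cong refl)
       (simp add: sc_comm_left[of "wd _"] sc_mult mult.assoc flip: wd_append)
  ultimately show ?case by (intro exI[of _ ?y]) blast
next
  case (chain_step e' Y e B)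
  then obtain y where y: "\<And>k. starts (gW e' k) (y k)"
    "\<And>i. group_hom H (Y i) = wd [gL e' i] * (\<Sum>k\<in>UNIV. sc (H i k) * y k)" by blast
  define g where "g l = (\<Sum>m\<in>UNIV. sc (H l m) * y m)" for l
  define z where "z k = (\<Sum>j\<in>UNIV. \<Sum>l\<in>UNIV. sc (cnj (H j k) * B j l) * (wd [gR e j] * (wd [gL e' l] * g l)))" for k
  have g_heads: "red_coeff (g l) r = 0" if "reduced r" "r = [] \<or> (\<forall>m. hd r \<noteq> gW e' m)" for l r
  proof -
    have "red_coeff (y m) r = 0" for m using y(1)[of m] that unfolding starts_def by auto
    then show ?thesis by (simp add: g_def red_coeff_sum red_coeff_scale)
  qed
  have g_at: "red_coeff (g l) r = H l k * red_coeff (y k) r" if "reduced r" "r \<noteq> []" "hd r = gW e' k" for l r k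
  proof -
    have "red_coeff (y m) r = 0" if "m \<noteq> k" for m
      using y(1)[of m] \<open>reduced r\<close> \<open>hd r = gW e' k\<close> that unfolding starts_def by (auto simp: gW_def)
    then have "red_coeff (g l) r = (\<Sum>m\<in>UNIV. if m = k then H l k * red_coeff (y k) r else 0)"
      unfolding g_def red_coeff_sum red_coeff_scale by (intro sum.cong) auto
    then show ?thesis by simp
  qed
  \<comment> \<open>The W letter about to be prepended must not cancel. The letters in front of the
    old W letter vanish only for opposite signs and j = l.\<close>
  have "red_coeff (z k) r = 0" if r: "reduced r" "r \<noteq> []" "hd r = ginv (gW e k)" for k r
  proof -
    have off: "red_coeff (wd [gR e j] * (wd [gL e' l] * g l)) r = 0" if "gL e' l \<noteq> ginv (gR e j)" for j l
    proof -
      have "starts (gL e' l) (wd [gL e' l] * g l)"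
        by (rule starts_letter) (rule g_heads, auto simp: gL_def gW_def)
      then have "starts (gR e j) (wd [gR e j] * (wd [gL e' l] * g l))"
        using that by (rule starts_letter_starts)
      then show ?thesis using r unfolding starts_def by (auto simp: gR_def gW_def)
    qed
    show ?thesis
    proof (cases "e = e'")
      case True
      then have "gL e' l \<noteq> ginv (gR e j)" for j l by (auto simp: gL_def gR_def)
      from off[OF this] show ?thesis by (simp add: z_def red_coeff_sum red_coeff_scale)
    next
      case False
      then have e': "e' = (\<not> e)" by simp
      have diag: "red_coeff (wd [gR e j] * (wd [gL e' j] * g j)) r = H j k * red_coeff (y k) r" for j
      proof -
        have "gL e' j = ginv (gR e j)" by (simp add: e' ginv_gR)
        then have "red_coeff (wd [gR e j] * (wd [gL e' j] * g j)) r = red_coeff (g j) r"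
          using r by (simp add: red_coeff_letter reduced_push push_ginv')
        then show ?thesis using r e' by (simp add: g_at ginv_gW)
      qed
      have "red_coeff (z k) r = (\<Sum>j\<in>UNIV. \<Sum>l\<in>UNIV. if l = j then cnj (H j k) * B j j * (H j k * red_coeff (y k) r) else 0)"
        unfolding z_def red_coeff_sum red_coeff_scale
      proof (intro sum.cong refl)
        fix j l
        show "cnj (H j k) * B j l * red_coeff (wd [gR e j] * (wd [gL e' l] * g l)) r
          = (if l = j then cnj (H j k) * B j j * (H j k * red_coeff (y k) r) else 0)"
          using diag[of j] off[of l j] by (auto simp: e' ginv_gR gL_def split: if_splits)
      qed
      also have "\<dots> = (\<Sum>j\<in>UNIV. (cnj (H j k) * H j k) * B j j * red_coeff (y k) r)"
        by (simp add: mult_ac)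
      \<comment> \<open>Equal moduli of the Hadamard entries turn the weighted diagonal sum into tr
        B / n.\<close>
      also have "\<dots> = (\<Sum>j\<in>UNIV. B j j) * (red_coeff (y k) r / of_nat (card (UNIV :: 'n set)))"
        using H by (simp add: hadamard_def sum_distrib_right sum_divide_distrib)
      also have "\<dots> = 0" using chain_step(2) False by simp
      finally show ?thesis .
    qed
  qed
  then have "starts (gW e k) (wd [gW e k] * z k)" for k by (rule starts_letter)
  moreover have "group_hom H (\<Sum>j\<in>UNIV. \<Sum>l\<in>UNIV. gen_entry e i j * (sc (B j l) * Y l))
      = wd [gL e i] * (\<Sum>k\<in>UNIV. sc (H i k) * (wd [gW e k] * z k))" for i
  proof -
    have GAlin: "group_hom H (\<Sum>j\<in>UNIV. \<Sum>l\<in>UNIV. gen_entry e i j * (sc (B j l) * Y l))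
       = (\<Sum>j\<in>UNIV. \<Sum>l\<in>UNIV. haar_entry H e i j * (sc (B j l) * group_hom H (Y l)))"
      by (simp add: group_hom_sum group_hom_mult group_hom_gen_entry group_hom_sc)
    have summand: "sc (H i k * cnj (H j k)) * wd [gL e i, gW e k, gR e j] * (sc (B j l) * (wd [gL e' l] * g l))
       = wd [gL e i] * (sc (H i k) * (wd [gW e k] * (sc (cnj (H j k) * B j l) * (wd [gR e j] * (wd [gL e' l] * g l)))))"
      for j k l
    proof -
      let ?A = "wd [gL e i]" and ?W = "wd [gW e k]" and ?R = "wd [gR e j]" and ?G = "wd [gL e' l] * g l"
      have "wd [gL e i, gW e k, gR e j] = ?A * (?W * ?R)" by (simp flip: wd_append)
      then show ?thesis
        by (simp add: sc_mult mult.assoc sc_comm_left[of ?A] sc_comm_left[of ?W] sc_comm_left[of ?R])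
    qed
    have "group_hom H (\<Sum>j\<in>UNIV. \<Sum>l\<in>UNIV. gen_entry e i j * (sc (B j l) * Y l))
      = (\<Sum>j\<in>UNIV. \<Sum>l\<in>UNIV. \<Sum>k\<in>UNIV. wd [gL e i] * (sc (H i k) * (wd [gW e k] * (sc (cnj (H j k) * B j l) * (wd [gR e j] * (wd [gL e' l] * g l))))))"
      unfolding GAlin haar_entry_def y(2) g_def[symmetric] sum_distrib_right summand ..
    also have "\<dots> = (\<Sum>k\<in>UNIV. \<Sum>j\<in>UNIV. \<Sum>l\<in>UNIV. wd [gL e i] * (sc (H i k) * (wd [gW e k] * (sc (cnj (H j k) * B j l) * (wd [gR e j] * (wd [gL e' l] * g l))))))"
      by (rule sym, subst sum.swap, rule sum.cong[OF refl], rule sum.swap)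
    also have "\<dots> = wd [gL e i] * (\<Sum>k\<in>UNIV. sc (H i k) * (wd [gW e k] * z k))"
      by (simp add: z_def sum_distrib_left)
    finally show ?thesis .
  qed
  ultimately show ?case by (intro exI[of _ "\<lambda>k. wd [gW e k] * z k"]) blast
qed

text \<open>The trace is the coefficient at the identity; a leading S or T letter cannot cancel the
  W letter that follows it.\<close>

lemma free_haar_chain_null:
  assumes H: "hadamard H"
  shows "chain_null (free_haar H)"
  unfolding chain_null_def
proof (intro allI impI)
  fix e Y i assume "chain e (Y :: 'a \<Rightarrow> 'a ulet alg)"
  then obtain y where y: "\<And>k. starts (gW e k) (y k)"
    "group_hom H (Y i) = wd [gL e i] * (\<Sum>k\<in>UNIV. sc (H i k) * y k)"
    using free_haar_chain[OF H] by blast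
  have "red_coeff (y k) (push (ginv (gL e i)) []) = 0" for k
    using y(1)[of k] reduced_push[of "[]" "ginv (gL e i)"] unfolding starts_def
    by (auto simp: push_def gL_def gW_def)
  then have "group_trace (group_hom H (Y i)) = 0"
    unfolding group_trace_def y(2) by (subst red_coeff_letter) (simp_all add: red_coeff_sum red_coeff_scale)
  then show "lf (free_haar H) (Y i) = 0" by (simp add: lf_free_haar)
qed

lemma free_haar_trace: "\<exists>h :: 'n::finite ufun. haar_trace free_prod h"
proof -
  obtain H :: "'n \<Rightarrow> 'n \<Rightarrow> complex" where H: "hadamard H" using hadamard_exists by blast
  have "haar_trace free_prod (free_haar H)"
    by (rule haar_trace_if_left_invariant)
      (use H in \<open>auto intro: conv_free_antipode_dual free_haar_state free_haar_tracial free_left_invariant free_haar_chain_null\<close>)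
  then show ?thesis by blast
qed

section \<open>The tensor convolution\<close>

abbreviation lists_of_length :: "nat \<Rightarrow> 'n::finite list set" where "lists_of_length m \<equiv> {xs. length xs = m}"

lemma finite_lists_of_length [simp]: "finite (lists_of_length m :: 'n::finite list set)"
  using finite_lists_length_eq[OF finite[of "UNIV :: 'n set"], of m] by simp

lemma sum_lists_of_length_Suc: "(\<Sum>ks\<in>lists_of_length (Suc m). g ks) = (\<Sum>k\<in>UNIV. \<Sum>ks\<in>lists_of_length m. g (k # ks))"
proof -
  have "(\<Sum>k\<in>UNIV. \<Sum>ks\<in>lists_of_length m. g (k # ks)) = (\<Sum>(k, ks)\<in>UNIV \<times> lists_of_length m. g (k # ks))"
    by (simp add: sum.cartesian_product)
  also have "\<dots> = (\<Sum>ks\<in>lists_of_length (Suc m). g ks)"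
    by (rule sum.reindex_bij_witness[where i = "\<lambda>ks. (hd ks, tl ks)" and j = "\<lambda>(k, ks). k # ks"])
      (auto simp: length_Suc_conv)
  finally show ?thesis by simp
qed

lemma sum_lists_of_length_add: "(\<Sum>ks\<in>lists_of_length (a + b). g ks) = (\<Sum>us\<in>lists_of_length a. \<Sum>vs\<in>lists_of_length b. g (us @ vs))"
proof (induction a arbitrary: g)
  case (Suc a)
  then show ?case by (simp add: sum_lists_of_length_Suc)
qed simp

definition fst_word :: "'n ulet list \<Rightarrow> 'n list \<Rightarrow> 'n ulet list" where
  "fst_word w ks = map2 (\<lambda>(i, j, b) k. (i, k, b)) w ks"
definition snd_word :: "'n ulet list \<Rightarrow> 'n list \<Rightarrow> 'n ulet list" where
  "snd_word w ks = map2 (\<lambda>(i, j, b) k. (k, j, b)) w ks"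

lemma fst_snd_word_simps [simp]:
  "fst_word [] ks = []" "snd_word [] ks = []"
  "fst_word ((i, j, b) # w) (k # ks) = (i, k, b) # fst_word w ks"
  "snd_word ((i, j, b) # w) (k # ks) = (k, j, b) # snd_word w ks"
  by (simp_all add: fst_word_def snd_word_def)

lemma fst_snd_word_append:
  "length us = length v \<Longrightarrow> fst_word (v @ w) (us @ vs) = fst_word v us @ fst_word w vs"
  "length us = length v \<Longrightarrow> snd_word (v @ w) (us @ vs) = snd_word v us @ snd_word w vs"
  by (simp_all add: fst_word_def snd_word_def)

lemma length_snd_word [simp]: "length ks = length w \<Longrightarrow> length (snd_word w ks) = length w"
  by (simp add: snd_word_def)

lemma map_snd_snd_word: "length ks = length w \<Longrightarrow> map snd (snd_word w ks) = map snd w"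
  by (induction w ks rule: list_induct2') auto

text \<open>Closed form of the convolution: the tensor product lets the copies commute, so each term
  of \<Delta> of a word separates into a first-copy and a second-copy word.\<close>

definition tensor_conv :: "'n::finite ufun \<Rightarrow> 'n ufun \<Rightarrow> 'n ufun" where
  "tensor_conv f h w = (\<Sum>ks\<in>lists_of_length (length w). f (fst_word w ks) * h (snd_word w ks))"

definition side_word :: "side \<Rightarrow> ('l \<times> side) list \<Rightarrow> 'l list" where
  "side_word s v = map fst (filter (\<lambda>x. snd x = s) v)"

lemma side_word_simps [simp]:
  "side_word s [] = []" "side_word s ((l, t) # v) = (if t = s then l # side_word s v else side_word s v)"
  "side_word s (u @ v) = side_word s u @ side_word s v"
  "side_word s (map (\<lambda>l. (l, t)) w) = (if t = s then w else [])"
  by (simp_all add: side_word_def filter_map comp_def)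

lemma dsum_tensor_conv:
  "dsum (\<lambda>v. f (p @ side_word Fst v) * h (q @ side_word Snd v)) w
     = (\<Sum>ks\<in>lists_of_length (length w). f (p @ fst_word w ks) * h (q @ snd_word w ks))"
proof (induction w arbitrary: p q)
  case (Cons l w)
  obtain i j b where l: "l = (i, j, b)" by (cases l)
  have "dsum (\<lambda>v. f (p @ side_word Fst (dl l k @ v)) * h (q @ side_word Snd (dl l k @ v))) w
     = (\<Sum>ks\<in>lists_of_length (length w). f (p @ (i, k, b) # fst_word w ks) * h (q @ (k, j, b) # snd_word w ks))" for k
    using Cons[of "p @ [(i, k, b)]" "q @ [(k, j, b)]"] by (cases b) (simp_all add: l dl_def)
  then show ?case by (simp add: sum_lists_of_length_Suc) (simp add: l)
qed simp

lemma lf_tensor_conv_copy_prod: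
  "lf (\<lambda>v. f (p @ side_word Fst v) * h (q @ side_word Snd v)) (copy_prod es)
     = lf f (wd p * prod_list (part Fst es)) * lf h (wd q * prod_list (part Snd es))"
proof (induction es arbitrary: p q)
  case Nil
  show ?case by (simp add: lf_1)
next
  case (Cons e es)
  obtain s a where e: "e = (s, a)" by force
  show ?case unfolding e
  proof (induction a rule: alg_induct)
    case (add a b)
    then show ?case by (cases s) (simp_all add: copy_hom_add lf_add distrib_left distrib_right)
  next
    case (word c u)
    let ?F = "\<lambda>p q v. f (p @ side_word Fst v) * h (q @ side_word Snd v)"
    have "lf (?F p q) (copy_hom s (wd u) * copy_prod es)
       = lf (\<lambda>v. ?F p q (map (\<lambda>l. (l, s)) u @ v)) (copy_prod es)"
      unfolding copy_hom_wd lf_wd_left[symmetric] ..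
    also have "\<dots> = lf f (wd p * prod_list (part Fst ((s, wd u) # es))) * lf h (wd q * prod_list (part Snd ((s, wd u) # es)))"
      using Cons[of "p @ u" q] Cons[of p "q @ u"] by (cases s) (simp_all add: wd_append mult.assoc)
    finally show ?case
      by (cases s) (simp_all add: copy_hom_scale mult.assoc lf_scale sc_comm_left[of "wd _"])
  qed (cases s; simp)
qed

lemma conv_tensor:
  assumes "f [] = 1" "h [] = 1"
  shows "conv tensor_prod f h = tensor_conv f h"
proof -
  have "product_rule (\<lambda>_. cou) (rtens f h) (\<lambda>v. f ([] @ side_word Fst v) * h ([] @ side_word Snd v))"
    unfolding product_rule_def lf_tensor_conv_copy_prod by (simp add: rtens_def flip: one_alg)
  then have "conv tensor_prod f h = dsum (\<lambda>v. f ([] @ side_word Fst v) * h ([] @ side_word Snd v))"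
    using conv_eq[of tensor_prod f h, OF tensor_prod_iff[of f h, OF assms] multilinear_rules(2) cou_Nil] by blast
  moreover have "dsum (\<lambda>v. f ([] @ side_word Fst v) * h ([] @ side_word Snd v)) = tensor_conv f h"
    by (rule ext, subst dsum_tensor_conv) (simp add: tensor_conv_def)
  ultimately show ?thesis by simp
qed

lemma tensor_conv_rotate:
  assumes "is_tracial f" "is_tracial h"
  shows "tensor_conv f h (u @ v) = tensor_conv f h (v @ u)"
proof -
  have "tensor_conv f h (u @ v) = (\<Sum>us\<in>lists_of_length (length u). \<Sum>vs\<in>lists_of_length (length v). f (fst_word u us @ fst_word v vs) * h (snd_word u us @ snd_word v vs))"
    by (simp add: tensor_conv_def sum_lists_of_length_add fst_snd_word_append)
  also have "\<dots> = (\<Sum>vs\<in>lists_of_length (length v). \<Sum>us\<in>lists_of_length (length u). f (fst_word v vs @ fst_word u us) * h (snd_word v vs @ snd_word u us))"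
    using assms unfolding is_tracial_def
    by (subst sum.swap) (intro sum.cong refl arg_cong2[where f = "(*)"]; blast)
  also have "\<dots> = tensor_conv f h (v @ u)"
    by (simp add: tensor_conv_def sum_lists_of_length_add fst_snd_word_append)
  finally show ?thesis .
qed

subsection \<open>A queue of indices\<close>

definition queue_step :: "'n ulet \<Rightarrow> 'n list \<Rightarrow> 'n list option" where
  "queue_step l x = (case l of (i, j, b) \<Rightarrow>
     if b then if x \<noteq> [] \<and> last x = j then Some (i # butlast x) else None
     else if x \<noteq> [] \<and> hd x = i then Some (tl x @ [j]) else None)"

text \<open>The last letter acts first, as in a product of operators. Flipping the flag of a letter
  inverts its partial injection.\<close>

definition queue_run :: "'n ulet list \<Rightarrow> 'n list \<Rightarrow> 'n list option" where
  "queue_run w x = foldr (\<lambda>l r. Option.bind r (queue_step l)) w (Some x)"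

lemma queue_run_Nil [simp]: "queue_run [] x = Some x" by (simp add: queue_run_def)
lemma queue_run_Cons: "queue_run (l # w) x = Option.bind (queue_run w x) (queue_step l)" by (simp add: queue_run_def)
lemma queue_run_append: "queue_run (v @ w) x = Option.bind (queue_run w x) (queue_run v)"
  by (induction v) (simp_all add: queue_run_Cons Option.bind_assoc)

lemma queue_step_length: "queue_step l x = Some y \<Longrightarrow> length y = length x"
  by (auto simp: queue_step_def split: prod.splits if_splits)

lemma queue_run_length: "queue_run w x = Some y \<Longrightarrow> length y = length x"
  by (induction w arbitrary: y) (auto simp: queue_run_Cons bind_eq_Some_conv queue_step_length)

lemma queue_step_Some:
  "queue_step (i, j, b) x = Some y \<longleftrightarrow>
     (\<exists>xs. if b then x = xs @ [j] \<and> y = i # xs else x = i # xs \<and> y = xs @ [j])"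
proof (cases b)
  case True
  then show ?thesis by (cases x rule: rev_cases) (auto simp: queue_step_def)
next
  case False
  then show ?thesis by (cases x) (auto simp: queue_step_def)
qed

lemma queue_step_star: "queue_step (i, j, \<not> b) y = Some x \<longleftrightarrow> queue_step (i, j, b) x = Some y"
  by (auto simp: queue_step_Some)

lemma queue_run_wstar: "queue_run (wstar w) y = Some x \<longleftrightarrow> queue_run w x = Some y"
proof (induction w arbitrary: y)
  case (Cons l w)
  obtain i j b where l: "l = (i, j, b)" by (cases l)
  have "wstar (l # w) = wstar w @ [(i, j, \<not> b)]" by (simp add: wstar_def l)
  then show ?case using Cons
    by (auto simp: queue_run_append queue_run_Cons bind_eq_Some_conv l queue_step_star)
qed (auto simp: wstar_def)

section \<open>Degree and normalised traces\<close>

definition deg :: "'n ulet list \<Rightarrow> int" where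
  "deg w = (\<Sum>l\<leftarrow>w. if snd (snd l) then 1 else - 1)"

lemma deg_simps [simp]:
  "deg [] = 0" "deg ((i, j, b) # w) = (if b then 1 else - 1) + deg w" "deg (v @ w) = deg v + deg w"
  by (simp_all add: deg_def)

lemma deg_wstar: "deg (wstar w) = - deg w"
  by (induction w) (auto simp: wstar_def)

lemma deg_cong: "map snd v = map snd w \<Longrightarrow> deg v = deg w"
proof -
  have "deg w = (\<Sum>l\<leftarrow>map snd w. if snd l then 1 else - 1)" for w :: "'n ulet list"
    by (simp add: deg_def comp_def)
  then show "map snd v = map snd w \<Longrightarrow> deg v = deg w" by metis
qed

definition fixed :: "nat \<Rightarrow> 'n::finite ulet list \<Rightarrow> 'n list set" where
  "fixed m w = {x \<in> lists_of_length m. queue_run w x = Some x}"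

lemma finite_fixed [simp]: "finite (fixed m w)" by (simp add: fixed_def)

text \<open>Partial injections are 0/1 matrices, so the trace counts fixed queues. The value 0 off
  degree zero models the shift, whose nonzero powers have trace zero; a queue of fixed length can
  have fixed points there, such as constant queues.\<close>

definition queue_trace :: "nat \<Rightarrow> 'n::finite ufun" where
  "queue_trace m w = (if deg w = 0 then of_nat (card (fixed m w)) / of_nat (card (UNIV :: 'n set)) ^ m else 0)"

lemma queue_trace_tracial: "queue_trace m (v @ w) = queue_trace m (w @ v)"
proof -
  have "bij_betw (\<lambda>x. the (queue_run w x)) (fixed m (v @ w)) (fixed m (w @ v))"
    by (rule bij_betw_byWitness[where f' = "\<lambda>y. the (queue_run v y)"])
      (auto simp: fixed_def queue_run_append bind_eq_Some_conv dest: queue_run_length)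
  then have "card (fixed m (v @ w)) = card (fixed m (w @ v))" by (rule bij_betw_same_card)
  then show ?thesis by (simp add: queue_trace_def add.commute)
qed

lemma sum_card_fibres:
  assumes "finite A"
  shows "(\<Sum>k\<in>(UNIV :: 'n::finite set). card {x \<in> A. f x = k}) = card A"
  using sum.group[of A UNIV f "\<lambda>_. 1 :: nat"] assms by simp

text \<open>The middle word tests one end of the queue against k and restores it. Over all k these
  tests partition the fixed queues of \<open>p @ q\<close>.\<close>

lemma queue_trace_rel:
  fixes p q :: "'n::finite ulet list" and mid :: "'n \<Rightarrow> 'n ulet list"
  assumes m: "m > 0"
    and queue_run: "\<And>k y. length y = m \<Longrightarrow> queue_run (mid k) y = (if g y = k \<and> i = j then Some y else None)"
    and deg: "\<And>k. deg (mid k) = 0"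
  shows "(\<Sum>k\<in>UNIV. queue_trace m (p @ mid k @ q)) = (if (i :: 'n) = j then queue_trace m (p @ q) else 0)"
proof -
  let ?f = "\<lambda>x. g (the (queue_run q x))"
  have fixed_mid: "fixed m (p @ mid k @ q) = (if i = j then {x \<in> fixed m (p @ q). ?f x = k} else {})" for k
  proof -
    have "queue_run (p @ mid k @ q) x = Some x \<longleftrightarrow> i = j \<and> queue_run (p @ q) x = Some x \<and> ?f x = k" if "length x = m" for x
    proof (cases "queue_run q x")
      case (Some y)
      then have "length y = m" using queue_run_length that by blast
      then show ?thesis using Some queue_run[of y k] by (auto simp: queue_run_append)
    qed (simp add: queue_run_append)
    then show ?thesis by (auto simp: fixed_def)
  qed
  show ?thesis
  proof (cases "i = j \<and> deg (p @ q) = 0")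
    case True
    have "(\<Sum>k\<in>UNIV. of_nat (card {x \<in> fixed m (p @ q). ?f x = k})) = (of_nat (card (fixed m (p @ q))) :: complex)"
      by (simp only: sum_card_fibres[OF finite_fixed] flip: of_nat_sum)
    then show ?thesis using True deg by (simp add: queue_trace_def fixed_mid flip: sum_divide_distrib)
  next
    case False
    then have "queue_trace m (p @ mid k @ q) = 0" for k using deg fixed_mid[of k] by (auto simp: queue_trace_def)
    then show ?thesis using False by (auto simp: queue_trace_def)
  qed
qed

lemma queue_trace_relations:
  fixes p q :: "'n::finite ulet list"
  assumes m: "m > 0"
  shows "(\<Sum>k\<in>UNIV. queue_trace m (p @ [(k, i, True), (k, j, False)] @ q)) = (if i = j then queue_trace m (p @ q) else 0)"
    and "(\<Sum>k\<in>UNIV. queue_trace m (p @ [(i, k, False), (j, k, True)] @ q)) = (if i = j then queue_trace m (p @ q) else 0)"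
proof -
  show "(\<Sum>k\<in>UNIV. queue_trace m (p @ [(k, i, True), (k, j, False)] @ q)) = (if i = j then queue_trace m (p @ q) else 0)"
  proof (rule queue_trace_rel[OF m, where g = hd])
    fix k and y :: "'n list" assume "length y = m"
    then have "y \<noteq> []" using m by auto
    then show "queue_run [(k, i, True), (k, j, False)] y = (if hd y = k \<and> i = j then Some y else None)"
      by (cases y) (auto simp: queue_run_Cons queue_step_def)
  qed simp
  show "(\<Sum>k\<in>UNIV. queue_trace m (p @ [(i, k, False), (j, k, True)] @ q)) = (if i = j then queue_trace m (p @ q) else 0)"
  proof (rule queue_trace_rel[OF m, where g = last])
    fix k and y :: "'n list" assume "length y = m"
    then have "y \<noteq> []" using m by auto
    then show "queue_run [(i, k, False), (j, k, True)] y = (if last y = k \<and> i = j then Some y else None)"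
      by (cases y rule: rev_cases) (auto simp: queue_run_Cons queue_step_def)
  qed simp
qed

text \<open>The vectors are the matrices of the partial injections, scaled by the square root of the
  normalisation. The degree is kept as a third coordinate to make words of different degree
  orthogonal.\<close>

lemma queue_trace_gram:
  fixes W :: "'n::finite ulet list set"
  assumes W: "finite W"
  shows "\<exists>(S :: ('n list \<times> 'n list \<times> int) set) \<xi>. finite S \<and>
    (\<forall>v\<in>W. \<forall>w\<in>W. queue_trace m (wstar v @ w) = (\<Sum>a\<in>S. cnj (\<xi> v a) * \<xi> w a))"
proof -
  let ?n = "real (card (UNIV :: 'n set)) ^ m"
  let ?S = "lists_of_length m \<times> lists_of_length m \<times> deg ` W :: ('n list \<times> 'n list \<times> int) set"
  let ?P = "\<lambda>w (x, y, d). queue_run w x = Some y \<and> deg w = d"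
  let ?\<xi> = "\<lambda>w a. if ?P w a then complex_of_real (1 / sqrt ?n) else 0"
  have n0: "card (UNIV :: 'n set) > 0" by (simp add: card_gt_0_iff)
  have "queue_trace m (wstar v @ w) = (\<Sum>a\<in>?S. cnj (?\<xi> v a) * ?\<xi> w a)" if "v \<in> W" "w \<in> W" for v w
  proof -
    have sq: "complex_of_real (1 / sqrt ?n) * complex_of_real (1 / sqrt ?n) = 1 / of_nat (card (UNIV :: 'n set)) ^ m"
      by (simp flip: of_real_mult real_sqrt_mult) 
    have "(\<Sum>a\<in>?S. cnj (?\<xi> v a) * ?\<xi> w a)
       = (\<Sum>a\<in>?S. if ?P v a \<and> ?P w a then 1 / of_nat (card (UNIV :: 'n set)) ^ m else 0)"
      by (intro sum.cong refl) (auto simp: sq simp del: of_real_divide)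
    also have "\<dots> = of_nat (card {a \<in> ?S. ?P v a \<and> ?P w a}) / of_nat (card (UNIV :: 'n set)) ^ m"
      using W by (subst sum.inter_filter[symmetric]) simp_all
    also have "\<dots> = queue_trace m (wstar v @ w)"
    proof (cases "deg v = deg w")
      case True
      have "bij_betw fst {a \<in> ?S. ?P v a \<and> ?P w a} (fixed m (wstar v @ w))"
        using that True
        by (intro bij_betw_byWitness[where f' = "\<lambda>x. (x, the (queue_run w x), deg w)"])
          (auto simp: fixed_def queue_run_append bind_eq_Some_conv queue_run_wstar queue_run_length)
      then have "card {a \<in> ?S. ?P v a \<and> ?P w a} = card (fixed m (wstar v @ w))"
        by (rule bij_betw_same_card)
      then show ?thesis using True by (simp add: queue_trace_def deg_wstar)
    next
      case False
      then have eq: "{a \<in> ?S. ?P v a \<and> ?P w a} = {}" by auto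
      show ?thesis unfolding eq using False by (simp add: queue_trace_def deg_wstar)
    qed
    finally show ?thesis by simp
  qed
  then show ?thesis using W by (intro exI[of _ ?S] exI[of _ ?\<xi>]) simp
qed

subsection \<open>Words whose queue splits into two stacks\<close>

definition front_step :: "'n ulet \<Rightarrow> 'n list \<Rightarrow> 'n list option" where
  "front_step l L = (case l of (i, j, b) \<Rightarrow>
     if b then Some (i # L) else if L \<noteq> [] \<and> hd L = i then Some (tl L) else None)"

definition back_step :: "'n \<times> bool \<Rightarrow> 'n list \<Rightarrow> 'n list option" where
  "back_step l R = (case l of (j, b) \<Rightarrow>
     if b then if R \<noteq> [] \<and> last R = j then Some (butlast R) else None else Some (R @ [j]))"

definition front_run :: "'n ulet list \<Rightarrow> 'n list option" where
  "front_run w = foldr (\<lambda>l r. Option.bind r (front_step l)) w (Some [])"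

definition back_run :: "('n \<times> bool) list \<Rightarrow> 'n list \<Rightarrow> 'n list option" where
  "back_run js R = foldr (\<lambda>l r. Option.bind r (back_step l)) js (Some R)"

lemma front_back_run_simps [simp]:
  "front_run [] = Some []" "front_run (l # w) = Option.bind (front_run w) (front_step l)"
  "back_run [] R = Some R" "back_run (l' # js) R = Option.bind (back_run js R) (back_step l')"
  by (simp_all add: front_run_def back_run_def)

lemma front_run_length: "front_run w = Some L \<Longrightarrow> int (length L) = deg w"
proof (induction w arbitrary: L)
  case (Cons l w)
  obtain i j b where l: "l = (i, j, b)" by (cases l)
  obtain L' where L': "front_run w = Some L'" "front_step l L' = Some L"
    using Cons.prems by (auto simp: bind_eq_Some_conv)
  have "int (length L') = deg w" using Cons.IH L' by simp
  then show ?case using L'(2) by (cases L') (auto simp: l front_step_def split: if_splits)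
qed simp

lemma back_run_length: "back_run (map snd w) R = Some R' \<Longrightarrow> int (length R') = int (length R) - deg w"
proof (induction w arbitrary: R')
  case (Cons l w)
  obtain i j b where l: "l = (i, j, b)" by (cases l)
  obtain R'' where R'': "back_run (map snd w) R = Some R''" "back_step (snd l) R'' = Some R'"
    using Cons.prems by (auto simp: bind_eq_Some_conv)
  have "int (length R'') = int (length R) - deg w" using Cons.IH R'' by simp
  then show ?case using R''(2) by (cases R'' rule: rev_cases) (auto simp: l back_step_def split: if_splits)
qed simp

text \<open>Letters act from the right end of the word, so the degree of a suffix is the height of
  the front stack once that suffix has acted.\<close>

definition suffix_nonneg :: "'n ulet list \<Rightarrow> bool" where
  "suffix_nonneg w \<longleftrightarrow> (\<forall>k. deg (drop k w) \<ge> 0)"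

lemma all_nat_split: "(\<forall>k. P k) \<longleftrightarrow> P 0 \<and> (\<forall>k. P (Suc k))"
  using not0_implies_Suc by metis

lemma suffix_nonneg_Cons: "suffix_nonneg (l # w) \<longleftrightarrow> deg (l # w) \<ge> 0 \<and> suffix_nonneg w"
  unfolding suffix_nonneg_def by (subst all_nat_split) simp

lemma deg_le_length: "deg w \<le> int (length w)"
  by (induction w) auto

text \<open>Every unstarred letter finds a front entry pushed by a starred letter to its right, and
  a queue as long as the word is never exhausted from the back, so the ends act as independent
  stacks.\<close>

lemma queue_run_split:
  "suffix_nonneg w \<Longrightarrow> length w \<le> length R \<Longrightarrow>
    queue_run w R = Option.bind (front_run w) (\<lambda>L. Option.bind (back_run (map snd w) R) (\<lambda>R'. Some (L @ R')))"
proof (induction w)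
  case (Cons l w)
  obtain i j b where l: "l = (i, j, b)" by (cases l)
  have IH: "queue_run w R = Option.bind (front_run w) (\<lambda>L. Option.bind (back_run (map snd w) R) (\<lambda>R'. Some (L @ R')))"
    using Cons by (simp add: suffix_nonneg_Cons)
  show ?case
  proof (cases "front_run w")
    case None
    then show ?thesis using IH by (simp add: queue_run_Cons)
  next
    case (Some L)
    note L = this
    show ?thesis
    proof (cases "back_run (map snd w) R")
      case None
      then show ?thesis using IH L by (cases "front_step l L") (simp_all add: queue_run_Cons)
    next
      case (Some R')
      have "int (length R') = int (length R) - deg w" using back_run_length[OF Some] .
      \<comment> \<open>\<open>R\<close> is longer than the tail w, and w lowers the back stack by
        at most its length.\<close>
      then have "R' \<noteq> []" using Cons.prems(2) deg_le_length[of w] by auto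
      moreover have "\<not> b \<Longrightarrow> L \<noteq> []"
        using front_run_length[OF L] Cons.prems(1) by (auto simp: suffix_nonneg_Cons l)
      ultimately show ?thesis using IH L Some
        by (auto simp: queue_run_Cons l queue_step_def front_step_def back_step_def butlast_append)
    qed
  qed
qed simp

definition matched :: "'n ulet list \<Rightarrow> complex" where
  "matched w = (if front_run w = Some [] then 1 else 0)"

definition back_fixed :: "nat \<Rightarrow> ('n::finite \<times> bool) list \<Rightarrow> 'n list set" where
  "back_fixed m js = {x \<in> lists_of_length m. back_run js x = Some x}"

text \<open>Degree zero leaves the front stack empty, so the back stack must restore the queue
  alone. The first factor depends on first indices and flags, the second only on
  \<open>map snd w\<close>, which left convolution does not change.\<close>

lemma queue_trace_split:
  fixes w :: "'n::finite ulet list"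
  assumes "suffix_nonneg w" "deg w = 0" "length w \<le> m"
  shows "queue_trace m w = matched w * (of_nat (card (back_fixed m (map snd w))) / of_nat (card (UNIV :: 'n set)) ^ m)"
proof -
  have "queue_run w x = Some x \<longleftrightarrow> front_run w = Some [] \<and> back_run (map snd w) x = Some x" if "length x = m" for x
  proof (cases "front_run w")
    case (Some L)
    then have "L = []" using front_run_length[OF Some] assms(2) by simp
    then show ?thesis using Some queue_run_split[OF assms(1), of x] assms(3) that
      by (auto simp: bind_eq_Some_conv)
  qed (use queue_run_split[OF assms(1), of x] assms(3) that in simp)
  then have "fixed m w = (if front_run w = Some [] then back_fixed m (map snd w) else {})"
    by (auto simp: fixed_def back_fixed_def)
  then show ?thesis using assms(2) by (simp add: queue_trace_def matched_def)
qed

section \<open>Independence of the queue length\<close>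

lemma back_run_Cons_stack:
  fixes w :: "'n ulet list"
  shows "length w \<le> length x \<Longrightarrow> back_run (map snd w) (a # x) = map_option ((#) a) (back_run (map snd w) x)"
proof (induction w)
  case (Cons l w)
  obtain i j b where l: "l = (i, j, b)" by (cases l)
  show ?case
  proof (cases "back_run (map snd w) x")
    case (Some R')
    have "int (length R') = int (length x) - deg w" using back_run_length[OF Some] .
    then have "R' \<noteq> []" using Cons.prems deg_le_length[of w] by auto
    then show ?thesis using Cons Some by (auto simp: l back_step_def)
  qed (use Cons in simp)
qed simp

text \<open>The extra entry lies below everything the word can reach, so it is arbitrary.\<close>

lemma card_back_fixed_Suc:
  fixes w :: "'n::finite ulet list"
  assumes "length w \<le> m"
  shows "card (back_fixed (Suc m) (map snd w)) = card (UNIV :: 'n set) * card (back_fixed m (map snd w))"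
proof -
  have "back_fixed (Suc m) (map snd w) = (\<lambda>(a, x). a # x) ` (UNIV \<times> back_fixed m (map snd w))"
  proof (intro equalityI subsetI)
    fix y assume y: "y \<in> back_fixed (Suc m) (map snd w)"
    then obtain a x where "y = a # x" "length x = m" by (auto simp: back_fixed_def length_Suc_conv)
    moreover from this have "back_run (map snd w) x = Some x"
      using y assms back_run_Cons_stack[of w x a] by (auto simp: back_fixed_def)
    ultimately show "y \<in> (\<lambda>(a, x). a # x) ` (UNIV \<times> back_fixed m (map snd w))"
      by (force simp: back_fixed_def)
  qed (use assms back_run_Cons_stack[of w] in \<open>auto simp: back_fixed_def\<close>)
  moreover have "inj_on (\<lambda>(a, x). a # x) (UNIV \<times> back_fixed m (map snd w))"
    by (auto simp: inj_on_def)
  ultimately show ?thesis by (simp add: card_image card_cartesian_product)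
qed

text \<open>The argument of the cycle lemma: cut where the degree of the suffix is least.\<close>

lemma rotate_suffix_nonneg:
  assumes "deg w = 0"
  obtains u v where "w = u @ v" "suffix_nonneg (v @ u)"
proof -
  let ?S = "\<lambda>k. deg (drop k w)"
  have "Min (?S ` {..length w}) \<in> ?S ` {..length w}" by (intro Min_in) auto
  then obtain k0 where k0: "k0 \<le> length w" "?S k0 = Min (?S ` {..length w})" by force
  have min: "?S k0 \<le> ?S k" for k
  proof (cases "k \<le> length w")
    case False
    then have "?S k = ?S (length w)" by simp
    then show ?thesis unfolding k0(2) by (metis Min_le atMost_iff finite_atMost finite_imageI imageI order_refl)
  qed (auto simp: k0(2))
  let ?u = "take k0 w" and ?v = "drop k0 w"
  have du: "deg ?u = - ?S k0"
    using assms deg_simps(3)[of ?u ?v] by simp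
  have "deg (drop k (?v @ ?u)) \<ge> 0" for k
  proof (cases "k \<le> length ?v")
    case True
    then show ?thesis using min[of "k0 + k"] du by (simp add: add.commute)
  next
    case False
    let ?k = "k - length ?v"
    have "deg (drop ?k ?u) \<ge> 0"
    proof (cases "?k \<le> k0")
      case True
      have "drop ?k w = drop ?k ?u @ ?v"
        using True k0(1) by (metis append_take_drop_id drop_append length_take min.absorb2 diff_is_0_eq drop0)
      then show ?thesis using min[of ?k] by simp
    qed simp
    then show ?thesis using False by simp
  qed
  then have "suffix_nonneg (?v @ ?u)" unfolding suffix_nonneg_def by blast
  then show ?thesis using that[of ?u ?v] by simp
qed

lemma queue_trace_Suc:
  fixes w :: "'n::finite ulet list"
  assumes "length w \<le> m"
  shows "queue_trace (Suc m) w = queue_trace m w"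
proof (cases "deg w = 0")
  case True
  then obtain u v where uv: "w = u @ v" "suffix_nonneg (v @ u)" by (rule rotate_suffix_nonneg)
  have n0: "card (UNIV :: 'n set) > 0" by (simp add: card_gt_0_iff)
  have "queue_trace (Suc m) (v @ u) = queue_trace m (v @ u)"
    using uv True assms n0 card_back_fixed_Suc[of "v @ u" m]
    by (simp add: queue_trace_split add.commute)
  then show ?thesis using queue_trace_tracial[of _ u v] by (simp add: uv)
qed (simp add: queue_trace_def)

text \<open>The limit over queue lengths is attained at the length of the word, so no convergence is
  involved.\<close>

lemma queue_trace_stable:
  assumes "length w \<le> m"
  shows "queue_trace m w = queue_trace (length w) w"
  using assms by (induction m rule: dec_induct) (simp_all add: queue_trace_Suc)

subsection \<open>Left invariance\<close>

lemma front_run_append: "front_run (p @ q) = foldr (\<lambda>l r. Option.bind r (front_step l)) p (front_run q)"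
  by (simp add: front_run_def)

text \<open>The starred letter pushes i', which the unstarred letter before it pops when i =
  i'.\<close>

lemma matched_peak: "matched (p @ [(i, j, False), (i', j', True)] @ q) = (if i = i' then matched (p @ q) else 0)"
proof -
  have "front_run ([(i, j, False), (i', j', True)] @ q) = (if i = i' then front_run q else None)"
    by (cases "front_run q") (auto simp: front_step_def)
  moreover have "foldr (\<lambda>l r. Option.bind r (front_step l)) p None = None"
    by (induction p) simp_all
  ultimately show ?thesis unfolding matched_def front_run_append[of p] by auto
qed

text \<open>The rightmost unstarred letter would either pop from the empty stack or stand directly
  before a starred letter.\<close>

lemma front_run_no_peak:
  assumes "\<nexists>p q. map (snd \<circ> snd) w = p @ [False, True] @ q" "front_run w = Some L"
  shows "list_all (snd \<circ> snd) w"
  using assms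
proof (induction w arbitrary: L)
  case (Cons l w)
  obtain L' where L': "front_run w = Some L'" "front_step l L' = Some L"
    using Cons.prems by (auto simp: bind_eq_Some_conv)
  have "\<nexists>p q. map (snd \<circ> snd) w = p @ [False, True] @ q"
    using Cons.prems(1) by (metis append_Cons list.simps(9))
  then have all: "list_all (snd \<circ> snd) w" using Cons.IH L' by blast
  have "snd (snd l)"
  proof (rule ccontr)
    assume F: "\<not> snd (snd l)"
    show False
    proof (cases w)
      case Nil
      then show ?thesis using L' F by (auto simp: front_step_def split: prod.splits)
    next
      case (Cons x w')
      then have "map (snd \<circ> snd) (l # w) = [] @ [False, True] @ map (snd \<circ> snd) w'"
        using F all by simp
      then show ?thesis using \<open>\<nexists>p q. map (snd \<circ> snd) (l # w) = p @ [False, True] @ q\<close> by blast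
    qed
  qed
  then show ?case using all by (simp add: comp_def)
qed simp

lemma matched_no_peak:
  assumes "\<nexists>p q. map (snd \<circ> snd) w = p @ [False, True] @ q" "w \<noteq> []"
  shows "matched w = 0"
proof (rule ccontr)
  assume "matched w \<noteq> 0"
  then have r: "front_run w = Some []" by (auto simp: matched_def split: if_splits)
  then have "deg w = 0" using front_run_length[OF r] by simp
  moreover have "list_all (snd \<circ> snd) w \<Longrightarrow> deg w = int (length w)" by (induction w) auto
  ultimately show False using front_run_no_peak[OF assms(1) r] assms(2) by simp
qed

text \<open>Induction by deleting a peak. In the second factor the peak forces equal summation
  indices, and the remaining sum for f is an instance of the relation, giving the same test i = i'
  as \<open>matched_peak\<close>.\<close>

lemma tensor_conv_matched:
  fixes f :: "'n::finite ufun"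
  assumes f: "is_state f"
  shows "tensor_conv f matched w = matched w"
proof (induction "length w" arbitrary: w rule: less_induct)
  case less
  show ?case
  proof (cases "\<exists>p q. map (snd \<circ> snd) w = p @ [False, True] @ q")
    case False
    show ?thesis
    proof (cases "w = []")
      case True
      then show ?thesis using f by (simp add: tensor_conv_def is_state_def)
    next
      case ne: False
      have "matched (snd_word w ks) = 0" if "length ks = length w" for ks
      proof (rule matched_no_peak)
        have "map (snd \<circ> snd) (snd_word w ks) = map (snd \<circ> snd) w"
          using map_snd_snd_word[OF that] by (metis map_map)
        then show "\<nexists>p q. map (snd \<circ> snd) (snd_word w ks) = p @ [False, True] @ q" using False by simp
        show "snd_word w ks \<noteq> []" using ne length_snd_word[OF that] by (metis length_0_conv)
      qed
      then show ?thesis using matched_no_peak[OF False ne] by (simp add: tensor_conv_def)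
    qed
  next
    case True
    then obtain p i j i' j' q where w: "w = p @ [(i, j, False), (i', j', True)] @ q"
      by (auto simp: map_eq_append_conv map_eq_Cons_conv) 
    let ?f = "\<lambda>us k k' vs. f (fst_word p us @ [(i, k, False), (i', k', True)] @ fst_word q vs)"
    have rel: "(\<Sum>k\<in>UNIV. ?f us k k vs) = (if i = i' then f (fst_word p us @ fst_word q vs) else 0)" for us vs
      using f unfolding is_state_def vanishes_on_relations_def by blast
    have len: "length w = length p + Suc (Suc (length q))" by (simp add: w)
    have "tensor_conv f matched w = (\<Sum>us\<in>lists_of_length (length p). \<Sum>k\<in>UNIV. \<Sum>k'\<in>UNIV. \<Sum>vs\<in>lists_of_length (length q).
        f (fst_word w (us @ k # k' # vs)) * matched (snd_word w (us @ k # k' # vs)))"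
      unfolding tensor_conv_def len sum_lists_of_length_add sum_lists_of_length_Suc ..
    also have "\<dots> = (\<Sum>us\<in>lists_of_length (length p). \<Sum>k\<in>UNIV. \<Sum>k'\<in>UNIV. \<Sum>vs\<in>lists_of_length (length q).
        if k' = k then ?f us k k vs * matched (snd_word p us @ snd_word q vs) else 0)"
    proof (intro sum.cong refl)
      fix us vs :: "'n list" and k k' assume "us \<in> lists_of_length (length p)" "vs \<in> lists_of_length (length q)"
      then have "fst_word w (us @ k # k' # vs) = fst_word p us @ [(i, k, False), (i', k', True)] @ fst_word q vs"
        "snd_word w (us @ k # k' # vs) = snd_word p us @ [(k, j, False), (k', j', True)] @ snd_word q vs"
        unfolding w by (simp_all add: fst_snd_word_append)
      then show "f (fst_word w (us @ k # k' # vs)) * matched (snd_word w (us @ k # k' # vs))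
        = (if k' = k then ?f us k k vs * matched (snd_word p us @ snd_word q vs) else 0)"
        by (simp only: matched_peak) auto
    qed
    also have "\<dots> = (\<Sum>us\<in>lists_of_length (length p). \<Sum>k\<in>UNIV. \<Sum>vs\<in>lists_of_length (length q). ?f us k k vs * matched (snd_word p us @ snd_word q vs))"
      by (intro sum.cong refl, subst sum.swap) simp
    also have "\<dots> = (\<Sum>us\<in>lists_of_length (length p). \<Sum>vs\<in>lists_of_length (length q). (\<Sum>k\<in>UNIV. ?f us k k vs) * matched (snd_word p us @ snd_word q vs))"
      unfolding sum_distrib_right by (intro sum.cong refl sum.swap)
    \<comment> \<open>The relation deletes the peak from the word of f, so both factors now run over
      \<open>p @ q\<close>.\<close>
    also have "\<dots> = (if i = i' then tensor_conv f matched (p @ q) else 0)"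
      unfolding rel by (simp add: tensor_conv_def sum_lists_of_length_add fst_snd_word_append)
    also have "\<dots> = matched w"
      using less[of "p @ q"] by (simp add: w matched_peak[of p, simplified])
    finally show ?thesis .
  qed
qed

text \<open>Traciality of both functionals permits the rotation; afterwards the back factor is a
  constant that leaves the sum.\<close>

lemma tensor_conv_queue_trace:
  fixes f :: "'n::finite ufun"
  assumes f: "is_state f" "is_tracial f" and m: "length w \<le> m"
  shows "tensor_conv f (queue_trace m) w = queue_trace m w"
proof (cases "deg w = 0")
  case False
  then have "queue_trace m (snd_word w ks) = 0" if "length ks = length w" for ks
    using deg_cong[OF map_snd_snd_word[OF that]] by (simp add: queue_trace_def)
  then show ?thesis using False by (simp add: tensor_conv_def queue_trace_def)
next
  case True
  then obtain u v where uv: "w = u @ v" "suffix_nonneg (v @ u)" by (rule rotate_suffix_nonneg)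
  let ?w = "v @ u"
  let ?J = "of_nat (card (back_fixed m (map snd ?w))) / of_nat (card (UNIV :: 'n set)) ^ m :: complex"
  have len: "length ?w \<le> m" and deg: "deg ?w = 0" using m True by (simp_all add: uv)
  have "queue_trace m (snd_word ?w ks) = matched (snd_word ?w ks) * ?J" if ks: "length ks = length ?w" for ks
  proof -
    have s: "map snd (snd_word ?w ks) = map snd ?w" by (rule map_snd_snd_word[OF ks])
    have "deg (drop k (snd_word ?w ks)) = deg (drop k ?w)" for k
      by (rule deg_cong) (metis drop_map s)
    then have "suffix_nonneg (snd_word ?w ks)" using uv(2) by (simp only: suffix_nonneg_def) simp
    then show ?thesis
      using queue_trace_split[of "snd_word ?w ks" m] deg_cong[OF s] deg len ks s by simp
  qed
  then have "tensor_conv f (queue_trace m) ?w = tensor_conv f matched ?w * ?J"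
    unfolding tensor_conv_def sum_distrib_right by (intro sum.cong refl) (simp only: mem_Collect_eq mult.assoc)
  also have "\<dots> = queue_trace m ?w"
    using queue_trace_split[OF uv(2) deg len] by (simp add: tensor_conv_matched[OF f(1)])
  finally have "tensor_conv f (queue_trace m) ?w = queue_trace m ?w" .
  moreover have "is_tracial (queue_trace m :: 'n ufun)" unfolding is_tracial_def using queue_trace_tracial by blast
  ultimately show ?thesis using tensor_conv_rotate[OF f(2), of "queue_trace m" u v] queue_trace_tracial[of m u v] by (simp add: uv)
qed

definition tensor_haar :: "'n::finite ufun" where "tensor_haar w = queue_trace (length w) w"

lemma tensor_haar_queue_trace: "length w \<le> m \<Longrightarrow> tensor_haar w = queue_trace m w"
  using queue_trace_stable[of w m] by (simp add: tensor_haar_def)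

lemma tensor_haar_tracial: "is_tracial tensor_haar"
  unfolding is_tracial_def
proof (intro allI)
  fix v w :: "'a ulet list"
  show "tensor_haar (v @ w) = tensor_haar (w @ v)"
    using queue_trace_tracial[of "length (v @ w)" v w] by (simp add: tensor_haar_def add.commute)
qed

lemma tensor_haar_state: "is_state (tensor_haar :: 'n::finite ufun)"
proof -
  have "vanishes_on_relations (tensor_haar :: 'n ufun)"
    unfolding vanishes_on_relations_def
  proof (intro conjI allI)
    fix p q :: "'n ulet list" and i j
    \<comment> \<open>One queue length for all words of the relation; it is at least the longest of
      them and positive.\<close>
    let ?m = "length p + length q + 2"
    show "(\<Sum>k\<in>UNIV. tensor_haar (p @ [(k, i, True), (k, j, False)] @ q)) = (if i = j then tensor_haar (p @ q) else 0)"
      using queue_trace_relations(1)[of ?m p i j q] by (simp add: tensor_haar_queue_trace[of _ ?m])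
    show "(\<Sum>k\<in>UNIV. tensor_haar (p @ [(i, k, False), (j, k, True)] @ q)) = (if i = j then tensor_haar (p @ q) else 0)"
      using queue_trace_relations(2)[of ?m p i j q] by (simp add: tensor_haar_queue_trace[of _ ?m])
  qed
  moreover have "(tensor_haar :: 'n ufun) [] = 1"
    by (simp add: tensor_haar_def queue_trace_def fixed_def cong: conj_cong)
  moreover have "Im (lin (tensor_haar :: 'n ufun) (pmul (pstar p) p)) = 0 \<and> 0 \<le> Re (lin (tensor_haar :: 'n ufun) (pmul (pstar p) p))" for p
  proof (rule positive_if_gram)
    fix W :: "'n ulet list set" assume W: "finite W"
    \<comment> \<open>Twice the maximal length bounds every \<open>wstar v @ w\<close>, so all
      entries of the Gram matrix come from one queue.\<close>
    let ?M = "Max (length ` W)"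
    have "length w \<le> ?M" if "w \<in> W" for w using W that by simp
    then have "tensor_haar (wstar v @ w) = queue_trace (?M + ?M) (wstar v @ w)" if "v \<in> W" "w \<in> W" for v w
      using that by (intro tensor_haar_queue_trace) (simp add: wstar_def add_mono)
    then show "\<exists>(S :: ('n list \<times> 'n list \<times> int) set) \<xi>. finite S \<and>
      (\<forall>v\<in>W. \<forall>w\<in>W. tensor_haar (wstar v @ w) = (\<Sum>a\<in>S. cnj (\<xi> v a) * \<xi> w a))"
      using queue_trace_gram[OF W, of "?M + ?M"] by auto
  qed
  ultimately show ?thesis by (simp add: is_state_def)
qed

lemma tensor_haar_trace: "haar_trace tensor_prod (tensor_haar :: 'n::finite ufun)"
proof (rule haar_trace_if_left_invariant)
  fix f :: "'n ufun" assume f: "is_state f" "is_tracial f"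
  have "conv tensor_prod f tensor_haar = tensor_conv f tensor_haar"
    using f tensor_haar_state[where 'n = 'n] by (intro conv_tensor) (simp_all add: is_state_def)
  also have "\<dots> = tensor_haar"
  proof
    fix w :: "'n ulet list"
    have "tensor_conv f tensor_haar w = tensor_conv f (queue_trace (length w)) w"
      unfolding tensor_conv_def by (intro sum.cong refl) (simp add: tensor_haar_def)
    then show "tensor_conv f tensor_haar w = tensor_haar w"
      using tensor_conv_queue_trace[OF f, of w "length w"] by (simp add: tensor_haar_def)
  qed
  finally show "conv tensor_prod f tensor_haar = tensor_haar" .
qed (simp_all add: conv_tensor_antipode_dual tensor_haar_state tensor_haar_tracial)

theorem mainTheorem2:
  shows "(card (UNIV :: 'n set) \<ge> 2 \<longrightarrow>
            (\<nexists>h :: 'n ufun. haar_trace boolean_prod h) \<and>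
            (\<nexists>h :: 'n ufun. haar_trace monotone_prod h) \<and>
            (\<nexists>h :: 'n ufun. haar_trace antimonotone_prod h)) \<and>
         (\<exists>h :: ('n::finite) ufun. haar_trace free_prod h) \<and>
         (\<exists>h :: 'n ufun. haar_trace tensor_prod h)"
proof (intro conjI impI)
  assume n: "card (UNIV :: 'n set) \<ge> 2"
  show "\<nexists>h :: 'n ufun. haar_trace boolean_prod h"
    and "\<nexists>h :: 'n ufun. haar_trace monotone_prod h"
    and "\<nexists>h :: 'n ufun. haar_trace antimonotone_prod h"
    using no_haar_boolean[OF n] no_haar_monotone[OF n] no_haar_antimonotone[OF n] by simp_all
qed (use free_haar_trace tensor_haar_trace in blast)+

end
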